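(* For any nonnegative integer $d$ the $\mathfrak{gl}_\infty$-module $\mathbf V^{\otimes d}$, regarded as an $\mathfrak{sp}_\infty$-module, has Loewy length $\left[\frac d2\right]+1$, and $$\operatorname{soc}^{(r)}\mathbf V^{\otimes d}=\bigcap_{I_1,\dots,I_r}\ker\Big(\Phi_{\langle I_1,\dots,I_r\rangle}:\mathbf V^{\otimes d}\to\mathbf V^{\otimes(d-2r)}\Big),\qquad r=1,\dots,\left[\tfrac d2\right],$$ where the intersection is over all collections of $r$ pairwise disjoint index pairs.
   Context: $\Bbbk$ is a field of characteristic zero; everything is over $\Bbbk$. $[x]$ denotes the integer part of $x$. Let $\mathbf V$ be a countably infinite-dimensional vector space with a non-degenerate antisymmetric bilinear form $\Omega:\mathbf V\otimes\mathbf V\to\Bbbk$. $\mathfrak{gl}_\infty$ is the Lie algebra of operators on $\mathbf V$ spanned by $u\otimes w:\ v\mapsto\Omega(v,w)u$ ($u,w\in\mathbf V$), and $\mathfrak{sp}_\infty=\{X\in\mathfrak{gl}_\infty:\Omega(Xu,v)+\Omega(u,Xv)=0\ \forall u,v\in\mathbf V\}$. Both act on $\mathbf V^{\otimes d}$ by the Leibniz rule. An index pair is $I=(i,j)$ with $1\le i<j\le d$. For pairwise disjoint index pairs $I_1=(i_1,j_1),\dots,I_r=(i_r,j_r)$ (all $2r$ indices distinct), $\Phi_{\langle I_1,\dots,I_r\rangle}:\mathbf V^{\otimes d}\to\mathbf V^{\otimes(d-2r)}$ is the $r$-fold contraction sending $v_1\otimes\dots\otimes v_d$ to $\prod_k\Omega(v_{i_k},v_{j_k})$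 times the tensor obtained by omitting all $v_{i_k},v_{j_k}$. For a finite length module $M$, $\operatorname{soc}M$ is the sum of all simple submodules; the socle filtration is defined by $\operatorname{soc}^{(0)}M=0$ and $\operatorname{soc}^{(i+1)}M/\operatorname{soc}^{(i)}M=\operatorname{soc}(M/\operatorname{soc}^{(i)}M)$. The Loewy length is the smallest positive integer $l$ with $\operatorname{soc}^{(l)}M=M$. *)

theory Defs
  imports
    Complex_Main
    "HOL-Algebra.Module"
    "HOL-Algebra.AbelCoset"
    "HOL-Library.Poly_Mapping"
    "HOL-Library.Function_Algebras"
    "HOL-Library.Countable_Set"
begin

section \<open>Modules with an action of a Lie algebra of operators\<close>

text \<open>
  The fields \<open>mult\<close> and \<open>one\<close> that the library record for modules inherits from rings
  carry no information here and are left undefined.  The elements that act form a type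
  \<open>'x\<close>; the Lie algebra itself is a subset of \<open>'x\<close> passed separately, so that a
  \<open>\<gg>\<close>-module is regarded as a module over a subalgebra by passing the subalgebra instead.
\<close>

definition field_ring :: "'k::field ring" where
  "field_ring = \<lparr>carrier = UNIV, mult = (*), one = 1, zero = 0, add = (+)\<rparr>"

record ('k, 'm, 'x) lie_module = "('k, 'm) module" +
  act :: "'x \<Rightarrow> 'm \<Rightarrow> 'm"

definition lie_submodule ::
    "'x set \<Rightarrow> 'm set \<Rightarrow> ('k::field, 'm, 'x) lie_module \<Rightarrow> bool" where
  "lie_submodule \<gg> N M \<longleftrightarrow>
     submodule N (field_ring :: 'k ring) M \<and> (\<forall>X\<in>\<gg>. \<forall>n\<in>N. act M X n \<in> N)"

definition simple_module :: "'x set \<Rightarrow> ('k::field, 'm, 'x) lie_module \<Rightarrow> bool" where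
  "simple_module \<gg> M \<longleftrightarrow> carrier M \<noteq> {\<zero>\<^bsub>M\<^esub>} \<and>
     (\<forall>N. lie_submodule \<gg> N M \<longrightarrow> N = {\<zero>\<^bsub>M\<^esub>} \<or> N = carrier M)"

definition simple_submodule ::
    "'x set \<Rightarrow> 'm set \<Rightarrow> ('k::field, 'm, 'x) lie_module \<Rightarrow> bool" where
  "simple_submodule \<gg> N M \<longleftrightarrow>
     lie_submodule \<gg> N M \<and> simple_module \<gg> (M\<lparr>carrier := N\<rparr>)"

definition socle :: "'x set \<Rightarrow> ('k::field, 'm, 'x) lie_module \<Rightarrow> 'm set" where
  "socle \<gg> M = {finsum M x F | x F. finite F \<and> (\<forall>S\<in>F. simple_submodule \<gg> S M \<and> x S \<in> S)}"

text \<open>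
  As with \<open>rcoset_mult\<close> in HOL-Algebra, operations on cosets are unions over all
  representatives: if the operation preserves \<open>N\<close>, every representative contributes the same
  coset.
\<close>

definition quot_module ::
    "('k, 'm, 'x) lie_module \<Rightarrow> 'm set \<Rightarrow> ('k, 'm set, 'x) lie_module" where
  "quot_module M N =
     \<lparr>carrier = a_rcosets\<^bsub>M\<^esub> N, mult = undefined, one = undefined, zero = N, add = set_add M,
      smult = (\<lambda>c A. \<Union>a\<in>A. N +>\<^bsub>M\<^esub> (c \<odot>\<^bsub>M\<^esub> a)),
      act = (\<lambda>X A. \<Union>a\<in>A. N +>\<^bsub>M\<^esub> act M X a)\<rparr>"

primrec socle_filtration ::
    "'x set \<Rightarrow> ('k::field, 'm, 'x) lie_module \<Rightarrow> nat \<Rightarrow> 'm set" where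
  "socle_filtration \<gg> M 0 = {\<zero>\<^bsub>M\<^esub>}"
| "socle_filtration \<gg> M (Suc i) =
     {m \<in> carrier M. socle_filtration \<gg> M i +>\<^bsub>M\<^esub> m \<in> socle \<gg> (quot_module M (socle_filtration \<gg> M i))}"

definition has_Loewy_length ::
    "'x set \<Rightarrow> ('k::field, 'm, 'x) lie_module \<Rightarrow> nat \<Rightarrow> bool" where
  "has_Loewy_length \<gg> M l \<longleftrightarrow> 0 < l \<and> socle_filtration \<gg> M l = carrier M \<and>
     (\<forall>l'. 0 < l' \<and> l' < l \<longrightarrow> socle_filtration \<gg> M l' \<noteq> carrier M)"


section \<open>Symplectic spaces and their Lie algebras\<close>

text \<open>\<open>Modules.module\<close> is the type-class based theory of modules; the unqualified name
  \<open>module\<close> refers to the locale of HOL-Algebra.\<close>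

locale symplectic_space = vector_space scale
  for scale :: "'k::field \<Rightarrow> 'v::ab_group_add \<Rightarrow> 'v" +
  fixes \<Omega> :: "'v \<Rightarrow> 'v \<Rightarrow> 'k"
  assumes linear_left: "Vector_Spaces.linear scale (*) (\<lambda>u. \<Omega> u v)"
    and linear_right: "Vector_Spaces.linear scale (*) (\<lambda>v. \<Omega> u v)"
    and antisymmetric: "\<Omega> u v = - \<Omega> v u"
    and nondegenerate: "(\<And>v. \<Omega> u v = 0) \<Longrightarrow> u = 0"

definition countably_infinite_dim :: "('k::field \<Rightarrow> 'v::ab_group_add \<Rightarrow> 'v) \<Rightarrow> bool" where
  "countably_infinite_dim scale \<longleftrightarrow>
     (\<exists>B. countable B \<and> infinite B \<and> \<not> Modules.module.dependent scale B \<and>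
          Modules.module.span scale B = UNIV)"

definition gl_inf ::
    "('k::field \<Rightarrow> 'v::ab_group_add \<Rightarrow> 'v) \<Rightarrow> ('v \<Rightarrow> 'v \<Rightarrow> 'k) \<Rightarrow> ('v \<Rightarrow> 'v) set" where
  "gl_inf scale \<Omega> = Modules.module.span (\<lambda>c X v. scale c (X v))
     {(\<lambda>v. scale (\<Omega> v w) u) | u w. True}"

definition sp_inf ::
    "('k::field \<Rightarrow> 'v::ab_group_add \<Rightarrow> 'v) \<Rightarrow> ('v \<Rightarrow> 'v \<Rightarrow> 'k) \<Rightarrow> ('v \<Rightarrow> 'v) set" where
  "sp_inf scale \<Omega> = {X \<in> gl_inf scale \<Omega>. \<forall>u v. \<Omega> (X u) v + \<Omega> u (X v) = 0}"


section \<open>Tensor powers\<close>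

text \<open>
  The \<open>d\<close>-th tensor power is the vector space freely spanned by the words
  of length \<open>d\<close> in the vectors (finitely supported functions), modulo the
  relations of multilinearity.
\<close>

definition fscale :: "'k::field \<Rightarrow> ('a \<Rightarrow>\<^sub>0 'k) \<Rightarrow> ('a \<Rightarrow>\<^sub>0 'k)" where
  "fscale c = Poly_Mapping.map ((*) c)"

definition lin_ext :: "('a \<Rightarrow> ('b \<Rightarrow>\<^sub>0 'k::field)) \<Rightarrow> ('a \<Rightarrow>\<^sub>0 'k) \<Rightarrow> ('b \<Rightarrow>\<^sub>0 'k)" where
  "lin_ext f p = (\<Sum>x\<in>Poly_Mapping.keys p. fscale (Poly_Mapping.lookup p x) (f x))"

abbreviation word :: "'v list \<Rightarrow> ('v list \<Rightarrow>\<^sub>0 'k::field)" where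
  "word vs \<equiv> Poly_Mapping.single vs 1"

definition word_module :: "nat \<Rightarrow> ('k::field, 'v list \<Rightarrow>\<^sub>0 'k, 'v \<Rightarrow> 'v) lie_module" where
  "word_module d =
     \<lparr>carrier = {p. \<forall>vs\<in>Poly_Mapping.keys p. length vs = d}, mult = undefined, one = undefined,
      zero = 0, add = (+), smult = fscale,
      act = (\<lambda>X. lin_ext (\<lambda>vs. \<Sum>i<length vs. word (vs[i := X (vs ! i)])))\<rparr>"

definition multilinear_relations ::
    "('k::field \<Rightarrow> 'v::ab_group_add \<Rightarrow> 'v) \<Rightarrow> nat \<Rightarrow> ('v list \<Rightarrow>\<^sub>0 'k) set" where
  "multilinear_relations scale d =
     {word (us @ (v + w) # ws) - word (us @ v # ws) - word (us @ w # ws) | us v w ws.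
        length us + 1 + length ws = d} \<union>
     {word (us @ scale c v # ws) - fscale c (word (us @ v # ws)) | us c v ws.
        length us + 1 + length ws = d}"

definition tensor_null ::
    "('k::field \<Rightarrow> 'v::ab_group_add \<Rightarrow> 'v) \<Rightarrow> nat \<Rightarrow> ('v list \<Rightarrow>\<^sub>0 'k) set" where
  "tensor_null scale d = Modules.module.span fscale (multilinear_relations scale d)"

definition tensor_power ::
    "('k::field \<Rightarrow> 'v::ab_group_add \<Rightarrow> 'v) \<Rightarrow> nat \<Rightarrow> ('k, ('v list \<Rightarrow>\<^sub>0 'k) set, 'v \<Rightarrow> 'v) lie_module"
  where "tensor_power scale d = quot_module (word_module d) (tensor_null scale d)"


section \<open>Contractions\<close>

text \<open>Tensor positions are numbered \<open>0, \<dots>, d - 1\<close>, as positions in lists are.  A collection of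
  pairwise disjoint index pairs is given as a list of pairs.  The contraction is the map induced
  on cosets by the linear extension of \<open>contract_word\<close>.\<close>

definition disjoint_index_pairs :: "nat \<Rightarrow> (nat \<times> nat) list \<Rightarrow> bool" where
  "disjoint_index_pairs d Is \<longleftrightarrow>
     (\<forall>(i, j)\<in>set Is. i < j \<and> j < d) \<and> distinct (map fst Is @ map snd Is)"

definition contract_word ::
    "('v \<Rightarrow> 'v \<Rightarrow> 'k::field) \<Rightarrow> (nat \<times> nat) list \<Rightarrow> 'v list \<Rightarrow> ('v list \<Rightarrow>\<^sub>0 'k)" where
  "contract_word \<Omega> Is vs =
     fscale (\<Prod>(i, j)\<leftarrow>Is. \<Omega> (vs ! i) (vs ! j))
       (word (nths vs (- (fst ` set Is \<union> snd ` set Is))))"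

definition contraction ::
    "('k::field \<Rightarrow> 'v::ab_group_add \<Rightarrow> 'v) \<Rightarrow> ('v \<Rightarrow> 'v \<Rightarrow> 'k) \<Rightarrow> nat \<Rightarrow> (nat \<times> nat) list \<Rightarrow>
       ('v list \<Rightarrow>\<^sub>0 'k) set \<Rightarrow> ('v list \<Rightarrow>\<^sub>0 'k) set" where
  "contraction scale \<Omega> d Is A =
     (let e = d - 2 * length Is
      in \<Union>p\<in>A. tensor_null scale e +>\<^bsub>word_module e\<^esub> lin_ext (contract_word \<Omega> Is) p)"

end

theory Submission
  imports Defs "HOL-Combinatorics.Multiset_Permutations"
begin

text \<open>
  Let \<open>layer d r\<close> be the tensors killed by all \<open>r\<close>-fold contractions; we show that the socle of
  the quotient by \<open>layer d r\<close> is \<open>layer d (Suc r)\<close>.  A tensor is encoded by its values on lists of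
  vectors via \<open>\<Omega>\<close>; put \<open>e = d - 2 r\<close>.

  Given finitely many tensors, choose \<open>e\<close> vectors \<open>x\<^sub>i\<close> that are orthogonal to each other and to
  everything in sight, with dual vectors \<open>y\<^sub>i\<close>.  The operators \<open>v \<mapsto> \<Omega>(v, w\<^sub>i) x\<^sub>i + \<Omega>(v, x\<^sub>i) w\<^sub>i\<close> lie in \<open>\<ss>\<pp>\<close>, and
  their product turns a tensor of degree \<open>e\<close> into a combination \<open>\<Sum> c(\<sigma>) x\<^sub>\<sigma>\<close> of the permutations
  of \<open>x\<^sub>1 \<otimes> \<dots> \<otimes> x\<^sub>e\<close>, which is traceless; the \<open>c(\<sigma>)\<close> are values of the tensor.  Hence every submodule properly
  containing \<open>layer d r\<close> meets \<open>layer d (Suc r)\<close> outside \<open>layer d r\<close>.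

  Conversely, a traceless tensor is recovered from these images: composing with
  \<open>v \<mapsto> \<Omega>(v, b) y\<^sub>i + \<Omega>(v, y\<^sub>i) b\<close> and summing over dual bases \<open>b, w\<^sub>i\<close> gives a multiple of the
  identity, because the correction terms contain a contraction.  So modulo \<open>layer d r\<close> the
  submodules of \<open>layer d (Suc r)\<close> are governed by spaces of functions \<open>c\<close> stable under the
  symmetric group, and Maschke's theorem yields semisimplicity.
\<close>

section \<open>Socles of Lie algebra modules\<close>

text \<open>A tensor power is a quotient of formal sums, and the relations alone do not show when a
  sum is zero. Nondegeneracy does: a sum is zero exactly when its values on all lists of test
  vectors vanish, so identities of tensors become identities of scalars. Socles are pulled back to
  formal sums as well, where a simple submodule of a quotient appears as a submodule covering the
  one divided out.

  The quotient of \<open>layer d (Suc r)\<close> by \<open>layer d r\<close> embeds into the product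
  of the traceless tensors over all r-fold contractions, and a submodule may lie diagonally in this
  product. Hence the functions c record all contractions at once, and the symmetric group acts by
  renaming test vectors, which leaves the contraction untouched.

  The frame vectors must be orthogonal to all letters present, so that an operator acts on each
  letter by a single term or not at all; infinite dimension provides such vectors. Characteristic
  zero permits division by the number e - k of letters still unreplaced when one operator is undone,
  and by the group order in the averaging.\<close>

lemma field_ring_simps [simp]:
  "carrier field_ring = UNIV" "monoid.mult field_ring = (*)" "one field_ring = 1"
  "zero field_ring = 0" "add field_ring = (+)"
  by (simp_all add: field_ring_def)

lemma cring_field_ring: "cring (field_ring :: 'k::field ring)"
  by (intro cringI abelian_groupI comm_monoidI)
    (auto simp: algebra_simps intro: exI[of _ "- x" for x])

text \<open>Submodules and socles depend only on the individual operators, so the locale records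
  that each operator of \<open>\<gg>\<close> acts linearly on the carrier. The acting set is
  arbitrary, which lets a subalgebra take the place of the whole algebra.\<close>

locale lie_mod = module "field_ring :: 'k ring" M
  for \<gg> :: "'x set" and M :: "('k::field, 'm, 'x) lie_module" (structure) +
  assumes act_closed: "X \<in> \<gg> \<Longrightarrow> m \<in> carrier M \<Longrightarrow> act M X m \<in> carrier M"
    and act_add: "X \<in> \<gg> \<Longrightarrow> m \<in> carrier M \<Longrightarrow> n \<in> carrier M \<Longrightarrow>
      act M X (m \<oplus> n) = act M X m \<oplus> act M X n"
    and act_smult: "X \<in> \<gg> \<Longrightarrow> m \<in> carrier M \<Longrightarrow> act M X (c \<odot> m) = c \<odot> act M X m"
begin

lemma smult_closed' [simp, intro]: "x \<in> carrier M \<Longrightarrow> a \<odot> x \<in> carrier M"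
  using smult_closed by simp

lemma lie_submoduleI:
  assumes "N \<subseteq> carrier M" "\<zero> \<in> N" "\<And>a b. a \<in> N \<Longrightarrow> b \<in> N \<Longrightarrow> a \<oplus> b \<in> N"
    "\<And>c a. a \<in> N \<Longrightarrow> c \<odot> a \<in> N" "\<And>X a. X \<in> \<gg> \<Longrightarrow> a \<in> N \<Longrightarrow> act M X a \<in> N"
  shows "lie_submodule \<gg> N M"
  unfolding lie_submodule_def
proof (intro conjI ballI submoduleI)
  fix a assume "a \<in> N"
  then have c: "a \<in> carrier M" using assms(1) by auto
  have "(- 1) \<odot> a \<oplus> a = (- 1 + 1) \<odot> a"
    using smult_l_distr[of "- 1" 1 a] smult_one[OF c] c by simp
  also have "\<dots> = \<zero>" using smult_l_null[OF c] by simp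
  finally have "\<ominus> a = (- 1) \<odot> a" using c by (intro minus_equality) auto
  then show "\<ominus> a \<in> N" using assms(4)[OF \<open>a \<in> N\<close>] by simp
qed (use assms in auto)

lemma
  assumes "lie_submodule \<gg> N M"
  shows lie_submodule_subset: "N \<subseteq> carrier M"
    and lie_submodule_zero: "\<zero> \<in> N"
    and lie_submodule_add: "\<And>a b. a \<in> N \<Longrightarrow> b \<in> N \<Longrightarrow> a \<oplus> b \<in> N"
    and lie_submodule_smult: "\<And>c a. a \<in> N \<Longrightarrow> c \<odot> a \<in> N"
    and lie_submodule_act: "\<And>X a. X \<in> \<gg> \<Longrightarrow> a \<in> N \<Longrightarrow> act M X a \<in> N"
proof -
  have s: "submodule N field_ring M" and a: "\<And>X a. X \<in> \<gg> \<Longrightarrow> a \<in> N \<Longrightarrow> act M X a \<in> N"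
    using assms by (auto simp: lie_submodule_def)
  note e = submoduleE[OF s]
  show "N \<subseteq> carrier M" "\<And>a b. a \<in> N \<Longrightarrow> b \<in> N \<Longrightarrow> a \<oplus> b \<in> N"
    "\<And>c a. a \<in> N \<Longrightarrow> c \<odot> a \<in> N" "\<And>X a. X \<in> \<gg> \<Longrightarrow> a \<in> N \<Longrightarrow> act M X a \<in> N"
    using e a by auto
  show "\<zero> \<in> N" using subgroup.one_closed[OF submodule.axioms(1)[OF s]] by simp
qed

lemma lie_submodule_carrier: "lie_submodule \<gg> (carrier M) M"
  by (rule lie_submoduleI) (auto simp: act_closed)

lemma lie_mod_restrict:
  assumes "lie_submodule \<gg> N M"
  shows "lie_mod \<gg> (M\<lparr>carrier := N\<rparr>)"
proof -
  have "submodule N field_ring M" using assms by (simp add: lie_submodule_def)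
  then have "module field_ring (M\<lparr>carrier := N\<rparr>)"
    by (rule submodule.submodule_is_module) (rule module_axioms)
  then show ?thesis
    using assms lie_submodule_subset[OF assms] lie_submodule_act[OF assms]
    by (auto intro!: lie_mod.intro lie_mod_axioms.intro simp: act_add act_smult subset_eq)
qed

lemma lie_submodule_restrict_iff:
  assumes "lie_submodule \<gg> N M"
  shows "lie_submodule \<gg> K (M\<lparr>carrier := N\<rparr>) \<longleftrightarrow> lie_submodule \<gg> K M \<and> K \<subseteq> N"
proof
  interpret R: lie_mod \<gg> "M\<lparr>carrier := N\<rparr>" by (rule lie_mod_restrict[OF assms])
  show "lie_submodule \<gg> K M \<and> K \<subseteq> N" if k: "lie_submodule \<gg> K (M\<lparr>carrier := N\<rparr>)"
    using R.lie_submodule_subset[OF k] R.lie_submodule_zero[OF k] R.lie_submodule_add[OF k]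
      R.lie_submodule_smult[OF k] R.lie_submodule_act[OF k] lie_submodule_subset[OF assms]
    by (auto intro!: lie_submoduleI)
  show "lie_submodule \<gg> K (M\<lparr>carrier := N\<rparr>)" if k: "lie_submodule \<gg> K M \<and> K \<subseteq> N"
    using lie_submodule_zero lie_submodule_add lie_submodule_smult lie_submodule_act k
    by (auto intro!: R.lie_submoduleI)
qed

lemma simple_submodule_iff:
  "simple_submodule \<gg> S M \<longleftrightarrow> lie_submodule \<gg> S M \<and> S \<noteq> {\<zero>} \<and>
     (\<forall>K. lie_submodule \<gg> K M \<and> K \<subseteq> S \<longrightarrow> K = {\<zero>} \<or> K = S)"
  by (auto simp: simple_submodule_def simple_module_def lie_submodule_restrict_iff)

lemma finsum_hom:
  assumes "finite F" "x \<in> F \<rightarrow> carrier M" "h \<in> carrier M \<rightarrow> carrier M"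
    "\<And>a b. a \<in> carrier M \<Longrightarrow> b \<in> carrier M \<Longrightarrow> h (a \<oplus> b) = h a \<oplus> h b"
  shows "h (finsum M x F) = finsum M (\<lambda>S. h (x S)) F"
  using assms(1,2)
proof (induction F)
  case empty
  have h0: "h \<zero> \<in> carrier M" using assms(3) by auto
  have "h \<zero> \<oplus> h \<zero> = h \<zero>" using assms(4)[of \<zero> \<zero>] by simp
  then have "h \<zero> = \<zero>" using h0 add.l_cancel_one' by metis
  then show ?case by simp
next
  case (insert S F)
  then have "x S \<in> carrier M" "x \<in> F \<rightarrow> carrier M" "(\<lambda>S. h (x S)) \<in> F \<rightarrow> carrier M" "h (x S) \<in> carrier M"
    using assms(3) by auto
  then show ?case using insert by (simp add: assms(4) finsum_closed)
qed

lemma finsum_in_submodule: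
  assumes K: "lie_submodule \<gg> K M" and "finite F" "\<And>S. S \<in> F \<Longrightarrow> x S \<in> K"
  shows "finsum M x F \<in> K"
  using assms(2,3)
proof (induction F)
  case (insert S F)
  then have "x S \<in> carrier M" "x \<in> F \<rightarrow> carrier M"
    using lie_submodule_subset[OF K] by auto
  then show ?case using insert lie_submodule_add[OF K] by simp
qed (use lie_submodule_zero[OF K] in simp)

text \<open>Together with \<open>simple_subset_socle\<close> and \<open>lie_submodule_socle\<close>,
  this makes the socle the least submodule containing all simple ones; the finite sums in its
  definition do not reappear later.\<close>

lemma socle_minimal:
  assumes "lie_submodule \<gg> K M" "\<And>S. simple_submodule \<gg> S M \<Longrightarrow> S \<subseteq> K"
  shows "socle \<gg> M \<subseteq> K"
  using assms by (auto simp: socle_def intro!: finsum_in_submodule)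

lemma simple_subset_socle:
  assumes "simple_submodule \<gg> S M"
  shows "S \<subseteq> socle \<gg> M"
proof
  fix a assume "a \<in> S"
  then have "a \<in> carrier M"
    using assms lie_submodule_subset by (auto simp: simple_submodule_def)
  then have "a = finsum M (\<lambda>_. a) {S}" by simp
  then show "a \<in> socle \<gg> M" unfolding socle_def using assms \<open>a \<in> S\<close> by blast
qed

lemma lie_submodule_socle: "lie_submodule \<gg> (socle \<gg> M) M"
proof (rule lie_submoduleI)
  show "socle \<gg> M \<subseteq> carrier M"
    by (rule socle_minimal[OF lie_submodule_carrier])
      (auto simp: simple_submodule_def dest: lie_submodule_subset)
  show "\<zero> \<in> socle \<gg> M"
    unfolding socle_def using finsum_empty by (force intro!: exI[of _ "{}"])
  have car: "x \<in> F \<rightarrow> carrier M" if "\<forall>S\<in>F. simple_submodule \<gg> S M \<and> x S \<in> S" for x F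
    using that by (auto simp: simple_submodule_def dest!: lie_submodule_subset)
  \<comment> \<open>Scalars and operators are treated alike: an additive map that preserves every
    submodule can be pushed into the finite sum term by term.\<close>
  have hom: "h a \<in> socle \<gg> M" if a: "a \<in> socle \<gg> M"
    and h: "h \<in> carrier M \<rightarrow> carrier M"
      "\<And>a b. a \<in> carrier M \<Longrightarrow> b \<in> carrier M \<Longrightarrow> h (a \<oplus> b) = h a \<oplus> h b"
    and hS: "\<And>S a. lie_submodule \<gg> S M \<Longrightarrow> a \<in> S \<Longrightarrow> h a \<in> S" for h a
  proof -
    obtain x F where x: "a = finsum M x F" "finite F" "\<forall>S\<in>F. simple_submodule \<gg> S M \<and> x S \<in> S"
      using a by (auto simp: socle_def)
    then have "h a = finsum M (\<lambda>S. h (x S)) F"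
      using finsum_hom[OF x(2) car[OF x(3)] h] by simp
    moreover have "\<forall>S\<in>F. simple_submodule \<gg> S M \<and> h (x S) \<in> S"
      using x(3) hS by (auto simp: simple_submodule_def)
    ultimately show ?thesis using x(2) unfolding socle_def by blast
  qed
  show "c \<odot> a \<in> socle \<gg> M" if "a \<in> socle \<gg> M" for c a
    by (rule hom[OF that]) (auto simp: smult_r_distr lie_submodule_smult)
  show "act M X a \<in> socle \<gg> M" if "X \<in> \<gg>" "a \<in> socle \<gg> M" for X a
    by (rule hom[OF that(2)]) (auto simp: that act_closed act_add lie_submodule_act)
  fix a b assume "a \<in> socle \<gg> M" "b \<in> socle \<gg> M"
  then obtain x F y G where x: "a = finsum M x F" "finite F" "\<forall>S\<in>F. simple_submodule \<gg> S M \<and> x S \<in> S"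
    and y: "b = finsum M y G" "finite G" "\<forall>S\<in>G. simple_submodule \<gg> S M \<and> y S \<in> S"
    by (auto simp: socle_def)
  \<comment> \<open>The two sums run over different sets of simple submodules. Padding with zero
    puts both on the union, where each summand stays in its own submodule.\<close>
  define x' where "x' S = (if S \<in> F then x S else \<zero>)" for S
  define y' where "y' S = (if S \<in> G then y S else \<zero>)" for S
  have c: "x' \<in> F \<union> G \<rightarrow> carrier M" "y' \<in> F \<union> G \<rightarrow> carrier M"
    using car[OF x(3)] car[OF y(3)] by (auto simp: x'_def y'_def)
  have "a = finsum M x' (F \<union> G)" unfolding x(1)
    by (rule add.finprod_mono_neutral_cong_left) (use x y c in \<open>auto simp: x'_def\<close>)
  moreover have "b = finsum M y' (F \<union> G)" unfolding y(1)
    by (rule add.finprod_mono_neutral_cong_left) (use x y c in \<open>auto simp: y'_def\<close>)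
  ultimately have "a \<oplus> b = finsum M (\<lambda>S. x' S \<oplus> y' S) (F \<union> G)"
    using c by (simp add: finsum_addf)
  moreover have "\<forall>S\<in>F \<union> G. simple_submodule \<gg> S M \<and> x' S \<oplus> y' S \<in> S"
  proof
    fix S assume S: "S \<in> F \<union> G"
    then have "simple_submodule \<gg> S M" using x(3) y(3) by auto
    then have L: "lie_submodule \<gg> S M" by (simp add: simple_submodule_def)
    show "simple_submodule \<gg> S M \<and> x' S \<oplus> y' S \<in> S"
      using \<open>simple_submodule \<gg> S M\<close> x(3) y(3) lie_submodule_zero[OF L]
      by (auto simp: x'_def y'_def intro!: lie_submodule_add[OF L])
  qed
  ultimately show "a \<oplus> b \<in> socle \<gg> M"
    unfolding socle_def using x(2) y(2) by blast
qed

end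

section \<open>Quotient modules, the correspondence of submodules, and covers\<close>

lemma quot_module_simps:
  "carrier (quot_module M N) = a_rcosets\<^bsub>M\<^esub> N" "zero (quot_module M N) = N"
  "add (quot_module M N) = set_add M"
  "smult (quot_module M N) = (\<lambda>c A. \<Union>a\<in>A. N +>\<^bsub>M\<^esub> (c \<odot>\<^bsub>M\<^esub> a))"
  "act (quot_module M N) = (\<lambda>X A. \<Union>a\<in>A. N +>\<^bsub>M\<^esub> act M X a)"
  by (simp_all add: quot_module_def)

locale lie_mod_sub = lie_mod \<gg> M for \<gg> :: "'x set" and M :: "('k::field, 'm, 'x) lie_module" (structure) +
  fixes N assumes N: "lie_submodule \<gg> N M"
begin

sublocale sg: abelian_subgroup N M
  by (rule abelian_subgroupI3)
    (use N in \<open>auto simp: lie_submodule_def additive_subgroup_def submodule_def abelian_group_axioms\<close>)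

lemma coset_eq_iff:
  assumes "m \<in> carrier M" "m' \<in> carrier M"
  shows "N +> m = N +> m' \<longleftrightarrow> m \<ominus> m' \<in> N"
proof -
  have "N +> m = N +> m' \<longleftrightarrow> m \<in> N +> m'"
    using assms sg.a_repr_independence' sg.a_rcos_self by blast
  then show ?thesis using assms
    by (simp add: sg.a_rcos_module a_minus_def)
qed

lemma quot_carrier: "carrier (quot_module M N) = (\<lambda>m. N +> m) ` carrier M"
  by (auto simp: quot_module_simps A_RCOSETS_def')

lemma quot_add:
  "m \<in> carrier M \<Longrightarrow> n \<in> carrier M \<Longrightarrow> (N +> m) \<oplus>\<^bsub>quot_module M N\<^esub> (N +> n) = N +> (m \<oplus> n)"
  by (simp add: quot_module_simps sg.a_rcos_sum)

text \<open>Operations on cosets are unions over all representatives. The union collapses to one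
  coset because changing the representative by an element of \<open>N\<close> changes the value of
  \<open>f\<close> by an element of \<open>N\<close>.\<close>

lemma quot_lift:
  assumes "m \<in> carrier M" "f \<in> carrier M \<rightarrow> carrier M"
    "\<And>n. n \<in> N \<Longrightarrow> f (n \<oplus> m) = f n \<oplus> f m" "f ` N \<subseteq> N"
  shows "(\<Union>a\<in>N +> m. N +> f a) = N +> f m"
proof -
  have "N +> f a = N +> f m" if a: "a \<in> N +> m" for a
  proof -
    obtain n where n: "n \<in> N" "a = n \<oplus> m" using a unfolding a_r_coset_def' by blast
    then have "f a = f n \<oplus> f m" "f n \<in> N" "f m \<in> carrier M" "f n \<in> carrier M"
      using assms by auto
    then show ?thesis by (metis a_coset_add_assoc sg.a_subset sg.a_rcos_const)
  qed
  then show ?thesis using sg.a_rcos_self[OF assms(1)] by blast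
qed

lemma quot_smult:
  assumes "m \<in> carrier M"
  shows "c \<odot>\<^bsub>quot_module M N\<^esub> (N +> m) = N +> (c \<odot> m)"
  unfolding quot_module_simps
  by (rule quot_lift) (use assms N in \<open>auto simp: lie_submodule_smult smult_r_distr\<close>)

lemma quot_act:
  assumes "X \<in> \<gg>" "m \<in> carrier M"
  shows "act (quot_module M N) X (N +> m) = N +> act M X m"
  unfolding quot_module_simps
  by (rule quot_lift) (use assms N in \<open>auto simp: lie_submodule_act act_add act_closed\<close>)

lemma quot_zero: "\<zero>\<^bsub>quot_module M N\<^esub> = N +> \<zero>"
  using lie_submodule_subset[OF N] by (simp add: quot_module_simps)

lemma quot_zero': "\<zero>\<^bsub>quot_module M N\<^esub> = N"
  by (simp add: quot_module_simps)

lemma lie_mod_quot: "lie_mod \<gg> (quot_module M N)"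
proof -
  have ab: "abelian_group (quot_module M N)"
  proof (rule abelian_groupI)
    fix A assume "A \<in> carrier (quot_module M N)"
    then obtain m where m: "m \<in> carrier M" "A = N +> m" by (auto simp: quot_carrier)
    then have "(N +> \<ominus> m) \<oplus>\<^bsub>quot_module M N\<^esub> A = \<zero>\<^bsub>quot_module M N\<^esub>"
      by (simp add: quot_add quot_zero l_neg)
    then show "\<exists>y\<in>carrier (quot_module M N). y \<oplus>\<^bsub>quot_module M N\<^esub> A = \<zero>\<^bsub>quot_module M N\<^esub>"
      using m by (auto simp: quot_carrier)
  qed (auto simp: quot_carrier quot_add quot_zero a_ac)
  show ?thesis
  proof (intro lie_mod.intro lie_mod_axioms.intro moduleI cring_field_ring ab)
  qed (auto simp: quot_carrier quot_add quot_zero quot_act quot_smult act_closed act_add act_smult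
      smult_l_distr[simplified] smult_r_distr smult_assoc1[simplified] smult_one[simplified])
qed

sublocale Q: lie_mod \<gg> "quot_module M N" by (rule lie_mod_quot)

lemma image_submodule:
  assumes "lie_submodule \<gg> K M"
  shows "lie_submodule \<gg> ((\<lambda>m. N +> m) ` K) (quot_module M N)"
proof (rule Q.lie_submoduleI)
  note K = lie_submodule_subset[OF assms] lie_submodule_zero[OF assms] lie_submodule_add[OF assms]
      lie_submodule_smult[OF assms] lie_submodule_act[OF assms]
  show "(\<lambda>m. N +> m) ` K \<subseteq> carrier (quot_module M N)" using K by (auto simp: quot_carrier)
  show "\<zero>\<^bsub>quot_module M N\<^esub> \<in> (\<lambda>m. N +> m) ` K" using K by (auto simp: quot_zero)
  show "a \<oplus>\<^bsub>quot_module M N\<^esub> b \<in> (\<lambda>m. N +> m) ` K"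
    if "a \<in> (\<lambda>m. N +> m) ` K" "b \<in> (\<lambda>m. N +> m) ` K" for a b
    using that K by (auto simp: quot_add subset_eq)
  show "c \<odot>\<^bsub>quot_module M N\<^esub> a \<in> (\<lambda>m. N +> m) ` K" if "a \<in> (\<lambda>m. N +> m) ` K" for a c
    using that K by (auto simp: quot_smult subset_eq)
  show "act (quot_module M N) X a \<in> (\<lambda>m. N +> m) ` K" if "X \<in> \<gg>" "a \<in> (\<lambda>m. N +> m) ` K" for a X
    using that K by (auto simp: quot_act subset_eq)
qed

lemma coset_in_image_iff:
  assumes "lie_submodule \<gg> K M" "N \<subseteq> K" "m \<in> carrier M"
  shows "N +> m \<in> (\<lambda>m. N +> m) ` K \<longleftrightarrow> m \<in> K"
proof
  assume "N +> m \<in> (\<lambda>m. N +> m) ` K"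
  then obtain k where k: "k \<in> K" "N +> m = N +> k" by auto
  have kc: "k \<in> carrier M" using k lie_submodule_subset[OF assms(1)] by auto
  then have "m \<ominus> k \<in> K" using k coset_eq_iff assms by auto
  then have "(m \<ominus> k) \<oplus> k \<in> K" using k lie_submodule_add[OF assms(1)] by auto
  then show "m \<in> K" using kc assms(3) by (simp add: a_minus_def a_assoc l_neg)
qed auto

text \<open>The inverse of taking images in the correspondence between submodules of the quotient
  and submodules containing \<open>N\<close>.\<close>

definition preim where "preim S = {m \<in> carrier M. N +> m \<in> S}"

lemma
  assumes S: "lie_submodule \<gg> S (quot_module M N)"
  shows preim_submodule: "lie_submodule \<gg> (preim S) M"
    and preim_contains: "N \<subseteq> preim S"
    and image_preim: "(\<lambda>m. N +> m) ` preim S = S"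
proof -
  note S' = Q.lie_submodule_subset[OF S] Q.lie_submodule_zero[OF S] Q.lie_submodule_add[OF S]
      Q.lie_submodule_smult[OF S] Q.lie_submodule_act[OF S]
  show "lie_submodule \<gg> (preim S) M"
    using S' by (auto intro!: lie_submoduleI simp: preim_def quot_zero act_closed simp flip: quot_add quot_smult quot_act)
  show "N \<subseteq> preim S"
    using S'(2) lie_submodule_subset[OF N] by (auto simp: preim_def quot_zero' sg.a_rcos_const)
  show "(\<lambda>m. N +> m) ` preim S = S" using S'(1) by (auto simp: preim_def quot_carrier)
qed

lemma preim_image:
  assumes "lie_submodule \<gg> K M" "N \<subseteq> K"
  shows "preim ((\<lambda>m. N +> m) ` K) = K"
  using coset_in_image_iff[OF assms] lie_submodule_subset[OF assms(1)] by (auto simp: preim_def)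

end

text \<open>Simplicity of \<open>S\<close> modulo \<open>N\<close>, expressed without cosets. This
  lets the later arguments stay among formal sums of words.\<close>

definition covers :: "'x set \<Rightarrow> ('k::field, 'm, 'x) lie_module \<Rightarrow> 'm set \<Rightarrow> 'm set \<Rightarrow> bool" where
  "covers \<gg> M N S \<longleftrightarrow> lie_submodule \<gg> S M \<and> N \<subset> S \<and>
     (\<forall>K. lie_submodule \<gg> K M \<and> N \<subseteq> K \<and> K \<subseteq> S \<longrightarrow> K = N \<or> K = S)"

context lie_mod_sub
begin

lemma coset_N: "(\<lambda>m. N +> m) ` N = {N}"
proof -
  have "(\<lambda>m. N +> m) ` N = (\<lambda>m. N) ` N"
    by (rule image_cong) (auto simp: sg.a_rcos_const)
  also have "\<dots> = {N}" using lie_submodule_zero[OF N] by (rule image_constant)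
  finally show ?thesis .
qed

lemma simple_image_iff:
  assumes "lie_submodule \<gg> S (quot_module M N)"
  shows "simple_submodule \<gg> S (quot_module M N) \<longleftrightarrow> covers \<gg> M N (preim S)"
proof
  assume "simple_submodule \<gg> S (quot_module M N)"
  then have s: "S \<noteq> {N}" "\<And>K. lie_submodule \<gg> K (quot_module M N) \<Longrightarrow> K \<subseteq> S \<Longrightarrow> K = {N} \<or> K = S"
    by (auto simp: Q.simple_submodule_iff quot_zero')
  show "covers \<gg> M N (preim S)" unfolding covers_def
  proof (intro conjI allI impI psubsetI)
    show "N \<noteq> preim S" using s(1) coset_N image_preim[OF assms] by metis
    fix K assume K: "lie_submodule \<gg> K M \<and> N \<subseteq> K \<and> K \<subseteq> preim S"
    then have "(\<lambda>m. N +> m) ` K = {N} \<or> (\<lambda>m. N +> m) ` K = S"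
      by (intro s(2) image_submodule) (auto simp: preim_def)
    then show "K = N \<or> K = preim S"
      using preim_image[of K] preim_image[OF N] coset_N K by auto
  qed (use preim_submodule[OF assms] preim_contains[OF assms] in auto)
next
  assume c: "covers \<gg> M N (preim S)"
  show "simple_submodule \<gg> S (quot_module M N)"
    unfolding Q.simple_submodule_iff quot_zero'
  proof (intro conjI allI impI)
    show "S \<noteq> {N}" using c preim_image[OF N] coset_N by (auto simp: covers_def)
    fix K assume K: "lie_submodule \<gg> K (quot_module M N) \<and> K \<subseteq> S"
    then have "preim K = N \<or> preim K = preim S"
      using c preim_submodule[of K] preim_contains[of K] unfolding covers_def
      by (auto simp: preim_def)
    then show "K = {N} \<or> K = S" using image_preim[of K] image_preim[OF assms] K coset_N by metis
  qed (use assms in auto)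
qed

lemma
  shows preim_socle_submodule: "lie_submodule \<gg> (preim (socle \<gg> (quot_module M N))) M"
    and subset_preim_socle: "N \<subseteq> preim (socle \<gg> (quot_module M N))"
  using preim_submodule preim_contains Q.lie_submodule_socle by auto

lemma cover_subset_preim_socle:
  assumes "covers \<gg> M N S"
  shows "S \<subseteq> preim (socle \<gg> (quot_module M N))"
proof -
  have S: "lie_submodule \<gg> S M" "N \<subseteq> S" using assms by (auto simp: covers_def)
  have "simple_submodule \<gg> ((\<lambda>m. N +> m) ` S) (quot_module M N)"
    using simple_image_iff[OF image_submodule[OF S(1)]] preim_image[OF S] assms by simp
  then show ?thesis
    using Q.simple_subset_socle lie_submodule_subset[OF S(1)] by (fastforce simp: preim_def)
qed

text \<open>With \<open>cover_subset_preim_socle\<close>, this identifies the preimage of the socle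
  of the quotient as the least submodule that contains \<open>N\<close> and all covers of
  \<open>N\<close>.\<close>

lemma preim_socle_minimal:
  assumes "lie_submodule \<gg> K M" "N \<subseteq> K" "\<And>S. covers \<gg> M N S \<Longrightarrow> S \<subseteq> K"
  shows "preim (socle \<gg> (quot_module M N)) \<subseteq> K"
proof -
  have "socle \<gg> (quot_module M N) \<subseteq> (\<lambda>m. N +> m) ` K"
  proof (rule Q.socle_minimal[OF image_submodule[OF assms(1)]])
    fix S assume S: "simple_submodule \<gg> S (quot_module M N)"
    then have S': "lie_submodule \<gg> S (quot_module M N)" by (simp add: simple_submodule_def)
    then have "preim S \<subseteq> K" using S simple_image_iff assms(3) by auto
    then show "S \<subseteq> (\<lambda>m. N +> m) ` K" using image_preim[OF S'] by blast
  qed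
  then show ?thesis using preim_image[OF assms(1,2)] by (auto simp: preim_def)
qed

text \<open>The tensor power is itself a quotient, so its socle filtration forms quotients of a
  quotient. The correspondence preserves inclusions in both directions, and covers can be found
  before dividing by \<open>N\<close>.\<close>

lemma covers_image:
  assumes "N \<subseteq> F" "lie_submodule \<gg> F M" "lie_submodule \<gg> S M" "N \<subseteq> S"
  shows "covers \<gg> (quot_module M N) ((\<lambda>m. N +> m) ` F) ((\<lambda>m. N +> m) ` S) \<longleftrightarrow> covers \<gg> M F S"
proof -
  let ?\<pi> = "\<lambda>K. (\<lambda>m. N +> m) ` K"
  have le: "?\<pi> A \<subseteq> ?\<pi> B \<longleftrightarrow> A \<subseteq> B"
    if "lie_submodule \<gg> A M" "N \<subseteq> A" "lie_submodule \<gg> B M" "N \<subseteq> B" for A B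
  proof
    assume "?\<pi> A \<subseteq> ?\<pi> B"
    then have "preim (?\<pi> A) \<subseteq> preim (?\<pi> B)" unfolding preim_def by blast
    then show "A \<subseteq> B" by (simp only: preim_image[OF that(1,2)] preim_image[OF that(3,4)])
  qed (rule image_mono)
  have eq: "?\<pi> A = ?\<pi> B \<longleftrightarrow> A = B"
    if "lie_submodule \<gg> A M" "N \<subseteq> A" "lie_submodule \<gg> B M" "N \<subseteq> B" for A B
    using le[OF that] le[OF that(3,4,1,2)] by (simp only: set_eq_subset)
  show ?thesis
  proof
    assume c: "covers \<gg> (quot_module M N) (?\<pi> F) (?\<pi> S)"
    show "covers \<gg> M F S" unfolding covers_def
    proof (intro conjI allI impI psubsetI)
      show "F \<subseteq> S" "F \<noteq> S" using c le[OF assms(2,1,3,4)] by (auto simp: covers_def)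
      fix K assume K: "lie_submodule \<gg> K M \<and> F \<subseteq> K \<and> K \<subseteq> S"
      then have K': "lie_submodule \<gg> K M" "N \<subseteq> K" using assms(1) by blast+
      have "?\<pi> K = ?\<pi> F \<or> ?\<pi> K = ?\<pi> S"
        using c image_submodule[OF K'(1)] K unfolding covers_def by (meson image_mono)
      then show "K = F \<or> K = S" using eq[OF K' assms(2,1)] eq[OF K' assms(3,4)] by blast
    qed (fact assms(3))
  next
    assume c: "covers \<gg> M F S"
    show "covers \<gg> (quot_module M N) (?\<pi> F) (?\<pi> S)" unfolding covers_def
    proof (intro conjI allI impI psubsetI)
      show "?\<pi> F \<subseteq> ?\<pi> S" using c unfolding covers_def by blast
      show "?\<pi> F \<noteq> ?\<pi> S" using c eq[OF assms(2,1,3,4)] unfolding covers_def by blast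
      fix K assume K: "lie_submodule \<gg> K (quot_module M N) \<and> ?\<pi> F \<subseteq> K \<and> K \<subseteq> ?\<pi> S"
      then have L: "lie_submodule \<gg> (preim K) M" "N \<subseteq> preim K" "?\<pi> (preim K) = K"
        by (simp_all only: preim_submodule preim_contains image_preim)
      then have "F \<subseteq> preim K" "preim K \<subseteq> S"
        using K le[OF assms(2,1) L(1,2)] le[OF L(1,2) assms(3,4)] by (simp_all only:)
      then have "preim K = F \<or> preim K = S" using c L(1) unfolding covers_def by blast
      then show "K = ?\<pi> F \<or> K = ?\<pi> S" using L(3) by blast
    qed (rule image_submodule[OF assms(3)])
  qed
qed

text \<open>The assumption \<open>cov\<close> bounds the socle of each quotient from above and
  \<open>gen\<close> from below. Both speak of submodules of \<open>M\<close>, although the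
  filtration is that of the quotient by \<open>N\<close>.\<close>

theorem socle_filtration_eqI:
  assumes "F 0 = N" "\<And>r. lie_submodule \<gg> (F r) M" "\<And>r. F r \<subseteq> F (Suc r)"
    and cov: "\<And>r S. covers \<gg> M (F r) S \<Longrightarrow> S \<subseteq> F (Suc r)"
    and gen: "\<And>r K. lie_submodule \<gg> K M \<Longrightarrow> F r \<subseteq> K \<Longrightarrow> (\<And>S. covers \<gg> M (F r) S \<Longrightarrow> S \<subseteq> K) \<Longrightarrow>
      F (Suc r) \<subseteq> K"
  shows "socle_filtration \<gg> (quot_module M N) r = (\<lambda>m. N +> m) ` F r"
proof (induction r)
  case 0
  then show ?case using assms(1) coset_N by (simp add: quot_zero')
next
  case (Suc r)
  have NF: "N \<subseteq> F r" for r
    by (rule order_trans[OF eq_refl[OF assms(1)[symmetric]] lift_Suc_mono_le[of F, OF assms(3)]]) simp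
  define \<pi> where "\<pi> = (\<lambda>m. N +> m)"
  have im: "lie_submodule \<gg> (\<pi> ` F r) (quot_module M N)" for r
    unfolding \<pi>_def by (rule image_submodule[OF assms(2)])
  interpret L: lie_mod_sub \<gg> "quot_module M N" "\<pi> ` F r"
    by unfold_locales (rule im)
  define T where "T = L.preim (socle \<gg> (quot_module (quot_module M N) (\<pi> ` F r)))"
  have T: "lie_submodule \<gg> T (quot_module M N)" "\<pi> ` F r \<subseteq> T"
    using L.preim_socle_submodule L.subset_preim_socle by (auto simp: T_def)
  have "T \<subseteq> \<pi> ` F (Suc r)" unfolding T_def
  proof (rule L.preim_socle_minimal[OF im])
    fix S assume S: "covers \<gg> (quot_module M N) (\<pi> ` F r) S"
    then have S': "lie_submodule \<gg> S (quot_module M N)" by (simp add: covers_def)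
    have "covers \<gg> M (F r) (preim S)"
      using covers_image[OF NF assms(2) preim_submodule[OF S'] preim_contains[OF S'], of r]
        S image_preim[OF S'] by (simp add: \<pi>_def)
    then have "preim S \<subseteq> F (Suc r)" by (rule cov)
    then have "\<pi> ` preim S \<subseteq> \<pi> ` F (Suc r)" by (rule image_mono)
    then show "S \<subseteq> \<pi> ` F (Suc r)" by (simp only: image_preim[OF S'] \<pi>_def)
  qed (rule image_mono[OF assms(3)])
  moreover have "F (Suc r) \<subseteq> preim T"
  proof (rule gen[OF preim_submodule[OF T(1)]])
    show "F r \<subseteq> preim T" using T(2) lie_submodule_subset[OF assms(2)] by (auto simp: preim_def \<pi>_def)
    fix S assume S: "covers \<gg> M (F r) S"
    then have S': "lie_submodule \<gg> S M" "F r \<subseteq> S" by (auto simp: covers_def)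
    have "covers \<gg> (quot_module M N) (\<pi> ` F r) (\<pi> ` S)"
      unfolding \<pi>_def using covers_image[OF NF assms(2) S'(1) subset_trans[OF NF S'(2)]] S by (rule iffD2)
    then have "\<pi> ` S \<subseteq> T" unfolding T_def by (rule L.cover_subset_preim_socle)
    then show "S \<subseteq> preim T" using lie_submodule_subset[OF S'(1)] by (auto simp: preim_def \<pi>_def)
  qed
  then have "\<pi> ` F (Suc r) \<subseteq> T" unfolding preim_def \<pi>_def by blast
  ultimately have "T = \<pi> ` F (Suc r)" by (rule subset_antisym)
  then show ?case unfolding T_def L.preim_def using Suc by (simp add: \<pi>_def)
qed

end


section \<open>Complete reducibility for finite groups\<close>

context vector_space
begin

lemma linear_simps:
  assumes "Vector_Spaces.linear scale scale g"
  shows "g (v + w) = g v + g w" "g (scale c v) = scale c (g v)" "g 0 = 0"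
    "g (sum f A) = (\<Sum>a\<in>A. g (f a))"
proof -
  interpret g: Vector_Spaces.linear scale scale g by fact
  show "g (v + w) = g v + g w" "g (scale c v) = scale c (g v)" "g 0 = 0"
    "g (sum f A) = (\<Sum>a\<in>A. g (f a))"
    by (simp_all add: g.add g.scale g.sum)
qed

text \<open>An infinite basis has cardinality 0, so the finite set \<open>B\<close> is what makes a
  strict inequality of dimensions possible. It drives the induction in
  \<open>in_span_irreducibles\<close>.\<close>

lemma dim_psubset_spanned:
  assumes "subspace U" "U \<subset> W" "W \<subseteq> span B" "finite B"
  shows "dim U < dim W"
proof -
  obtain b where b: "b \<subseteq> U" "independent b" "U \<subseteq> span b" "card b = dim U"
    using basis_exists by blast
  obtain b' where b': "b' \<subseteq> W" "independent b'" "W \<subseteq> span b'" "card b' = dim W"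
    using basis_exists by blast
  have fin: "finite b'" using independent_span_bound[OF assms(4) b'(2)] b'(1) assms(3) by blast
  obtain v where v: "v \<in> W" "v \<notin> U" using assms(2) by blast
  have "span b = U" using b(1,3) assms(1) by (simp add: span_subspace)
  then have "independent (insert v b)" using v(2) b(2) by (intro independent_insertI) auto
  moreover have "insert v b \<subseteq> span b'" using v(1) b(1) b'(3) assms(2) by blast
  ultimately have "finite (insert v b) \<and> card (insert v b) \<le> card b'"
    by (rule independent_span_bound[OF fin])
  moreover have "v \<notin> b" using v(2) b(1) by blast
  ultimately show ?thesis using b(4) b'(4) by auto
qed

end

locale finite_linear_group = vector_space scale
  for scale :: "'k::field_char_0 \<Rightarrow> 'v::ab_group_add \<Rightarrow> 'v" +
  fixes G :: "('v \<Rightarrow> 'v) set"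
  assumes finite_G: "finite G"
    and id_in_G: "id \<in> G"
    and comp_in_G: "g \<in> G \<Longrightarrow> h \<in> G \<Longrightarrow> g \<circ> h \<in> G"
    and bij_G: "g \<in> G \<Longrightarrow> bij g"
    and inv_in_G: "g \<in> G \<Longrightarrow> inv_into UNIV g \<in> G"
    and linear_G: "g \<in> G \<Longrightarrow> Vector_Spaces.linear scale scale g"
begin

definition stable :: "'v set \<Rightarrow> bool" where
  "stable U \<longleftrightarrow> subspace U \<and> (\<forall>g\<in>G. \<forall>v\<in>U. g v \<in> U)"

definition irreducible :: "'v set \<Rightarrow> bool" where
  "irreducible U \<longleftrightarrow> stable U \<and> U \<noteq> {0} \<and> (\<forall>W. stable W \<and> W \<subseteq> U \<longrightarrow> W = {0} \<or> W = U)"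

lemma inv_cancel: "g \<in> G \<Longrightarrow> g (inv_into UNIV g v) = v" "g \<in> G \<Longrightarrow> inv_into UNIV g (g v) = v"
  using bij_G by (simp_all add: bij_is_surj surj_f_inv_f bij_is_inj)

text \<open>Maschke's averaging: a linear projection onto \<open>U\<close> is conjugated by every
  \<open>g\<close> and averaged, dividing by \<open>card G\<close>. Stability of \<open>U\<close>
  makes each conjugate a projection onto \<open>U\<close> again.\<close>

lemma equivariant_projection:
  assumes U: "stable U"
  obtains q where "\<And>v. q v \<in> U" "\<And>v. v \<in> U \<Longrightarrow> q v = v" "\<And>g v. g \<in> G \<Longrightarrow> q (g v) = g (q v)"
    "Vector_Spaces.linear scale scale q"
proof -
  interpret P: vector_space_pair scale scale by unfold_locales
  have sub: "subspace U" using U by (simp add: stable_def)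
  have "\<exists>p. p ` UNIV \<subseteq> U \<and> Vector_Spaces.linear scale scale p \<and> (\<forall>v\<in>U. p (id v) = v)"
    by (rule P.linear_exists_left_inverse_on) (use linear_ident sub in auto)
  then obtain p where p: "\<And>v. p v \<in> U" "\<And>v. v \<in> U \<Longrightarrow> p v = v"
    and lp: "Vector_Spaces.linear scale scale p" by auto
  define c :: 'k where "c = inverse (of_nat (card G))"
  have "card G \<noteq> 0" using finite_G id_in_G by auto
  then have c: "c * of_nat (card G) = 1" by (simp add: c_def)
  define q where "q v = scale c (\<Sum>g\<in>G. g (p (inv_into UNIV g v)))" for v
  show thesis
  proof (rule that[of q])
    show "q v \<in> U" for v
      using U p(1) unfolding q_def stable_def by (auto intro!: subspace_scale subspace_sum)
    show "q v = v" if "v \<in> U" for v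
    proof -
      have "g (p (inv_into UNIV g v)) = v" if "g \<in> G" for g
        using U \<open>v \<in> U\<close> inv_in_G[OF that] that by (simp add: p(2) stable_def inv_cancel)
      then have "(\<Sum>g\<in>G. g (p (inv_into UNIV g v))) = (\<Sum>g\<in>G. v)"
        by (intro sum.cong) auto
      then have "q v = scale c (scale (of_nat (card G)) v)"
        by (simp only: q_def sum_constant_scale)
      then show ?thesis using c by simp
    qed
    show "q (h v) = h (q v)" if h: "h \<in> G" for h v
    proof -
      \<comment> \<open>Left translation by \<open>h\<close> permutes \<open>G\<close>; after
        reindexing, every summand has \<open>h\<close> as its outermost factor.\<close>
      have "bij_betw (\<lambda>g. h \<circ> g) G G"
      proof (rule bij_betw_byWitness[where f' = "\<lambda>g. inv_into UNIV h \<circ> g"])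
        show "\<forall>g\<in>G. inv_into UNIV h \<circ> (h \<circ> g) = g" "\<forall>g\<in>G. h \<circ> (inv_into UNIV h \<circ> g) = g"
          using h by (auto simp: fun_eq_iff inv_cancel)
        show "(\<lambda>g. h \<circ> g) ` G \<subseteq> G" "(\<lambda>g. inv_into UNIV h \<circ> g) ` G \<subseteq> G"
          using comp_in_G[OF h] comp_in_G[OF inv_in_G[OF h]] by auto
      qed
      then have "(\<Sum>g\<in>G. g (p (inv_into UNIV g (h v)))) = (\<Sum>g\<in>G. (h \<circ> g) (p (inv_into UNIV (h \<circ> g) (h v))))"
        by (rule sum.reindex_bij_betw[symmetric])
      also have "\<dots> = (\<Sum>g\<in>G. h (g (p (inv_into UNIV g v))))"
        using h by (intro sum.cong) (auto simp: o_inv_distrib bij_G inv_cancel)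
      finally show ?thesis unfolding q_def by (simp add: linear_simps[OF linear_G[OF h]])
    qed
    show "Vector_Spaces.linear scale scale q"
    proof (unfold Vector_Spaces.linear_iff, intro conjI allI vector_space_axioms)
      fix v w show "q (v + w) = q v + q w"
        unfolding q_def sum.distrib[symmetric] scale_right_distrib[symmetric]
        by (intro arg_cong[of _ _ "scale c"] sum.cong)
          (simp_all add: linear_simps(1)[OF linear_G] linear_simps(1)[OF lp] inv_in_G)
    next
      fix a v show "q (scale a v) = scale a (q v)"
        unfolding q_def scale_left_commute[of a c] scale_sum_right[of a]
        by (intro arg_cong[of _ _ "scale c"] sum.cong)
          (simp_all add: linear_simps(2)[OF linear_G] linear_simps(2)[OF lp] inv_in_G)
    qed
  qed
qed

text \<open>The complement is the kernel of the equivariant projection inside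
  \<open>W\<close>.\<close>

lemma stable_complement:
  assumes U: "stable U" and W: "stable W" "U \<subseteq> W"
  obtains U' where "stable U'" "U' \<subseteq> W" "U \<inter> U' = {0}" "\<And>w. w \<in> W \<Longrightarrow> \<exists>u\<in>U. \<exists>u'\<in>U'. w = u + u'"
proof -
  obtain q where q: "\<And>v. q v \<in> U" "\<And>v. v \<in> U \<Longrightarrow> q v = v" "\<And>g v. g \<in> G \<Longrightarrow> q (g v) = g (q v)"
    and lq: "Vector_Spaces.linear scale scale q"
    using equivariant_projection[OF U] by metis
  note lin = linear_simps[OF lq]
  have subW: "subspace W" using W by (simp add: stable_def)
  show thesis
  proof (rule that[of "{w \<in> W. q w = 0}"])
    show "stable {w \<in> W. q w = 0}"
      using W(1) unfolding stable_def
      by (auto intro!: subspaceI simp: lin q(3) linear_simps(3)[OF linear_G]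
          subspace_0 subspace_add subspace_scale)
    show "U \<inter> {w \<in> W. q w = 0} = {0}"
    proof (intro equalityI subsetI)
      show "v \<in> {0}" if "v \<in> U \<inter> {w \<in> W. q w = 0}" for v using that q(2)[of v] by auto
      show "v \<in> U \<inter> {w \<in> W. q w = 0}" if "v \<in> {0}" for v
        using that U lin(3) subspace_0[OF subW] subspace_0[of U] unfolding stable_def by simp
    qed
    fix w assume w: "w \<in> W"
    have "w = q w + (w - q w)" by simp
    moreover have "w - q w \<in> W" using w q(1) W(2) subspace_diff[OF subW] by blast
    moreover have "q (w - q w) = 0"
      using lin(1)[of w "scale (- 1) (q w)"] lin(2)[of "- 1" "q w"] q(1,2) by simp
    ultimately show "\<exists>u\<in>U. \<exists>u'\<in>{w \<in> W. q w = 0}. w = u + u'" using q(1) by blast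
  qed auto
qed

text \<open>Strong induction on the dimension: a reducible \<open>W\<close> is the sum of a proper
  stable subspace and its complement, both of smaller dimension.\<close>

theorem in_span_irreducibles:
  assumes "finite B" "stable W" "W \<subseteq> span B"
  shows "W \<subseteq> span (\<Union>{U. irreducible U \<and> U \<subseteq> W})"
  using assms(2,3)
proof (induction "dim W" arbitrary: W rule: less_induct)
  case less
  consider "W = {0}" | "irreducible W" | U where "stable U" "U \<subseteq> W" "U \<noteq> {0}" "U \<noteq> W"
    using less.prems by (auto simp: irreducible_def)
  then show ?case
  proof cases
    case 2
    then show ?thesis using span_superset[of "\<Union>{U. irreducible U \<and> U \<subseteq> W}"] by blast
  next
    case (3 U)
    obtain U' where U': "stable U'" "U' \<subseteq> W" "U \<inter> U' = {0}"
      "\<And>w. w \<in> W \<Longrightarrow> \<exists>u\<in>U. \<exists>u'\<in>U'. w = u + u'"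
      using stable_complement[OF 3(1) less.prems(1) 3(2)] by metis
    have sub: "subspace U" "subspace U'" using 3(1) U'(1) by (auto simp: stable_def)
    have ne: "U' \<noteq> W" using U'(3) 3(2,3) by blast
    have *: "V \<subseteq> span (\<Union>{U. irreducible U \<and> U \<subseteq> W})"
      if V: "stable V" "V \<subset> W" for V
    proof -
      have "dim V < dim W"
        using V less.prems(2) assms(1) by (intro dim_psubset_spanned) (auto simp: stable_def)
      then have "V \<subseteq> span (\<Union>{U. irreducible U \<and> U \<subseteq> V})"
        by (rule less.hyps) (use V less.prems(2) in auto)
      also have "\<dots> \<subseteq> span (\<Union>{U. irreducible U \<and> U \<subseteq> W})"
        using V(2) by (intro span_mono) blast
      finally show ?thesis .
    qed
    have "U \<subseteq> span (\<Union>{U. irreducible U \<and> U \<subseteq> W})" "U' \<subseteq> span (\<Union>{U. irreducible U \<and> U \<subseteq> W})"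
      using 3 U' ne by (intro *; blast)+
    then show ?thesis using U'(4) by (blast intro: span_add)
  qed (simp add: span_zero)
qed

end


section \<open>Finitely supported functions\<close>

lemma lookup_fscale [simp]: "Poly_Mapping.lookup (fscale c p) x = c * Poly_Mapping.lookup p x"
  unfolding fscale_def by (simp add: Poly_Mapping.map.rep_eq when_def)

interpretation free: vector_space "fscale :: 'k::field \<Rightarrow> ('a \<Rightarrow>\<^sub>0 'k) \<Rightarrow> _"
  by unfold_locales (auto intro!: poly_mapping_eqI simp: lookup_add algebra_simps)

lemma keys_fscale: "Poly_Mapping.keys (fscale c p) \<subseteq> Poly_Mapping.keys p"
  by (auto simp: in_keys_iff)

text \<open>The scalar counterpart of \<open>lin_ext\<close>, which takes its values in formal
  sums.\<close>

definition lin_fun :: "('a \<Rightarrow> 'k::field) \<Rightarrow> ('a \<Rightarrow>\<^sub>0 'k) \<Rightarrow> 'k" where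
  "lin_fun g p = (\<Sum>x\<in>Poly_Mapping.keys p. Poly_Mapping.lookup p x * g x)"

lemma lin_fun_superset:
  assumes "finite A" "Poly_Mapping.keys p \<subseteq> A"
  shows "lin_fun g p = (\<Sum>x\<in>A. Poly_Mapping.lookup p x * g x)"
  unfolding lin_fun_def using assms by (intro sum.mono_neutral_left) (auto simp: in_keys_iff)

lemma lin_ext_superset:
  assumes "finite A" "Poly_Mapping.keys p \<subseteq> A"
  shows "lin_ext f p = (\<Sum>x\<in>A. fscale (Poly_Mapping.lookup p x) (f x))"
  unfolding lin_ext_def using assms by (intro sum.mono_neutral_left) (auto simp: in_keys_iff)

lemma lin_fun_add: "lin_fun g (p + q) = lin_fun g p + lin_fun g q"
proof -
  let ?A = "Poly_Mapping.keys p \<union> Poly_Mapping.keys q"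
  have "Poly_Mapping.keys (p + q) \<subseteq> ?A" by (rule keys_add)
  then show ?thesis
    by (simp add: lin_fun_superset[of ?A] lookup_add algebra_simps sum.distrib)
qed

lemma lin_ext_add: "lin_ext f (p + q) = lin_ext f p + lin_ext f q"
proof -
  let ?A = "Poly_Mapping.keys p \<union> Poly_Mapping.keys q"
  have "Poly_Mapping.keys (p + q) \<subseteq> ?A" by (rule keys_add)
  then show ?thesis
    by (simp add: lin_ext_superset[of ?A] lookup_add free.scale_left_distrib sum.distrib)
qed

lemma lin_fun_scale: "lin_fun g (fscale c p) = c * lin_fun g p"
  by (subst lin_fun_superset[OF finite_keys keys_fscale]) (simp add: lin_fun_def sum_distrib_left mult.assoc)

lemma lin_ext_scale: "lin_ext f (fscale c p) = fscale c (lin_ext f p)"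
  by (subst lin_ext_superset[OF finite_keys keys_fscale]) (simp add: lin_ext_def free.scale_sum_right)

lemma lin_fun_zero [simp]: "lin_fun g 0 = 0"
  by (simp add: lin_fun_def)

lemma lin_ext_zero [simp]: "lin_ext f 0 = 0"
  by (simp add: lin_ext_def)

lemma lin_fun_word [simp]: "lin_fun g (Poly_Mapping.single x 1) = g x"
  by (simp add: lin_fun_def)

lemma lin_ext_word [simp]: "lin_ext f (Poly_Mapping.single x 1) = f x"
  by (simp add: lin_ext_def)

lemma lin_fun_diff: "lin_fun g (p - q) = lin_fun g p - lin_fun g q"
  using lin_fun_add[of g "p - q" q] by simp

lemma lin_ext_diff: "lin_ext f (p - q) = lin_ext f p - lin_ext f q"
  using lin_ext_add[of f "p - q" q] by simp

lemma lin_fun_sum: "lin_fun g (sum h A) = (\<Sum>a\<in>A. lin_fun g (h a))"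
  by (induction A rule: infinite_finite_induct) (simp_all add: lin_fun_add)

lemma lin_ext_sum: "lin_ext f (sum h A) = (\<Sum>a\<in>A. lin_ext f (h a))"
  by (induction A rule: infinite_finite_induct) (simp_all add: lin_ext_add)

lemma lin_fun_lin_ext: "lin_fun g (lin_ext f p) = lin_fun (\<lambda>x. lin_fun g (f x)) p"
  by (simp add: lin_ext_def[of f] lin_fun_sum lin_fun_scale) (simp add: lin_fun_def)

lemma lin_ext_lin_ext: "lin_ext g (lin_ext f p) = lin_ext (\<lambda>x. lin_ext g (f x)) p"
  by (simp add: lin_ext_def[of f] lin_ext_sum lin_ext_scale) (simp add: lin_ext_def)

lemma lin_fun_cong:
  "(\<And>x. x \<in> Poly_Mapping.keys p \<Longrightarrow> g x = h x) \<Longrightarrow> lin_fun g p = lin_fun h p"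
  by (simp add: lin_fun_def)

lemma lin_ext_cong:
  "(\<And>x. x \<in> Poly_Mapping.keys p \<Longrightarrow> f x = h x) \<Longrightarrow> lin_ext f p = lin_ext h p"
  by (simp add: lin_ext_def)

lemma lin_fun_fun_sum: "lin_fun (\<lambda>x. \<Sum>a\<in>A. g a x) p = (\<Sum>a\<in>A. lin_fun (g a) p)"
  by (simp add: lin_fun_def sum_distrib_left) (rule sum.swap)

lemma lin_fun_fun_add: "lin_fun (\<lambda>x. g x + h x) p = lin_fun g p + lin_fun h p"
  by (simp add: lin_fun_def algebra_simps sum.distrib)

lemma lin_fun_fun_scale: "lin_fun (\<lambda>x. c * g x) p = c * lin_fun g p"
  by (simp add: lin_fun_def algebra_simps sum_distrib_left)

lemma lin_fun_fun_neg: "lin_fun (\<lambda>x. - g x) p = - lin_fun g p"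
  using lin_fun_fun_scale[of "- 1" g p] by simp

lemma lin_ext_words: "p = lin_ext (\<lambda>x. Poly_Mapping.single x 1) p"
proof (rule poly_mapping_eqI)
  fix y
  have "Poly_Mapping.lookup (lin_ext (\<lambda>x. Poly_Mapping.single x 1) p) y =
      (\<Sum>x\<in>Poly_Mapping.keys p. if x = y then Poly_Mapping.lookup p x else 0)"
    unfolding lin_ext_def lookup_sum by (rule sum.cong) (auto simp: lookup_single when_def)
  also have "\<dots> = Poly_Mapping.lookup p y" by (simp add: sum.delta in_keys_iff)
  finally show "Poly_Mapping.lookup p y = Poly_Mapping.lookup (lin_ext (\<lambda>x. Poly_Mapping.single x 1) p) y"
    by simp
qed

lemma subspace_lin_ext:
  assumes "free.subspace U" "\<And>x. x \<in> Poly_Mapping.keys p \<Longrightarrow> f x \<in> U"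
  shows "lin_ext f p \<in> U"
  unfolding lin_ext_def using assms by (auto intro!: free.subspace_sum free.subspace_scale)

lemma subspace_supported: "free.subspace {p. \<forall>x\<in>Poly_Mapping.keys p. P x}"
proof (rule free.subspaceI)
  show "0 \<in> {p. \<forall>x\<in>Poly_Mapping.keys p. P x}" by simp
  show "p + q \<in> {p. \<forall>x\<in>Poly_Mapping.keys p. P x}"
    if "p \<in> {p. \<forall>x\<in>Poly_Mapping.keys p. P x}" "q \<in> {p. \<forall>x\<in>Poly_Mapping.keys p. P x}" for p q
    using that keys_add[of p q] by blast
  show "fscale c p \<in> {p. \<forall>x\<in>Poly_Mapping.keys p. P x}"
    if "p \<in> {p. \<forall>x\<in>Poly_Mapping.keys p. P x}" for c p
    using that keys_fscale[of c p] by blast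
qed


section \<open>Symplectic spaces of infinite dimension\<close>

locale inf_symplectic = symplectic_space scale \<Omega>
  for scale :: "'k::field_char_0 \<Rightarrow> 'v::ab_group_add \<Rightarrow> 'v" and \<Omega> +
  assumes infinite_dim: "finite F \<Longrightarrow> span F \<noteq> UNIV"
begin

lemma omega_add [simp]: "\<Omega> (u + v) w = \<Omega> u w + \<Omega> v w" "\<Omega> w (u + v) = \<Omega> w u + \<Omega> w v"
  and omega_scale [simp]: "\<Omega> (scale c u) w = c * \<Omega> u w" "\<Omega> w (scale c u) = c * \<Omega> w u"
  and omega_diff [simp]: "\<Omega> (u - v) w = \<Omega> u w - \<Omega> v w" "\<Omega> w (u - v) = \<Omega> w u - \<Omega> w v"
  and omega_zero [simp]: "\<Omega> 0 w = 0" "\<Omega> w 0 = 0"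
  and omega_sum: "\<Omega> (sum f A) w = (\<Sum>a\<in>A. \<Omega> (f a) w)" "\<Omega> w (sum f A) = (\<Sum>a\<in>A. \<Omega> w (f a))"
proof -
  interpret l: Vector_Spaces.linear scale "(*)" "\<lambda>u. \<Omega> u w" by (rule linear_left)
  interpret r: Vector_Spaces.linear scale "(*)" "\<lambda>u. \<Omega> w u" by (rule linear_right)
  show "\<Omega> (u + v) w = \<Omega> u w + \<Omega> v w" "\<Omega> w (u + v) = \<Omega> w u + \<Omega> w v"
    "\<Omega> (scale c u) w = c * \<Omega> u w" "\<Omega> w (scale c u) = c * \<Omega> w u"
    "\<Omega> (u - v) w = \<Omega> u w - \<Omega> v w" "\<Omega> w (u - v) = \<Omega> w u - \<Omega> w v"
    "\<Omega> 0 w = 0" "\<Omega> w 0 = 0"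
    "\<Omega> (sum f A) w = (\<Sum>a\<in>A. \<Omega> (f a) w)" "\<Omega> w (sum f A) = (\<Sum>a\<in>A. \<Omega> w (f a))"
    by (simp_all add: l.add l.scale l.diff l.zero l.sum r.add r.scale r.diff r.zero r.sum)
qed

lemma omega_swap_zero: "\<Omega> u v = 0 \<longleftrightarrow> \<Omega> v u = 0"
  using antisymmetric[of u v] by simp

text \<open>Nondegeneracy says only that no nonzero vector is orthogonal to everything. Dual vectors
  for a finite independent set are built from it by induction, in the manner of
  Gram-Schmidt.\<close>

lemma dual_family:
  assumes "finite B" "independent B"
  obtains w where "\<And>b b'. b \<in> B \<Longrightarrow> b' \<in> B \<Longrightarrow> \<Omega> b (w b') = (if b = b' then 1 else 0)"
proof -
  have "\<exists>w. \<forall>b\<in>B. \<forall>b'\<in>B. \<Omega> b (w b') = (if b = b' then 1 else 0)"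
    using assms
  proof (induction B rule: finite_induct)
    case (insert b B)
    have "independent B" "b \<notin> span B"
      using insert.prems insert.hyps independent_insert by auto
    then obtain w where w: "\<And>c c'. c \<in> B \<Longrightarrow> c' \<in> B \<Longrightarrow> \<Omega> c (w c') = (if c = c' then 1 else 0)"
      using insert.IH by blast
    \<comment> \<open>\<open>b'\<close> is the part of \<open>b\<close> orthogonal to the dual
      vectors found so far. It is nonzero as \<open>b\<close> lies outside the span of
      \<open>B\<close>, so nondegeneracy gives a vector \<open>z0\<close> not orthogonal to
      it.\<close>
    define b' where "b' = b - (\<Sum>c\<in>B. scale (\<Omega> b (w c)) c)"
    have "(\<Sum>c\<in>B. scale (\<Omega> b (w c)) c) \<in> span B" by (intro span_sum span_scale span_base)
    then have "b' \<noteq> 0" using \<open>b \<notin> span B\<close> by (auto simp: b'_def)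
    then obtain z0 where z0: "\<Omega> b' z0 \<noteq> 0" using nondegenerate by blast
    have b'w: "\<Omega> b' (w c) = 0" if "c \<in> B" for c
    proof -
      have "(\<Sum>c'\<in>B. \<Omega> b (w c') * \<Omega> c' (w c)) = (\<Sum>c'\<in>B. if c' = c then \<Omega> b (w c') else 0)"
        using that w by (intro sum.cong) auto
      then show ?thesis using that insert.hyps by (simp add: b'_def omega_sum)
    qed
    \<comment> \<open>Subtracting multiples of the \<open>w c\<close> makes \<open>z0\<close>
      orthogonal to \<open>B\<close>. Its product with \<open>b'\<close> does not change, since
      \<open>b'\<close> is orthogonal to the \<open>w c\<close>; hence its product with
      \<open>b\<close> is nonzero.\<close>
    define z1 where "z1 = z0 - (\<Sum>c\<in>B. scale (\<Omega> c z0) (w c))"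
    have z1: "\<Omega> c z1 = 0" if "c \<in> B" for c
    proof -
      have "(\<Sum>c'\<in>B. \<Omega> c' z0 * \<Omega> c (w c')) = (\<Sum>c'\<in>B. if c' = c then \<Omega> c' z0 else 0)"
        using that w by (intro sum.cong) auto
      then show ?thesis using that insert.hyps by (simp add: z1_def omega_sum)
    qed
    have "\<Omega> b' z1 = \<Omega> b' z0" by (simp add: z1_def omega_sum b'w)
    moreover have "\<Omega> b' z1 = \<Omega> b z1" by (simp add: b'_def omega_sum z1)
    ultimately have bz1: "\<Omega> b z1 \<noteq> 0" using z0 by simp
    define z where "z = scale (inverse (\<Omega> b z1)) z1"
    have z: "\<Omega> b z = 1" "\<And>c. c \<in> B \<Longrightarrow> \<Omega> c z = 0" using bz1 z1 by (auto simp: z_def)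
    show ?case
    \<comment> \<open>The old dual vectors are corrected by multiples of \<open>z\<close> so as to
      vanish against \<open>b\<close>; as \<open>z\<close> is orthogonal to \<open>B\<close>, their
      other products persist.\<close>
    proof (intro exI[of _ "\<lambda>c. if c = b then z else w c - scale (\<Omega> b (w c)) z"] ballI)
      fix c c' assume c: "c \<in> insert b B" "c' \<in> insert b B"
      show "\<Omega> c (if c' = b then z else w c' - scale (\<Omega> b (w c')) z) = (if c = c' then 1 else 0)"
      proof (cases "c' = b")
        case True
        then show ?thesis using c z by auto
      next
        case False
        then have "c' \<in> B" using c by blast
        then show ?thesis using c z w[of c c'] False by (cases "c = b") simp_all
      qed
    qed
  qed simp
  then show thesis using that by blast
qed

lemma dual_expansion:
  assumes "finite B" "\<And>b b'. b \<in> B \<Longrightarrow> b' \<in> B \<Longrightarrow> \<Omega> b (w b') = (if b = b' then 1 else 0)"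
    "v \<in> span B"
  shows "(\<Sum>b\<in>B. scale (\<Omega> v (w b)) b) = v"
  using assms(3)
proof (induction rule: span_induct_alt)
  case (step c x y)
  have "(\<Sum>b\<in>B. scale (c * \<Omega> x (w b)) b) = (\<Sum>b\<in>B. if b = x then scale c b else 0)"
    using step assms(2) by (intro sum.cong) auto
  then have "(\<Sum>b\<in>B. scale (c * \<Omega> x (w b)) b) = scale c x" using step assms(1) by simp
  then show ?case using step by (simp add: scale_left_distrib sum.distrib)
qed simp

lemma finite_dual_basis:
  assumes "finite F"
  obtains B w where "finite B" "B \<subseteq> F" "F \<subseteq> span B"
    "\<And>b b'. b \<in> B \<Longrightarrow> b' \<in> B \<Longrightarrow> \<Omega> b (w b') = (if b = b' then 1 else 0)"
    "\<And>v. v \<in> F \<Longrightarrow> (\<Sum>b\<in>B. scale (\<Omega> v (w b)) b) = v"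
proof -
  obtain B where B: "B \<subseteq> F" "independent B" "F \<subseteq> span B"
    using maximal_independent_subset by blast
  have fin: "finite B" using B(1) assms by (rule finite_subset)
  obtain w where w: "\<And>b b'. b \<in> B \<Longrightarrow> b' \<in> B \<Longrightarrow> \<Omega> b (w b') = (if b = b' then 1 else 0)"
    using dual_family[OF fin B(2)] by blast
  have "(\<Sum>b\<in>B. scale (\<Omega> v (w b)) b) = v" if "v \<in> F" for v
    using dual_expansion[OF fin w] B(3) that by blast
  then show thesis using that[OF fin B(1,3) w] by blast
qed

text \<open>Infinite dimension enters here: a vector outside the span of \<open>B\<close> and its
  dual vectors can be made orthogonal to \<open>B\<close> without falling into the span of
  \<open>B\<close>.\<close>

lemma hyperbolic_pair:
  assumes "finite F"
  obtains x y where "\<Omega> x y = 1" "\<And>f. f \<in> F \<Longrightarrow> \<Omega> f x = 0" "\<And>f. f \<in> F \<Longrightarrow> \<Omega> f y = 0"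
proof -
  obtain B where B: "B \<subseteq> F" "independent B" "F \<subseteq> span B"
    using maximal_independent_subset by blast
  have fin: "finite B" using B(1) assms by (rule finite_subset)
  obtain w where w: "\<And>b b'. b \<in> B \<Longrightarrow> b' \<in> B \<Longrightarrow> \<Omega> b (w b') = (if b = b' then 1 else 0)"
    using dual_family[OF fin B(2)] by blast
  obtain v where v: "v \<notin> span (B \<union> w ` B)" using infinite_dim[of "B \<union> w ` B"] fin by auto
  define x where "x = v - (\<Sum>b\<in>B. scale (\<Omega> b v) (w b))"
  have xB: "\<Omega> b x = 0" if "b \<in> B" for b
  proof -
    have "(\<Sum>c\<in>B. \<Omega> c v * \<Omega> b (w c)) = (\<Sum>c\<in>B. if c = b then \<Omega> c v else 0)"
      using that w by (intro sum.cong) auto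
    then show ?thesis using that fin by (simp add: x_def omega_sum)
  qed
  have "x \<notin> span B"
  proof
    assume "x \<in> span B"
    then have "x \<in> span (B \<union> w ` B)" using span_mono[of B "B \<union> w ` B"] by blast
    moreover have "(\<Sum>b\<in>B. scale (\<Omega> b v) (w b)) \<in> span (B \<union> w ` B)"
      by (intro span_sum span_scale span_base) auto
    ultimately have "x + (\<Sum>b\<in>B. scale (\<Omega> b v) (w b)) \<in> span (B \<union> w ` B)" by (rule span_add)
    then show False using v by (simp add: x_def)
  qed
  then have indep: "independent (insert x B)" "x \<notin> B"
    using independent_insertI[OF _ B(2)] span_base by blast+
  \<comment> \<open>Duality for the enlarged set gives a partner of \<open>x\<close> that is
    orthogonal to all of \<open>B\<close>.\<close>
  obtain w' where w': "\<And>b b'. b \<in> insert x B \<Longrightarrow> b' \<in> insert x B \<Longrightarrow>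
      \<Omega> b (w' b') = (if b = b' then 1 else 0)"
    using dual_family[OF _ indep(1)] fin by blast
  have zero: "\<Omega> f u = 0" if "f \<in> F" "\<And>b. b \<in> B \<Longrightarrow> \<Omega> b u = 0" for f u
  proof -
    have "f \<in> span B" using that B(3) by blast
    then show ?thesis by (induction rule: span_induct_alt) (use that in auto)
  qed
  show thesis
  proof (rule that[of x "w' x"])
    show "\<Omega> x (w' x) = 1" using w'[of x x] by simp
    show "\<Omega> f x = 0" if "f \<in> F" for f by (rule zero[OF that xB])
    show "\<Omega> f (w' x) = 0" if "f \<in> F" for f
    proof (rule zero[OF that])
      show "\<Omega> b (w' x) = 0" if "b \<in> B" for b using w'[of b x] that indep(2) by auto
    qed
  qed
qed

text \<open>Hyperbolic pairs are added one at a time, each orthogonal to \<open>F\<close> and to all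
  vectors chosen earlier.\<close>

lemma symplectic_frame:
  fixes n :: nat
  assumes "finite F"
  obtains x y where "\<And>i j. i < n \<Longrightarrow> j < n \<Longrightarrow> \<Omega> (x i) (y j) = (if i = j then 1 else 0)"
    "\<And>i j. i < n \<Longrightarrow> j < n \<Longrightarrow> \<Omega> (x i) (x j) = 0"
    "\<And>i f. i < n \<Longrightarrow> f \<in> F \<Longrightarrow> \<Omega> f (x i) = 0" "\<And>i f. i < n \<Longrightarrow> f \<in> F \<Longrightarrow> \<Omega> f (y i) = 0"
proof -
  have "\<exists>x y. \<forall>i<n. (\<forall>j<n. \<Omega> (x i) (y j) = (if i = j then 1 else 0) \<and> \<Omega> (x i) (x j) = 0) \<and>
      (\<forall>f\<in>F. \<Omega> f (x i) = 0 \<and> \<Omega> f (y i) = 0)"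
  proof (induction n)
    case (Suc n)
    then obtain x y where xy: "\<And>i j. i < n \<Longrightarrow> j < n \<Longrightarrow> \<Omega> (x i) (y j) = (if i = j then 1 else 0)"
      "\<And>i j. i < n \<Longrightarrow> j < n \<Longrightarrow> \<Omega> (x i) (x j) = 0"
      "\<And>i f. i < n \<Longrightarrow> f \<in> F \<Longrightarrow> \<Omega> f (x i) = 0" "\<And>i f. i < n \<Longrightarrow> f \<in> F \<Longrightarrow> \<Omega> f (y i) = 0"
      by blast
    obtain u v where uv: "\<Omega> u v = 1" "\<And>f. f \<in> F \<union> x ` {..<n} \<union> y ` {..<n} \<Longrightarrow> \<Omega> f u = 0"
      "\<And>f. f \<in> F \<union> x ` {..<n} \<union> y ` {..<n} \<Longrightarrow> \<Omega> f v = 0"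
      using hyperbolic_pair[of "F \<union> x ` {..<n} \<union> y ` {..<n}"] assms by auto
    have uu: "\<Omega> u u = 0"
    proof -
      have "\<Omega> u u + \<Omega> u u = 0" by (subst (1) antisymmetric) (rule left_minus)
      then show ?thesis by (simp flip: mult_2)
    qed
    have flip: "\<Omega> u (x i) = 0" "\<Omega> u (y i) = 0" if "i < n" for i
      using uv(2)[of "x i"] uv(2)[of "y i"] that omega_swap_zero by auto
    show ?case
      by (rule exI[of _ "x(n := u)"], rule exI[of _ "y(n := v)"])
        (use xy uv uu flip in \<open>auto simp: less_Suc_eq\<close>)
  qed simp
  then show thesis using that by blast
qed

end

section \<open>The symplectic Lie algebra\<close>

lemma vector_space_fun: "vector_space scale \<Longrightarrow> vector_space (\<lambda>c X v. scale c (X v))"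
  unfolding vector_space_def by (auto simp: fun_eq_iff)

context inf_symplectic
begin

abbreviation sp :: "('v \<Rightarrow> 'v) set" where "sp \<equiv> sp_inf scale \<Omega>"

text \<open>Under the usual identification of the symplectic Lie algebra with the symmetric square
  of V, this is the product of \<open>u\<close> and \<open>w\<close>. On vectors orthogonal to
  \<open>u\<close> it is the rank one operator \<open>v \<mapsto> \<Omega>(v, w) u\<close>.\<close>

definition transvection :: "'v \<Rightarrow> 'v \<Rightarrow> 'v \<Rightarrow> 'v" where
  "transvection u w v = scale (\<Omega> v w) u + scale (\<Omega> v u) w"

lemma transvection_in_sp: "transvection u w \<in> sp"
proof -
  interpret E: vector_space "\<lambda>c (X :: 'v \<Rightarrow> 'v) v. scale c (X v)"
    by (rule vector_space_fun) (rule vector_space_axioms)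
  have eq: "transvection u w = (\<lambda>v. scale (\<Omega> v w) u) + (\<lambda>v. scale (\<Omega> v u) w)"
    by (simp add: fun_eq_iff transvection_def)
  have "transvection u w \<in> gl_inf scale \<Omega>"
    unfolding eq gl_inf_def by (intro E.span_add E.span_base) blast+
  moreover have "\<Omega> (transvection u w v) v' + \<Omega> v (transvection u w v') = 0" for v v'
    unfolding transvection_def omega_add omega_scale
    by (subst antisymmetric[of v' w], subst antisymmetric[of v' u]) (simp add: algebra_simps)
  ultimately show ?thesis by (simp add: sp_inf_def)
qed

lemma sp_invariant: "X \<in> sp \<Longrightarrow> \<Omega> (X u) v = - \<Omega> u (X v)"
  by (auto simp: sp_inf_def eq_neg_iff_add_eq_0)

end


section \<open>Tensors as formal sums of words\<close>

definition words :: "nat \<Rightarrow> ('v list \<Rightarrow>\<^sub>0 'k::field) set" where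
  "words d = {p. \<forall>vs\<in>Poly_Mapping.keys p. length vs = d}"

lemma subspace_words: "free.subspace (words d)"
  unfolding words_def by (rule subspace_supported)

lemma word_in_words: "length vs = d \<Longrightarrow> word vs \<in> words d"
  by (simp add: words_def)

definition word_act :: "('v \<Rightarrow> 'v) \<Rightarrow> ('v list \<Rightarrow>\<^sub>0 'k::field) \<Rightarrow> ('v list \<Rightarrow>\<^sub>0 'k)" where
  "word_act X = lin_ext (\<lambda>vs. \<Sum>i<length vs. word (vs[i := X (vs ! i)]))"

lemma word_act_in_words: "p \<in> words d \<Longrightarrow> word_act X p \<in> words d"
  unfolding word_act_def
  by (intro subspace_lin_ext subspace_words free.subspace_sum word_in_words) (auto simp: words_def)

definition contract :: "('v \<Rightarrow> 'v \<Rightarrow> 'k::field) \<Rightarrow> (nat \<times> nat) list \<Rightarrow> ('v list \<Rightarrow>\<^sub>0 'k) \<Rightarrow> ('v list \<Rightarrow>\<^sub>0 'k)" where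
  "contract \<Omega> Is = lin_ext (contract_word \<Omega> Is)"

definition inds :: "(nat \<times> nat) list \<Rightarrow> nat list" where
  "inds Is = map fst Is @ map snd Is"

text \<open>Increasing, in the order used by \<open>nths\<close>, so that position \<open>i\<close>
  of a contracted word is position \<open>free_positions d Is ! i\<close> of the original
  one.\<close>

definition free_positions :: "nat \<Rightarrow> (nat \<times> nat) list \<Rightarrow> nat list" where
  "free_positions d Is = nths [0..<d] (- set (inds Is))"

lemma set_inds: "set (inds Is) = fst ` set Is \<union> snd ` set Is"
  by (simp add: inds_def)

lemma disjoint_index_pairsD:
  assumes "disjoint_index_pairs d Is"
  shows "distinct (inds Is)" "set (inds Is) \<subseteq> {..<d}" "\<And>i j. (i, j) \<in> set Is \<Longrightarrow> i < j \<and> j < d"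
  using assms by (force simp: disjoint_index_pairs_def inds_def)+

lemma set_free_positions: "set (free_positions d Is) = {..<d} - set (inds Is)"
proof -
  have "set (free_positions d Is) = {[0..<d] ! i |i. i < d \<and> i \<notin> set (inds Is)}"
    by (simp add: free_positions_def set_nths)
  also have "\<dots> = {i |i. i < d \<and> i \<notin> set (inds Is)}" by (rule Collect_cong) force
  finally show ?thesis by auto
qed

lemma distinct_free_positions: "distinct (free_positions d Is)"
  by (simp add: free_positions_def)

lemma length_inds: "length (inds Is) = 2 * length Is"
  by (simp add: inds_def)

lemma length_free_positions:
  assumes "disjoint_index_pairs d Is"
  shows "length (free_positions d Is) = d - 2 * length Is"
proof -
  have "length (free_positions d Is) = card ({..<d} - set (inds Is))"
    using distinct_card[OF distinct_free_positions] set_free_positions by metis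
  also have "\<dots> = d - 2 * length Is"
    using disjoint_index_pairsD[OF assms] by (simp add: card_Diff_subset distinct_card length_inds)
  finally show ?thesis .
qed

lemma disjoint_index_pairs_length:
  assumes "disjoint_index_pairs d Is"
  shows "2 * length Is \<le> d"
  using card_mono[OF _ disjoint_index_pairsD(2)[OF assms]] disjoint_index_pairsD(1)[OF assms]
  by (simp add: distinct_card length_inds)

lemma nths_eq_map: "nths vs A = map ((!) vs) (nths [0..<length vs] A)"
  by (metis map_nth nths_map)

lemma contract_word_eq:
  assumes "length vs = d"
  shows "contract_word \<Omega> Is vs = fscale (\<Prod>(i, j)\<leftarrow>Is. \<Omega> (vs ! i) (vs ! j))
    (word (map ((!) vs) (free_positions d Is)))"
  using assms nths_eq_map[of vs] by (simp add: contract_word_def free_positions_def set_inds)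

lemma contract_in_words:
  assumes "disjoint_index_pairs d Is" "p \<in> words d"
  shows "contract \<Omega> Is p \<in> words (d - 2 * length Is)"
  unfolding contract_def
  by (intro subspace_lin_ext subspace_words)
    (use assms in \<open>auto simp: words_def contract_word_eq length_free_positions
      intro!: free.subspace_scale[OF subspace_words, unfolded words_def] dest!: keys_fscale[THEN subsetD]\<close>)


section \<open>Evaluation of tensors\<close>

context inf_symplectic
begin

text \<open>The product of \<open>\<Omega>\<close> over a matching of the positions of a list encodes contractions and
  evaluations at once.\<close>

definition match_prod :: "(nat \<times> nat) list \<Rightarrow> 'v list \<Rightarrow> 'k" where
  "match_prod Ps u = (\<Prod>(i, j)\<leftarrow>Ps. \<Omega> (u ! i) (u ! j))"

lemma match_prod_simps [simp]:
  "match_prod [] u = 1" "match_prod ((i, j) # Ps) u = \<Omega> (u ! i) (u ! j) * match_prod Ps u"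
  "match_prod (Ps @ Qs) u = match_prod Ps u * match_prod Qs u"
  by (simp_all add: match_prod_def)

lemma match_prod_cong:
  "(\<And>m. m \<in> set (inds Ps) \<Longrightarrow> u ! m = u' ! m) \<Longrightarrow> match_prod Ps u = match_prod Ps u'"
  unfolding match_prod_def
proof (intro arg_cong[of _ _ prod_list] map_cong refl)
  fix x assume "\<And>m. m \<in> set (inds Ps) \<Longrightarrow> u ! m = u' ! m" "x \<in> set Ps"
  then have "u ! fst x = u' ! fst x" "u ! snd x = u' ! snd x" by (simp_all add: set_inds)
  then show "(case x of (i, j) \<Rightarrow> \<Omega> (u ! i) (u ! j)) = (case x of (i, j) \<Rightarrow> \<Omega> (u' ! i) (u' ! j))"
    by (simp add: case_prod_beta)
qed

lemma match_prod_unchanged: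
  "m \<notin> set (inds Ps) \<Longrightarrow> match_prod Ps (u[m := a]) = match_prod Ps u"
  by (rule match_prod_cong) (metis nth_list_update_neq)

lemma inds_Cons:
  "set (inds ((i, j) # Ps)) = insert i (insert j (set (inds Ps)))"
  "distinct (inds ((i, j) # Ps)) \<longleftrightarrow>
     i \<noteq> j \<and> i \<notin> set (inds Ps) \<and> j \<notin> set (inds Ps) \<and> distinct (inds Ps)"
  by (auto simp: inds_def)

text \<open>Each position occurs in exactly one pair of the matching, so one factor of the product
  depends on it, and linearly.\<close>

lemma match_prod_multilinear:
  assumes "distinct (inds Ps)" "m \<in> set (inds Ps)" "m < length u"
  shows "match_prod Ps (u[m := v + w]) = match_prod Ps (u[m := v]) + match_prod Ps (u[m := w])"
    and "match_prod Ps (u[m := scale c v]) = c * match_prod Ps (u[m := v])"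
proof -
  have "match_prod Ps (u[m := v + w]) = match_prod Ps (u[m := v]) + match_prod Ps (u[m := w]) \<and>
    match_prod Ps (u[m := scale c v]) = c * match_prod Ps (u[m := v])"
    using assms
  proof (induction Ps)
    case (Cons ij Ps)
    obtain i j where ij: "ij = (i, j)" by force
    note d = Cons.prems(1)[unfolded ij inds_Cons(2)]
    consider "m = i" | "m = j" | "m \<in> set (inds Ps)" "m \<noteq> i" "m \<noteq> j"
      using Cons.prems(2) unfolding ij inds_Cons(1) by blast
    then show ?case
    proof cases
      case 3
      then show ?thesis using Cons.IH Cons.prems(3) d by (simp add: ij algebra_simps)
    qed (use Cons.prems(3) d in \<open>simp_all add: ij match_prod_unchanged algebra_simps\<close>)
  qed (simp add: inds_def)
  then show "match_prod Ps (u[m := v + w]) = match_prod Ps (u[m := v]) + match_prod Ps (u[m := w])"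
    "match_prod Ps (u[m := scale c v]) = c * match_prod Ps (u[m := v])" by blast+
qed

text \<open>For each pair, the two terms in which \<open>X\<close> hits one of its members cancel by
  the invariance of \<open>\<Omega>\<close>.\<close>

lemma match_prod_invariant:
  assumes "X \<in> sp" "distinct (inds Ps)" "\<And>m. m \<in> set (inds Ps) \<Longrightarrow> m < length u"
  shows "(\<Sum>m\<in>set (inds Ps). match_prod Ps (u[m := X (u ! m)])) = 0"
  using assms(2,3)
proof (induction Ps)
  case (Cons ij Ps)
  obtain i j where ij: "ij = (i, j)" by force
  note d = Cons.prems(1)[unfolded ij inds_Cons(2)]
  have len: "i < length u" "j < length u" using Cons.prems(2) unfolding ij inds_Cons by auto
  have "(\<Sum>m\<in>set (inds Ps). match_prod (ij # Ps) (u[m := X (u ! m)])) =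
      (\<Sum>m\<in>set (inds Ps). \<Omega> (u ! i) (u ! j) * match_prod Ps (u[m := X (u ! m)]))"
  proof (rule sum.cong[OF refl])
    fix m assume "m \<in> set (inds Ps)"
    then have "m \<noteq> i" "m \<noteq> j" using d by auto
    then show "match_prod (ij # Ps) (u[m := X (u ! m)]) = \<Omega> (u ! i) (u ! j) * match_prod Ps (u[m := X (u ! m)])"
      by (simp add: ij)
  qed
  also have "\<dots> = 0"
    using Cons d unfolding ij inds_Cons by (simp add: sum_distrib_left[symmetric])
  finally show ?case
    using d len sp_invariant[OF assms(1), of "u ! i" "u ! j"]
    by (simp add: ij inds_Cons match_prod_unchanged)
qed (simp add: inds_def)

text \<open>The pairing induced by \<open>\<Omega>\<close> between a tensor and the pure tensor with
  factors \<open>z\<close>. Letters of the tensor are always the left arguments, which fixes the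
  signs.\<close>

definition ev :: "'v list \<Rightarrow> ('v list \<Rightarrow>\<^sub>0 'k) \<Rightarrow> 'k" where
  "ev z = lin_fun (\<lambda>vs. \<Prod>i<length z. \<Omega> (vs ! i) (z ! i))"

lemma ev_add: "ev z (p + q) = ev z p + ev z q"
  and ev_diff: "ev z (p - q) = ev z p - ev z q"
  and ev_scale: "ev z (fscale c p) = c * ev z p"
  and ev_sum: "ev z (sum h A) = (\<Sum>a\<in>A. ev z (h a))"
  and ev_zero: "ev z 0 = 0"
  and ev_lin_ext: "ev z (lin_ext f p) = lin_fun (\<lambda>x. ev z (f x)) p"
  and ev_word: "ev z (word vs) = (\<Prod>i<length z. \<Omega> (vs ! i) (z ! i))"
  unfolding ev_def
  by (simp_all add: lin_fun_add lin_fun_diff lin_fun_scale lin_fun_sum lin_fun_lin_ext)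

abbreviation contr :: "(nat \<times> nat) list \<Rightarrow> ('v list \<Rightarrow>\<^sub>0 'k) \<Rightarrow> ('v list \<Rightarrow>\<^sub>0 'k)" where
  "contr \<equiv> contract \<Omega>"

lemma contr_add: "contr Is (p + q) = contr Is p + contr Is q"
  and contr_diff: "contr Is (p - q) = contr Is p - contr Is q"
  and contr_scale: "contr Is (fscale c p) = fscale c (contr Is p)"
  and contr_sum: "contr Is (sum h A) = (\<Sum>a\<in>A. contr Is (h a))"
  and contr_zero: "contr Is 0 = 0"
  by (simp_all add: contract_def lin_ext_add lin_ext_diff lin_ext_scale lin_ext_sum)

text \<open>In \<open>vs @ z\<close> the test vectors occupy the positions from \<open>d\<close> on.
  Matching the n-th free position with \<open>d + n\<close> turns contraction followed by evaluation
  into one product over a perfect matching.\<close>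

definition full_matching :: "nat \<Rightarrow> (nat \<times> nat) list \<Rightarrow> (nat \<times> nat) list" where
  "full_matching d Is =
     Is @ zip (free_positions d Is) [d..<d + length (free_positions d Is)]"

lemma full_matching:
  assumes "disjoint_index_pairs d Is"
  shows "distinct (inds (full_matching d Is))"
    and "set (inds (full_matching d Is)) = {..<d + (d - 2 * length Is)}"
proof -
  note D = disjoint_index_pairsD[OF assms]
  note L = length_free_positions[OF assms]
  have i: "inds (full_matching d Is) = map fst Is @ free_positions d Is @ map snd Is @
      [d..<d + length (free_positions d Is)]"
    by (simp add: inds_def full_matching_def)
  show "distinct (inds (full_matching d Is))"
    unfolding i using D(1,2) distinct_free_positions[of d Is] set_free_positions[of d Is]
    by (auto simp: inds_def)
  show "set (inds (full_matching d Is)) = {..<d + (d - 2 * length Is)}"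
    unfolding i using D(2) set_free_positions[of d Is] L by (auto simp: inds_def)
qed

lemma match_prod_zip:
  assumes "length qs = length z" "\<And>q. q \<in> set qs \<Longrightarrow> q < length vs"
  shows "match_prod (zip qs [length vs..<length vs + length z]) (vs @ z) =
    (\<Prod>i<length z. \<Omega> (vs ! (qs ! i)) (z ! i))"
proof -
  have "map (\<lambda>(i, j). \<Omega> ((vs @ z) ! i) ((vs @ z) ! j)) (zip qs [length vs..<length vs + length z]) =
    map (\<lambda>i. \<Omega> (vs ! (qs ! i)) (z ! i)) [0..<length z]"
    using assms by (intro nth_equalityI) (auto simp: nth_append)
  then show ?thesis
    unfolding match_prod_def
    by (simp add: prod.distinct_set_conv_list atLeast_upt del: set_upt)
qed

lemma ev_contr_word:
  assumes "disjoint_index_pairs d Is" "length vs = d" "length z = d - 2 * length Is"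
  shows "ev z (contract_word \<Omega> Is vs) = match_prod (full_matching d Is) (vs @ z)"
proof -
  have "match_prod Is vs = match_prod Is (vs @ z)"
    using disjoint_index_pairsD[OF assms(1)] assms(2) by (intro match_prod_cong) (auto simp: nth_append)
  moreover have "match_prod (zip (free_positions d Is) [d..<d + length (free_positions d Is)]) (vs @ z) =
      (\<Prod>i<length z. \<Omega> (vs ! (free_positions d Is ! i)) (z ! i))"
    using match_prod_zip[of "free_positions d Is" z vs] assms set_free_positions[of d Is]
    by (simp add: length_free_positions)
  ultimately show ?thesis
    unfolding contract_word_eq[OF assms(2)] ev_scale ev_word full_matching_def match_prod_simps
    using assms by (simp add: match_prod_def length_free_positions)
qed

lemma ev_contr:
  assumes "disjoint_index_pairs d Is" "p \<in> words d" "length z = d - 2 * length Is"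
  shows "ev z (contr Is p) = lin_fun (\<lambda>vs. match_prod (full_matching d Is) (vs @ z)) p"
  unfolding contract_def ev_lin_ext
  by (rule lin_fun_cong) (use assms ev_contr_word in \<open>auto simp: words_def\<close>)

lemma disjoint_index_pairs_Nil: "disjoint_index_pairs d []"
  by (simp add: disjoint_index_pairs_def)

lemma contr_Nil: "contr [] p = p"
  unfolding contract_def contract_word_def by (simp add: nths_all flip: lin_ext_words)

text \<open>The full matching uses all positions of \<open>vs @ z\<close>, so the terms with
  \<open>X\<close> on the letters and those with \<open>X\<close> on the test vectors add up to
  zero. The operator thereby moves from the tensor to the test vectors.\<close>

lemma ev_word_act_contr:
  assumes "X \<in> sp" "disjoint_index_pairs d Is" "p \<in> words d" "length z = d - 2 * length Is"
  shows "ev z (contr Is (word_act X p)) = - (\<Sum>n<length z. ev (z[n := X (z ! n)]) (contr Is p))"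
proof -
  let ?M = "full_matching d Is"
  have "(\<Sum>i<d. match_prod ?M (vs[i := X (vs ! i)] @ z)) =
      - (\<Sum>n<length z. match_prod ?M (vs @ z[n := X (z ! n)]))" if "length vs = d" for vs
  proof -
    have "(\<Sum>m\<in>set (inds ?M). match_prod ?M ((vs @ z)[m := X ((vs @ z) ! m)])) = 0"
      using full_matching[OF assms(2)] that assms(4) by (intro match_prod_invariant[OF assms(1)]) auto
    then have "(\<Sum>m<d + length z. match_prod ?M ((vs @ z)[m := X ((vs @ z) ! m)])) = 0"
      unfolding full_matching(2)[OF assms(2)] assms(4) .
    also have "{..<d + length z} = {..<d} \<union> (\<lambda>n. d + n) ` {..<length z}"
      unfolding lessThan_atLeast0 image_add_atLeastLessThan by auto
    finally have "(\<Sum>m<d. match_prod ?M ((vs @ z)[m := X ((vs @ z) ! m)])) +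
        (\<Sum>n<length z. match_prod ?M ((vs @ z)[d + n := X ((vs @ z) ! (d + n))])) = 0"
      by (subst (asm) sum.union_disjoint) (auto simp: sum.reindex)
    moreover have "(\<Sum>m<d. match_prod ?M ((vs @ z)[m := X ((vs @ z) ! m)])) =
        (\<Sum>i<d. match_prod ?M (vs[i := X (vs ! i)] @ z))"
      using that by (intro sum.cong) (auto simp: nth_append list_update_append)
    moreover have "(\<Sum>n<length z. match_prod ?M ((vs @ z)[d + n := X ((vs @ z) ! (d + n))])) =
        (\<Sum>n<length z. match_prod ?M (vs @ z[n := X (z ! n)]))"
      using that by (intro sum.cong) (auto simp: nth_append list_update_append)
    ultimately show ?thesis by (simp add: eq_neg_iff_add_eq_0)
  qed
  then have eq: "(\<Sum>i<length vs. match_prod ?M (vs[i := X (vs ! i)] @ z)) =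
      (\<Sum>n<length z. - match_prod ?M (vs @ z[n := X (z ! n)]))" if "length vs = d" for vs
    using that by (simp add: sum_negf)
  have "ev z (contr Is (word_act X p)) =
      lin_fun (\<lambda>vs. \<Sum>i<length vs. match_prod ?M (vs[i := X (vs ! i)] @ z)) p"
    unfolding ev_contr[OF assms(2) word_act_in_words[OF assms(3)] assms(4)]
    unfolding word_act_def lin_fun_lin_ext by (simp add: lin_fun_sum)
  also have "\<dots> = lin_fun (\<lambda>vs. \<Sum>n<length z. - match_prod ?M (vs @ z[n := X (z ! n)])) p"
    by (rule lin_fun_cong, rule eq) (use assms(3) in \<open>simp add: words_def\<close>)
  also have "\<dots> = - (\<Sum>n<length z. ev (z[n := X (z ! n)]) (contr Is p))"
    using assms by (simp add: lin_fun_fun_sum lin_fun_fun_neg sum_negf ev_contr)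
  finally show ?thesis .
qed

lemma ev_word_act:
  assumes "X \<in> sp" "p \<in> words d" "length z = d"
  shows "ev z (word_act X p) = - (\<Sum>n<length z. ev (z[n := X (z ! n)]) p)"
  using ev_word_act_contr[OF assms(1) disjoint_index_pairs_Nil assms(2), of z] assms(3)
  by (simp add: contr_Nil)

text \<open>Both sides are minus the sum in which \<open>X\<close> acts on the test vectors;
  contractions are therefore equivariant as maps of tensors.\<close>

lemma ev_contr_word_act:
  assumes "X \<in> sp" "disjoint_index_pairs d Is" "p \<in> words d" "length z = d - 2 * length Is"
  shows "ev z (contr Is (word_act X p)) = ev z (word_act X (contr Is p))"
  using ev_word_act_contr[OF assms] ev_word_act[OF assms(1) contract_in_words[OF assms(2,3)] assms(4)]
  by simp


subsection \<open>The relations of multilinearity\<close>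

abbreviation null :: "nat \<Rightarrow> ('v list \<Rightarrow>\<^sub>0 'k) set" where "null \<equiv> tensor_null scale"

lemma subspace_null: "free.subspace (null d)"
  by (simp add: tensor_null_def)

lemma null_subset_words: "null d \<subseteq> words d"
  unfolding tensor_null_def
proof (rule free.span_minimal[OF _ subspace_words])
  show "multilinear_relations scale d \<subseteq> words d"
    unfolding multilinear_relations_def
    by (auto intro!: free.subspace_diff[OF subspace_words] free.subspace_scale[OF subspace_words]
        word_in_words)
qed

text \<open>The value is linear in each letter, as each position is matched once, and so it vanishes
  on the relations of multilinearity.\<close>

lemma ev_contr_null:
  assumes "disjoint_index_pairs d Is" "p \<in> null d" "length z = d - 2 * length Is"
  shows "ev z (contr Is p) = 0"
proof -
  let ?M = "full_matching d Is"
  let ?g = "\<lambda>vs. match_prod ?M (vs @ z)"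
  have upd: "us @ v # ws = (us @ 0 # ws)[length us := v]" for us ws and v :: 'v by simp
  have lin: "?g (us @ (v + w) # ws) = ?g (us @ v # ws) + ?g (us @ w # ws)"
    "?g (us @ scale c v # ws) = c * ?g (us @ v # ws)"
    if "length us + 1 + length ws = d" for us v w ws c
    unfolding append_assoc append_Cons
    unfolding upd[of us "v + w"] upd[of us "scale c v"] upd[of us v] upd[of us w]
    using that assms(3) full_matching[OF assms(1)] by (intro match_prod_multilinear; simp)+
  have "lin_fun ?g p = 0"
    using assms(2) unfolding tensor_null_def
  proof (induction rule: free.span_induct_alt)
    case (step c x y)
    then have "lin_fun ?g x = 0"
      using lin unfolding multilinear_relations_def
      by (auto simp: lin_fun_diff lin_fun_scale)
    then show ?case using step by (simp add: lin_fun_add lin_fun_scale)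
  qed simp
  then show ?thesis using ev_contr[OF assms(1) subsetD[OF null_subset_words assms(2)] assms(3)] by simp
qed

text \<open>The letters are expanded from left to right; the prefix \<open>bs\<close> is the part
  already written in letters of \<open>B\<close>.\<close>

lemma word_in_span_basis_words:
  assumes "set vs \<subseteq> span B" "set bs \<subseteq> B" "length bs + length vs = d"
  shows "word (bs @ vs) \<in> free.span (multilinear_relations scale d \<union>
    {word bs | bs. set bs \<subseteq> B \<and> length bs = d})" (is "_ \<in> free.span ?S")
  using assms
proof (induction vs arbitrary: bs)
  case Nil
  then show ?case by (intro free.span_base) auto
next
  case (Cons v vs)
  have len: "length bs + 1 + length vs = d" using Cons.prems by simp
  have add: "word (bs @ (x + y) # vs) - word (bs @ x # vs) - word (bs @ y # vs) \<in> free.span ?S"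
    for x y
    using len unfolding multilinear_relations_def by (intro free.span_base) blast
  have sc: "word (bs @ scale c x # vs) - fscale c (word (bs @ x # vs)) \<in> free.span ?S" for c x
    using len unfolding multilinear_relations_def by (intro free.span_base) blast
  have "v \<in> span B" using Cons.prems by simp
  then show ?case
  proof (induction rule: span_induct_alt)
    case base
    show ?case using sc[of 0 0] by simp
  next
    case (step c x y)
    have "word ((bs @ [x]) @ vs) \<in> free.span ?S"
      using Cons.prems step by (intro Cons.IH) auto
    then have "fscale c (word (bs @ x # vs)) \<in> free.span ?S" by (simp add: free.span_scale)
    from free.span_add[OF sc[of c x] this] have "word (bs @ scale c x # vs) \<in> free.span ?S" by simp
    from free.span_add[OF add[of "scale c x" y] free.span_add[OF this step(2)]]
    show ?case by (simp add: algebra_simps)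
  qed
qed

text \<open>Modulo the relations the sum is a combination of words in \<open>B\<close>, and
  evaluation at the dual words reads off its coefficients. That dual vectors suffice as test vectors
  matters in \<open>nonzero_coeff\<close>, since raising is controlled for them only.\<close>

lemma null_dualI:
  assumes "p \<in> words d" "\<And>vs. vs \<in> Poly_Mapping.keys p \<Longrightarrow> set vs \<subseteq> span B"
    and dual: "\<And>b b'. b \<in> B \<Longrightarrow> b' \<in> B \<Longrightarrow> \<Omega> b (w b') = (if b = b' then 1 else 0)"
    and zero: "\<And>bs. set bs \<subseteq> B \<Longrightarrow> length bs = d \<Longrightarrow> ev (map w bs) p = 0"
  shows "p \<in> null d"
proof -
  let ?W = "{word bs | bs. set bs \<subseteq> B \<and> length bs = d}"
  have "lin_ext word p \<in> free.span (multilinear_relations scale d \<union> ?W)"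
  proof (rule subspace_lin_ext[OF free.subspace_span])
    fix vs assume "vs \<in> Poly_Mapping.keys p"
    then have "length vs = d" "set vs \<subseteq> span B" using assms(1,2) by (auto simp: words_def)
    then show "word vs \<in> free.span (multilinear_relations scale d \<union> ?W)"
      using word_in_span_basis_words[of vs B "[]" d] by simp
  qed
  then have "p \<in> free.span (multilinear_relations scale d \<union> ?W)"
    by (simp flip: lin_ext_words)
  then obtain q r where qr: "p = q + r" "q \<in> null d" "r \<in> free.span ?W"
    unfolding free.span_Un tensor_null_def by blast
  have "free.span ?W \<subseteq> {p. \<forall>bs\<in>Poly_Mapping.keys p. set bs \<subseteq> B \<and> length bs = d}"
    by (rule free.span_minimal[OF _ subspace_supported]) auto
  then have r: "\<And>bs. bs \<in> Poly_Mapping.keys r \<Longrightarrow> set bs \<subseteq> B \<and> length bs = d" using qr by blast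
  have "Poly_Mapping.lookup r bs = 0" if bs: "bs \<in> Poly_Mapping.keys r" for bs
  proof -
    have len: "length bs = d" and sub: "set bs \<subseteq> B" using r[OF bs] by auto
    have "ev (map w bs) r = 0"
      using zero[OF sub len] ev_contr_null[OF disjoint_index_pairs_Nil qr(2), of "map w bs"] len
      by (simp add: qr(1) ev_add contr_Nil)
    moreover have "ev (map w bs) r = (\<Sum>cs\<in>Poly_Mapping.keys r.
        if cs = bs then Poly_Mapping.lookup r bs else 0)"
      unfolding ev_def lin_fun_def
    proof (rule sum.cong[OF refl])
      fix cs assume cs: "cs \<in> Poly_Mapping.keys r"
      have \<delta>: "\<Omega> (cs ! i) (w (bs ! i)) = (if cs ! i = bs ! i then 1 else 0)" if "i < d" for i
        using that r[OF cs] sub len by (intro dual) auto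
      have "(\<Prod>i<length (map w bs). \<Omega> (cs ! i) (map w bs ! i)) = (\<Prod>i<d. if cs ! i = bs ! i then 1 else 0)"
        using len \<delta> by (intro prod.cong) auto
      also have "\<dots> = (if cs = bs then 1 else 0)"
        using r[OF cs] len by (auto simp: list_eq_iff_nth_eq)
      finally show "Poly_Mapping.lookup r cs * (\<Prod>i<length (map w bs). \<Omega> (cs ! i) (map w bs ! i)) =
          (if cs = bs then Poly_Mapping.lookup r bs else 0)" by simp
    qed
    ultimately show ?thesis using bs by (simp add: sum.delta)
  qed
  then have "r = 0" by (intro poly_mapping_eqI) (metis in_keys_iff lookup_zero)
  then show ?thesis using qr by simp
qed

text \<open>Finitely many letters occur, so a basis of their span has a dual family and
  \<open>null_dualI\<close> applies.\<close>

lemma nullI: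
  assumes "p \<in> words d" "\<And>z. length z = d \<Longrightarrow> ev z p = 0"
  shows "p \<in> null d"
proof -
  define F where "F = (\<Union>vs\<in>Poly_Mapping.keys p. set vs)"
  have "finite F" by (simp add: F_def)
  then obtain B w where B: "finite B" "B \<subseteq> F" "F \<subseteq> span B"
    "\<And>b b'. b \<in> B \<Longrightarrow> b' \<in> B \<Longrightarrow> \<Omega> b (w b') = (if b = b' then 1 else 0)"
    "\<And>v. v \<in> F \<Longrightarrow> (\<Sum>b\<in>B. scale (\<Omega> v (w b)) b) = v"
    by (rule finite_dual_basis) blast
  show ?thesis
    by (rule null_dualI[OF assms(1) _ B(4)]) (use B(3) assms(2) in \<open>auto simp: F_def\<close>)
qed

lemma null_iff: "p \<in> words d \<Longrightarrow> p \<in> null d \<longleftrightarrow> (\<forall>z. length z = d \<longrightarrow> ev z p = 0)"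
  using nullI ev_contr_null[OF disjoint_index_pairs_Nil] by (auto simp: contr_Nil)

lemma contr_null:
  assumes "disjoint_index_pairs d Is" "p \<in> null d"
  shows "contr Is p \<in> null (d - 2 * length Is)"
  using assms null_subset_words ev_contr_null by (intro nullI contract_in_words) auto

end


section \<open>Layers of iterated contractions\<close>

lemma free_positions_filter: "free_positions d Is = filter (\<lambda>m. m \<notin> set (inds Is)) [0..<d]"
  unfolding free_positions_def nths_def by (simp add: zip_same_conv_map filter_map o_def)

lemma disjoint_index_pairs_iff:
  "disjoint_index_pairs d Is \<longleftrightarrow> (\<forall>(i, j)\<in>set Is. i < j \<and> j < d) \<and> distinct (inds Is)"
  by (simp add: disjoint_index_pairs_def inds_def)

lemma disjoint_index_pairs_single: "i < j \<Longrightarrow> j < d \<Longrightarrow> disjoint_index_pairs d [(i, j)]"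
  by (simp add: disjoint_index_pairs_def)

text \<open>Contraction renumbers the remaining positions: the i-th of them is the i-th free
  position of the original word. Iterating contractions means translating pairs along
  \<open>free_positions\<close>.\<close>

lemma contr_pair_contr:
  assumes Is: "disjoint_index_pairs d Is" and p: "p \<in> words d" and ij: "i < j" "j < d - 2 * length Is"
  shows "contract \<Omega> [(i, j)] (contract \<Omega> Is p) =
    contract \<Omega> (Is @ [(free_positions d Is ! i, free_positions d Is ! j)]) p"
proof -
  let ?q = "free_positions d Is"
  let ?e = "d - 2 * length Is"
  have len: "length ?q = ?e" by (rule length_free_positions[OF Is])
  have dist: "distinct ?q" by (rule distinct_free_positions)
  let ?J = "Is @ [(?q ! i, ?q ! j)]"
  have fq: "map ((!) ?q) (free_positions ?e [(i, j)]) = free_positions d ?J"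
  proof -
    have "free_positions d ?J = filter (\<lambda>m. m \<noteq> ?q ! i \<and> m \<noteq> ?q ! j) ?q"
      unfolding free_positions_filter by (auto simp: inds_def intro!: filter_cong)
    also have "\<dots> = filter (\<lambda>m. m \<noteq> ?q ! i \<and> m \<noteq> ?q ! j) (map ((!) ?q) [0..<?e])"
      using map_nth[of ?q] len by simp
    also have "\<dots> = map ((!) ?q) (filter (\<lambda>n. n \<noteq> i \<and> n \<noteq> j) [0..<?e])"
      unfolding filter_map o_def using dist ij len
      by (intro arg_cong[of _ _ "map ((!) ?q)"] filter_cong) (auto simp: nth_eq_iff_index_eq)
    finally show ?thesis unfolding free_positions_filter[of ?e] by (simp add: inds_def)
  qed
  have fp: "map ((!) (map ((!) vs) ?q)) (free_positions ?e [(i, j)]) =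
      map ((!) vs) (free_positions d ?J)" for vs :: "'a list"
  proof -
    have "n < length ?q" if "n \<in> set (free_positions ?e [(i, j)])" for n
      using that len unfolding set_free_positions by simp
    then have "map ((!) (map ((!) vs) ?q)) (free_positions ?e [(i, j)]) =
        map ((!) vs) (map ((!) ?q) (free_positions ?e [(i, j)]))"
      by simp
    then show ?thesis using fq by simp
  qed
  show ?thesis
    unfolding contract_def lin_ext_lin_ext
  proof (rule lin_ext_cong)
    fix vs :: "'a list" assume "vs \<in> Poly_Mapping.keys p"
    then have vs: "length vs = d" using p by (simp add: words_def)
    show "lin_ext (contract_word \<Omega> [(i, j)]) (contract_word \<Omega> Is vs) = contract_word \<Omega> ?J vs"
      unfolding contract_word_eq[OF vs] lin_ext_scale lin_ext_word
      by (subst contract_word_eq[where d = ?e]) (use len ij in \<open>simp_all add: fp\<close>)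
  qed
qed

lemma disjoint_index_pairs_append:
  assumes Is: "disjoint_index_pairs d Is" and ij: "i < j" "j < d - 2 * length Is"
  shows "disjoint_index_pairs d (Is @ [(free_positions d Is ! i, free_positions d Is ! j)])"
proof -
  let ?q = "free_positions d Is"
  have len: "length ?q = d - 2 * length Is" by (rule length_free_positions[OF Is])
  have "sorted_wrt (<) ?q" unfolding free_positions_filter by (rule sorted_wrt_filter) simp
  then have lt: "?q ! i < ?q ! j" using ij len by (simp add: sorted_wrt_nth_less)
  have "?q ! i \<in> set ?q" "?q ! j \<in> set ?q" using ij len by simp_all
  then have "?q ! j < d" "?q ! i \<notin> set (inds Is)" "?q ! j \<notin> set (inds Is)"
    unfolding set_free_positions by auto
  then show ?thesis
    using lt Is by (auto simp: disjoint_index_pairs_iff inds_def)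
qed

text \<open>Converse of \<open>disjoint_index_pairs_append\<close>: the last pair consists of
  positions left free by the others, and its order survives the renumbering because free positions
  increase.\<close>

lemma disjoint_index_pairs_snocE:
  assumes "disjoint_index_pairs d Js" "length Js = Suc r"
  obtains Is i j where "disjoint_index_pairs d Is" "length Is = r" "i < j" "j < d - 2 * r"
    "Js = Is @ [(free_positions d Is ! i, free_positions d Is ! j)]"
proof -
  obtain Is a b where J: "Js = Is @ [(a, b)]"
    using assms(2) by (metis length_0_conv nat.simps(3) rev_exhaust surj_pair)
  have Is: "disjoint_index_pairs d Is" and ab: "a < b" "b < d" "a \<notin> set (inds Is)" "b \<notin> set (inds Is)"
    using assms(1) by (auto simp: J disjoint_index_pairs_iff inds_def)
  have r: "length Is = r" using assms(2) J by simp
  let ?q = "free_positions d Is"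
  have len: "length ?q = d - 2 * r" using length_free_positions[OF Is] r by simp
  have "a \<in> set ?q" "b \<in> set ?q" using ab unfolding set_free_positions by auto
  then obtain i j where ij: "i < length ?q" "?q ! i = a" "j < length ?q" "?q ! j = b"
    by (auto simp: in_set_conv_nth)
  have "sorted_wrt (<) ?q" unfolding free_positions_filter by (rule sorted_wrt_filter) simp
  then have "i < j"
    using ij ab by (metis linorder_neqE_nat order_less_asym sorted_wrt_nth_less)
  then show thesis using that[OF Is r] ij len J by auto
qed

lemma finite_index_pairs: "finite {Is. disjoint_index_pairs d Is \<and> length Is = r}"
proof (rule finite_subset)
  show "finite {Is. set Is \<subseteq> {..<d} \<times> {..<d} \<and> length Is = r}"
    by (rule finite_lists_length_eq) simp
  show "{Is. disjoint_index_pairs d Is \<and> length Is = r} \<subseteq>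
      {Is. set Is \<subseteq> {..<d} \<times> {..<d} \<and> length Is = r}"
    by (fastforce simp: disjoint_index_pairs_def)
qed

context inf_symplectic
begin

text \<open>Consists of representatives, the relations included. If 2r exceeds d there are no
  collections of pairs, and the layer is all of \<open>words d\<close>.\<close>

definition layer :: "nat \<Rightarrow> nat \<Rightarrow> ('v list \<Rightarrow>\<^sub>0 'k) set" where
  "layer d r = {p \<in> words d. \<forall>Is. disjoint_index_pairs d Is \<and> length Is = r \<longrightarrow>
     contr Is p \<in> null (d - 2 * r)}"

definition traceless :: "nat \<Rightarrow> ('v list \<Rightarrow>\<^sub>0 'k) set" where
  "traceless e = {p \<in> words e. \<forall>i j. i < j \<and> j < e \<longrightarrow> contr [(i, j)] p \<in> null (e - 2)}"

text \<open>An (r+1)-fold contraction is an r-fold one followed by the contraction of one pair. The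
  step from one layer to the next thus becomes a condition of tracelessness in degree d - 2r,
  uniformly in r.\<close>

lemma layer_Suc_iff:
  "p \<in> layer d (Suc r) \<longleftrightarrow> p \<in> words d \<and>
     (\<forall>Is. disjoint_index_pairs d Is \<and> length Is = r \<longrightarrow> contr Is p \<in> traceless (d - 2 * r))"
proof
  assume L: "p \<in> layer d (Suc r)"
  then have p: "p \<in> words d" by (simp add: layer_def)
  have "contr Is p \<in> traceless (d - 2 * r)" if Is: "disjoint_index_pairs d Is" "length Is = r" for Is
    unfolding traceless_def
  proof (intro CollectI conjI allI impI)
    show "contr Is p \<in> words (d - 2 * r)" using contract_in_words[OF Is(1) p] Is(2) by simp
    fix i j assume "i < j \<and> j < d - 2 * r"
    then have ij: "i < j" "j < d - 2 * length Is" using Is(2) by auto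
    have "contr (Is @ [(free_positions d Is ! i, free_positions d Is ! j)]) p \<in> null (d - 2 * Suc r)"
      using L disjoint_index_pairs_append[OF Is(1) ij] Is(2) by (simp add: layer_def)
    then show "contr [(i, j)] (contr Is p) \<in> null (d - 2 * r - 2)"
      unfolding contr_pair_contr[OF Is(1) p ij] by simp
  qed
  with p show "p \<in> words d \<and> (\<forall>Is. disjoint_index_pairs d Is \<and> length Is = r \<longrightarrow>
      contr Is p \<in> traceless (d - 2 * r))" by blast
next
  assume R: "p \<in> words d \<and> (\<forall>Is. disjoint_index_pairs d Is \<and> length Is = r \<longrightarrow>
      contr Is p \<in> traceless (d - 2 * r))"
  then have p: "p \<in> words d" by blast
  have "contr Js p \<in> null (d - 2 * Suc r)" if J: "disjoint_index_pairs d Js" "length Js = Suc r" for Js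
  proof -
    obtain Is i j where *: "disjoint_index_pairs d Is" "length Is = r" "i < j" "j < d - 2 * r"
      "Js = Is @ [(free_positions d Is ! i, free_positions d Is ! j)]"
      by (rule disjoint_index_pairs_snocE[OF J])
    then have "contr [(i, j)] (contr Is p) \<in> null (d - 2 * r - 2)"
      using R by (auto simp: traceless_def)
    then show ?thesis using contr_pair_contr[OF *(1) p *(3)] *(2,4,5) by simp
  qed
  with p show "p \<in> layer d (Suc r)" by (simp add: layer_def)
qed

lemma contr_traceless_null:
  assumes "p \<in> null e" shows "p \<in> traceless e"
  using assms null_subset_words contr_null[OF disjoint_index_pairs_single assms]
  by (auto simp: traceless_def)

lemma layer_mono: "layer d r \<subseteq> layer d (Suc r)"
  using contr_traceless_null by (auto simp: layer_Suc_iff) (auto simp: layer_def)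

lemma layer_0: "layer d 0 = null d"
  using null_subset_words by (auto simp: layer_def contr_Nil disjoint_index_pairs_Nil)

lemma subspace_contr_preimage:
  assumes "free.subspace U" shows "free.subspace {p. contr Is p \<in> U}"
  using assms by (auto intro!: free.subspaceI
    simp: contr_add contr_scale contr_zero free.subspace_0 free.subspace_add free.subspace_scale)

lemma subspace_layer: "free.subspace (layer d r)"
proof -
  have "layer d r = words d \<inter> (\<Inter>Is\<in>{Is. disjoint_index_pairs d Is \<and> length Is = r}.
      {p. contr Is p \<in> null (d - 2 * r)})"
    by (auto simp: layer_def)
  then show ?thesis
    by (auto intro!: free.subspace_inter free.subspace_Int subspace_words
        subspace_contr_preimage subspace_null)
qed

lemma layer_iff:
  "p \<in> layer d r \<longleftrightarrow> p \<in> words d \<and> (\<forall>Is z. disjoint_index_pairs d Is \<and> length Is = r \<and>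
     length z = d - 2 * r \<longrightarrow> ev z (contr Is p) = 0)"
  using contract_in_words[of d _ p \<Omega>] null_iff by (auto simp: layer_def)

lemma layer_word_act:
  assumes "X \<in> sp" "p \<in> layer d r"
  shows "word_act X p \<in> layer d r"
  using assms ev_word_act_contr[OF assms(1)] by (auto simp: layer_iff word_act_in_words)


section \<open>Transvections acting on tensors\<close>

lemma ev_word_update:
  assumes "length u = length z" "n < length z"
  shows "ev z (word (u[n := v])) = \<Omega> v (z ! n) * (\<Prod>i\<in>{..<length z} - {n}. \<Omega> (u ! i) (z ! i))"
proof -
  have "ev z (word (u[n := v])) = (\<Prod>i\<in>insert n ({..<length z} - {n}). \<Omega> (u[n := v] ! i) (z ! i))"
    using assms by (simp add: ev_word insert_absorb)
  also have "\<dots> = \<Omega> v (z ! n) * (\<Prod>i\<in>{..<length z} - {n}. \<Omega> (u[n := v] ! i) (z ! i))"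
    using assms by (subst prod.insert) auto
  also have "(\<Prod>i\<in>{..<length z} - {n}. \<Omega> (u[n := v] ! i) (z ! i)) =
      (\<Prod>i\<in>{..<length z} - {n}. \<Omega> (u ! i) (z ! i))"
    by (intro prod.cong) auto
  finally show ?thesis .
qed

lemma ev_word_zero_entry:
  assumes "length u = length z" "n < length z" "u ! n = 0"
  shows "ev z (word u) = 0"
  unfolding ev_word using assms by (intro prod_zero) (auto intro!: bexI[of _ n])

primrec iter_act :: "(nat \<Rightarrow> 'v \<Rightarrow> 'v) \<Rightarrow> nat \<Rightarrow> ('v list \<Rightarrow>\<^sub>0 'k) \<Rightarrow> ('v list \<Rightarrow>\<^sub>0 'k)" where
  "iter_act X 0 p = p"
| "iter_act X (Suc k) p = word_act (X k) (iter_act X k p)"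

lemma word_act_linear:
  "word_act X (p + q) = word_act X p + word_act X q"
  "word_act X (p - q) = word_act X p - word_act X q"
  "word_act X (fscale c p) = fscale c (word_act X p)"
  "word_act X (sum h A) = (\<Sum>a\<in>A. word_act X (h a))"
  "word_act X (lin_ext f r) = lin_ext (\<lambda>x. word_act X (f x)) r"
  by (simp_all add: word_act_def lin_ext_add lin_ext_diff lin_ext_scale lin_ext_sum lin_ext_lin_ext)

lemma word_act_word: "word_act X (word u) = (\<Sum>i<length u. word (u[i := X (u ! i)]))"
  by (simp add: word_act_def)

lemma iter_act_in_words: "p \<in> words d \<Longrightarrow> iter_act X k p \<in> words d"
  by (induction k) (simp_all add: word_act_in_words)

lemma iter_act_lin_ext: "iter_act X k (lin_ext f p) = lin_ext (\<lambda>x. iter_act X k (f x)) p"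
  by (induction k) (simp_all add: word_act_linear)

lemma iter_act_words: "iter_act X k p = lin_ext (\<lambda>vs. iter_act X k (word vs)) p"
  by (metis iter_act_lin_ext lin_ext_words)

lemma iter_act_cong: "(\<And>i. i < k \<Longrightarrow> X i = Y i) \<Longrightarrow> iter_act X k p = iter_act Y k p"
  by (induction k) simp_all

text \<open>Equality of the represented tensors, stated through values; by \<open>eqv_null\<close>
  it is congruence modulo the relations.\<close>

definition eqv :: "nat \<Rightarrow> ('v list \<Rightarrow>\<^sub>0 'k) \<Rightarrow> ('v list \<Rightarrow>\<^sub>0 'k) \<Rightarrow> bool" where
  "eqv e p q \<longleftrightarrow> p \<in> words e \<and> q \<in> words e \<and> (\<forall>z. length z = e \<longrightarrow> ev z p = ev z q)"

lemma eqv_word_act: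
  assumes "X \<in> sp" "eqv e p q" shows "eqv e (word_act X p) (word_act X q)"
  using assms by (auto simp: eqv_def word_act_in_words ev_word_act)

lemma eqv_null: "eqv e p q \<longleftrightarrow> p \<in> words e \<and> q \<in> words e \<and> p - q \<in> null e"
proof -
  have "p \<in> words e \<Longrightarrow> q \<in> words e \<Longrightarrow> p - q \<in> words e"
    by (rule free.subspace_diff[OF subspace_words])
  then show ?thesis using null_iff[of "p - q" e] by (auto simp: eqv_def ev_diff)
qed

lemma eqv_traceless:
  assumes "eqv e p q" "p \<in> traceless e" shows "q \<in> traceless e"
proof -
  have "p - q \<in> null e" and q: "q \<in> words e" using assms(1) by (auto simp: eqv_null)
  then have n: "contr [(i, j)] (p - q) \<in> null (e - 2)" if "i < j" "j < e" for i j
    using contr_null[OF disjoint_index_pairs_single[OF that]] by simp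
  have "contr [(i, j)] q \<in> null (e - 2)" if "i < j" "j < e" for i j
  proof -
    have "contr [(i, j)] p - contr [(i, j)] (p - q) \<in> null (e - 2)"
      using that assms(2) n[OF that] by (intro free.subspace_diff[OF subspace_null]) (auto simp: traceless_def)
    then show ?thesis by (simp add: contr_diff)
  qed
  then show ?thesis using q by (simp add: traceless_def)
qed

lemma eqv_contr_iter_act:
  assumes "disjoint_index_pairs d Is" "p \<in> words d" "\<And>i. i < k \<Longrightarrow> X i \<in> sp"
  shows "eqv (d - 2 * length Is) (contr Is (iter_act X k p)) (iter_act X k (contr Is p))"
  using assms(3)
proof (induction k)
  case 0
  then show ?case using contract_in_words[OF assms(1,2)] by (simp add: eqv_def)
next
  case (Suc k)
  let ?e = "d - 2 * length Is"
  have X: "X k \<in> sp" using Suc.prems by simp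
  have "eqv ?e (contr Is (iter_act X (Suc k) p)) (word_act (X k) (contr Is (iter_act X k p)))"
    using contract_in_words[OF assms(1) iter_act_in_words[OF assms(2)]]
      contract_in_words[OF assms(1) word_act_in_words[OF iter_act_in_words[OF assms(2)]]]
      ev_contr_word_act[OF X assms(1) iter_act_in_words[OF assms(2)]]
    by (simp add: eqv_def word_act_in_words)
  moreover have "eqv ?e (word_act (X k) (contr Is (iter_act X k p))) (iter_act X (Suc k) (contr Is p))"
    using eqv_word_act[OF X] Suc by simp
  ultimately show ?case by (auto simp: eqv_def)
qed

end


section \<open>Permutations as lists, frames, and the raising operators\<close>

abbreviation perm_lists :: "nat \<Rightarrow> nat list set" where
  "perm_lists e \<equiv> permutations_of_set {..<e}"

lemma perm_listsD:
  assumes "l \<in> perm_lists e"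
  shows "length l = e" "distinct l" "set l = {..<e}" "\<And>j. j < e \<Longrightarrow> l ! j < e"
proof -
  show "distinct l" "set l = {..<e}" using assms by (auto simp: permutations_of_set_def)
  then show len: "length l = e" using distinct_card[of l] by simp
  show "l ! j < e" if "j < e" for j
    using nth_mem[of j l] that unfolding len \<open>set l = {..<e}\<close> by simp
qed

lemma map_perm_lists:
  assumes "\<pi> permutes {..<e}"
  shows "map \<pi> l \<in> perm_lists e \<longleftrightarrow> l \<in> perm_lists e"
proof -
  have "inj \<pi>" using assms by (rule permutes_inj)
  then have "inj_on \<pi> (set l)" by (rule inj_on_subset) simp
  then have "distinct (map \<pi> l) \<longleftrightarrow> distinct l" by (simp add: distinct_map)
  moreover have "\<pi> ` set l = {..<e} \<longleftrightarrow> set l = {..<e}"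
    using permutes_image[OF assms] inj_image_eq_iff[OF \<open>inj \<pi>\<close>, of "set l" "{..<e}"] by simp
  ultimately show ?thesis by (simp add: permutations_of_set_def)
qed

lemma bij_map_perm_lists:
  assumes "\<pi> permutes {..<e}"
  shows "bij_betw (map \<pi>) (perm_lists e) (perm_lists e)"
proof -
  have inv: "inv_into UNIV \<pi> permutes {..<e}" using assms by (rule permutes_inv)
  show ?thesis
  proof (rule bij_betw_byWitness[where f' = "map (inv_into UNIV \<pi>)"])
    show "\<forall>l\<in>perm_lists e. map (inv_into UNIV \<pi>) (map \<pi> l) = l"
      "\<forall>l\<in>perm_lists e. map \<pi> (map (inv_into UNIV \<pi>) l) = l"
      by (simp_all add: permutes_inverses[OF assms] o_def)
    show "map \<pi> ` perm_lists e \<subseteq> perm_lists e"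
      "map (inv_into UNIV \<pi>) ` perm_lists e \<subseteq> perm_lists e"
      using map_perm_lists[OF assms] map_perm_lists[OF inv] by (simp_all only: image_subset_iff) blast+
  qed
qed

lemma bij_nth_perm_list:
  assumes "l \<in> perm_lists e"
  shows "bij_betw ((!) l) {..<e} {..<e}"
  by (rule bij_betw_nth) (simp_all add: perm_listsD(1-3)[OF assms])

lemma sum_perm_list:
  assumes "l \<in> perm_lists e"
  shows "(\<Sum>j<e. f (l ! j)) = (\<Sum>v<e. f v)"
  by (rule sum.reindex_bij_betw[OF bij_nth_perm_list[OF assms]])

lemma prod_perm_list:
  assumes "l \<in> perm_lists e"
  shows "(\<Prod>j<e. f (l ! j)) = (\<Prod>v<e. f v)"
  by (rule prod.reindex_bij_betw[OF bij_nth_perm_list[OF assms]])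

text \<open>\<open>F\<close> is to contain the letters of the tensors under study, and
  \<open>W\<close> the vectors \<open>w\<^sub>i\<close>. Orthogonality to both makes a transvection
  with a frame vector act on letters of \<open>F\<close> and on the \<open>x i\<close> by one term
  or by zero, as the next four lemmas record.\<close>

locale frame = inf_symplectic scale \<Omega>
  for scale :: "'k::field_char_0 \<Rightarrow> 'v::ab_group_add \<Rightarrow> 'v" and \<Omega> +
  fixes F W :: "'v set" and x y :: "nat \<Rightarrow> 'v" and e :: nat
  assumes xy: "i < e \<Longrightarrow> j < e \<Longrightarrow> \<Omega> (x i) (y j) = (if i = j then 1 else 0)"
    and xx: "i < e \<Longrightarrow> j < e \<Longrightarrow> \<Omega> (x i) (x j) = 0"
    and orth_x: "i < e \<Longrightarrow> f \<in> F \<union> W \<Longrightarrow> \<Omega> f (x i) = 0"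
    and orth_y: "i < e \<Longrightarrow> f \<in> F \<union> W \<Longrightarrow> \<Omega> f (y i) = 0"
begin

lemma transvection_x_F: "i < e \<Longrightarrow> v \<in> F \<Longrightarrow> transvection (x i) w v = scale (\<Omega> v w) (x i)"
  using orth_x by (simp add: transvection_def)

lemma transvection_x_x: "i < e \<Longrightarrow> j < e \<Longrightarrow> w \<in> W \<Longrightarrow> transvection (x i) w (scale c (x j)) = 0"
  using orth_x xx omega_swap_zero[of "x j" w] by (simp add: transvection_def)

lemma transvection_y_F: "i < e \<Longrightarrow> v \<in> F \<Longrightarrow> transvection (y i) b v = scale (\<Omega> v b) (y i)"
  using orth_y by (simp add: transvection_def)

lemma transvection_y_x:
  "i < e \<Longrightarrow> j < e \<Longrightarrow> b \<in> F \<Longrightarrow>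
    transvection (y i) b (scale c (x j)) = (if i = j then scale c b else 0)"
  using orth_x xy omega_swap_zero[of "x j" b] by (simp add: transvection_def)

text \<open>A word to which the operators with index below \<open>k\<close> have been applied. The
  list \<open>l\<close> says that operator \<open>l ! j\<close> acts at position \<open>j\<close>;
  its entries from \<open>k\<close> on have had no effect yet.\<close>

definition partial_subst :: "(nat \<Rightarrow> 'v) \<Rightarrow> nat \<Rightarrow> nat list \<Rightarrow> 'v list \<Rightarrow> 'v list" where
  "partial_subst \<omega> k l vs =
     map (\<lambda>j. if l ! j < k then scale (\<Omega> (vs ! j) (\<omega> (l ! j))) (x (l ! j)) else vs ! j) [0..<e]"

lemma length_partial_subst [simp]: "length (partial_subst \<omega> k l vs) = e"
  by (simp add: partial_subst_def)

lemma nth_partial_subst: "j < e \<Longrightarrow> partial_subst \<omega> k l vs ! j =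
    (if l ! j < k then scale (\<Omega> (vs ! j) (\<omega> (l ! j))) (x (l ! j)) else vs ! j)"
  by (simp add: partial_subst_def)

abbreviation raise :: "(nat \<Rightarrow> 'v) \<Rightarrow> nat \<Rightarrow> ('v list \<Rightarrow>\<^sub>0 'k) \<Rightarrow> ('v list \<Rightarrow>\<^sub>0 'k)" where
  "raise \<omega> \<equiv> iter_act (\<lambda>i. transvection (x i) (\<omega> i))"

text \<open>The next operator kills multiples of the \<open>x i\<close> and turns one letter of
  \<open>F\<close> into a multiple of \<open>x k\<close>. Exchanging the values \<open>k\<close> and
  \<open>l ! j\<close> in \<open>l\<close> makes \<open>j\<close> the place of \<open>k\<close>; the
  sum runs over the exchanged value \<open>v\<close> instead of the position.\<close>

lemma word_act_partial_subst:
  assumes l: "l \<in> perm_lists e" and vs: "length vs = e" "set vs \<subseteq> F" and k: "k < e"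
    and \<omega>: "\<omega> k \<in> W" and z: "length z = e"
  shows "ev z (word_act (transvection (x k) (\<omega> k)) (word (partial_subst \<omega> k l vs))) =
    (\<Sum>v<e. if v < k then 0 else ev z (word (partial_subst \<omega> (Suc k) (map (Transposition.transpose k v) l) vs)))"
proof -
  note L = perm_listsD[OF l]
  let ?u = "partial_subst \<omega> k l vs"
  have "ev z (word (?u[j := transvection (x k) (\<omega> k) (?u ! j)])) =
     (if l ! j < k then 0 else
       ev z (word (partial_subst \<omega> (Suc k) (map (Transposition.transpose k (l ! j)) l) vs)))" if j: "j < e" for j
  proof (cases "l ! j < k")
    case True
    then have "transvection (x k) (\<omega> k) (?u ! j) = 0"
      using k j \<omega> L(4)[OF j] by (simp add: nth_partial_subst transvection_x_x)
    then show ?thesis using True j z by (simp add: ev_word_zero_entry[of _ z j])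
  next
    case False
    have "?u[j := transvection (x k) (\<omega> k) (?u ! j)] =
        partial_subst \<omega> (Suc k) (map (Transposition.transpose k (l ! j)) l) vs"
    proof (rule nth_equalityI)
      fix i assume "i < length (?u[j := transvection (x k) (\<omega> k) (?u ! j)])"
      then have i: "i < e" by simp
      show "?u[j := transvection (x k) (\<omega> k) (?u ! j)] ! i =
          partial_subst \<omega> (Suc k) (map (Transposition.transpose k (l ! j)) l) vs ! i"
      proof (cases "i = j")
        case True
        have "vs ! j \<in> F" using vs j by auto
        then show ?thesis
          using True False i j k L(1) by (simp add: nth_partial_subst transvection_x_F)
      next
        case neq: False
        then have "l ! i \<noteq> l ! j" using L(1,2) i j by (simp add: nth_eq_iff_index_eq)
        then show ?thesis
          using neq False i L(1) by (auto simp: nth_partial_subst Transposition.transpose_def)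
      qed
    qed simp
    then show ?thesis using False by simp
  qed
  then have "ev z (word_act (transvection (x k) (\<omega> k)) (word ?u)) = (\<Sum>j<e. if l ! j < k then 0 else
        ev z (word (partial_subst \<omega> (Suc k) (map (Transposition.transpose k (l ! j)) l) vs)))"
    by (simp add: word_act_word ev_sum)
  also have "\<dots> = (\<Sum>v<e. if v < k then 0 else
        ev z (word (partial_subst \<omega> (Suc k) (map (Transposition.transpose k v) l) vs)))"
    by (rule sum_perm_list[OF l])
  finally show ?thesis .
qed

text \<open>Every list in \<open>perm_lists e\<close> records where the first \<open>k\<close> vectors \<open>x i\<close> are placed; each
  placement is counted \<open>(e - k)!\<close> times.\<close>

lemma raise_word:
  assumes vs: "length vs = e" "set vs \<subseteq> F"
  shows "k \<le> e \<Longrightarrow> (\<And>i. i < k \<Longrightarrow> \<omega> i \<in> W) \<Longrightarrow> length z = e \<Longrightarrow> fact (e - k) * ev z (raise \<omega> k (word vs)) =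
    (\<Sum>l\<in>perm_lists e. ev z (word (partial_subst \<omega> k l vs)))"
proof (induction k arbitrary: z)
  case 0
  have "partial_subst \<omega> 0 l vs = vs" for l
    using vs by (intro nth_equalityI) (auto simp: nth_partial_subst)
  then show ?case by simp
next
  case (Suc k)
  let ?X = "transvection (x k) (\<omega> k)"
  let ?S = "\<Sum>l\<in>perm_lists e. ev z (word (partial_subst \<omega> (Suc k) l vs))"
  have k: "k < e" and \<omega>: "\<omega> k \<in> W" using Suc.prems by simp_all
  have "fact (e - k) * ev z (raise \<omega> (Suc k) (word vs)) =
      - (\<Sum>n<e. fact (e - k) * ev (z[n := ?X (z ! n)]) (raise \<omega> k (word vs)))"
    using ev_word_act[OF transvection_in_sp iter_act_in_words[OF word_in_words[OF vs(1)]]] Suc.prems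
    by (simp add: sum_distrib_left)
  also have "\<dots> = - (\<Sum>n<e. \<Sum>l\<in>perm_lists e. ev (z[n := ?X (z ! n)]) (word (partial_subst \<omega> k l vs)))"
    using Suc.IH k Suc.prems by simp
  also have "\<dots> = (\<Sum>l\<in>perm_lists e. - (\<Sum>n<e. ev (z[n := ?X (z ! n)]) (word (partial_subst \<omega> k l vs))))"
    unfolding sum_negf by (subst sum.swap) simp
  also have "\<dots> = (\<Sum>l\<in>perm_lists e. ev z (word_act ?X (word (partial_subst \<omega> k l vs))))"
    using Suc.prems by (intro sum.cong refl)
      (simp add: ev_word_act[OF transvection_in_sp word_in_words[OF length_partial_subst]])
  also have "\<dots> = (\<Sum>l\<in>perm_lists e. \<Sum>v<e. if v < k then 0 else
      ev z (word (partial_subst \<omega> (Suc k) (map (Transposition.transpose k v) l) vs)))"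
    using word_act_partial_subst[where \<omega> = \<omega> and k = k, OF _ vs k \<omega>] Suc.prems by (intro sum.cong) auto
  also have "\<dots> = (\<Sum>v<e. \<Sum>l\<in>perm_lists e. if v < k then 0 else
      ev z (word (partial_subst \<omega> (Suc k) (map (Transposition.transpose k v) l) vs)))"
    by (rule sum.swap)
  \<comment> \<open>Exchanging two values permutes the lists, so each of the e - k values
    \<open>v\<close> from \<open>k\<close> on contributes the same sum. This is the factor by which
    the two factorials differ.\<close>
  also have "\<dots> = (\<Sum>v<e. if v < k then 0 else ?S)"
  proof (rule sum.cong[OF refl])
    fix v assume "v \<in> {..<e}"
    then have "Transposition.transpose k v permutes {..<e}" using k by (intro permutes_swap_id) auto
    then show "(\<Sum>l\<in>perm_lists e. if v < k then 0 else
        ev z (word (partial_subst \<omega> (Suc k) (map (Transposition.transpose k v) l) vs))) = (if v < k then 0 else ?S)"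
      using sum.reindex_bij_betw[OF bij_map_perm_lists, of _ e
          "\<lambda>l. ev z (word (partial_subst \<omega> (Suc k) l vs))"] by simp
  qed
  also have "\<dots> = (\<Sum>v\<in>{k..<e}. ?S)"
    by (rule sum.mono_neutral_cong_right) auto
  also have "\<dots> = of_nat (e - k) * ?S" by simp
  finally have "fact (e - k) * ev z (raise \<omega> (Suc k) (word vs)) = of_nat (e - k) * ?S" .
  moreover have "(fact (e - k) :: 'k) = of_nat (e - k) * fact (e - Suc k)"
    using k by (metis Suc_diff_Suc fact_Suc)
  ultimately show ?case using k by simp
qed

text \<open>At the last stage the factorial is 1 and every letter has been replaced; the scalars
  split off at the positions multiply to the value of the word at the permuted
  \<open>\<omega>\<close>.\<close>

lemma raise_full_word:
  assumes "length vs = e" "set vs \<subseteq> F" "\<And>i. i < e \<Longrightarrow> \<omega> i \<in> W" "length z = e"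
  shows "ev z (raise \<omega> e (word vs)) =
    (\<Sum>l\<in>perm_lists e. ev (map \<omega> l) (word vs) * ev z (word (map x l)))"
proof -
  have "ev z (word (partial_subst \<omega> e l vs)) = ev (map \<omega> l) (word vs) * ev z (word (map x l))"
    if "l \<in> perm_lists e" for l
    using perm_listsD[OF that] assms(4)
    by (simp add: ev_word nth_partial_subst prod.distrib[symmetric])
  then show ?thesis using raise_word[of vs e \<omega> z] assms by simp
qed

lemma raise_full:
  assumes "p \<in> words e" "\<And>vs. vs \<in> Poly_Mapping.keys p \<Longrightarrow> set vs \<subseteq> F"
    "\<And>i. i < e \<Longrightarrow> \<omega> i \<in> W" "length z = e"
  shows "ev z (raise \<omega> e p) = (\<Sum>l\<in>perm_lists e. ev (map \<omega> l) p * ev z (word (map x l)))"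
proof -
  have "ev z (raise \<omega> e p) = lin_fun (\<lambda>vs. ev z (raise \<omega> e (word vs))) p"
    by (subst iter_act_words) (rule ev_lin_ext)
  also have "\<dots> = lin_fun (\<lambda>vs. \<Sum>l\<in>perm_lists e. ev z (word (map x l)) * ev (map \<omega> l) (word vs)) p"
    by (rule lin_fun_cong) (use assms raise_full_word in \<open>simp add: words_def mult.commute\<close>)
  also have "\<dots> = (\<Sum>l\<in>perm_lists e. ev z (word (map x l)) * lin_fun (\<lambda>vs. ev (map \<omega> l) (word vs)) p)"
    by (simp only: lin_fun_fun_sum lin_fun_fun_scale)
  also have "\<dots> = (\<Sum>l\<in>perm_lists e. ev z (word (map x l)) * ev (map \<omega> l) p)"
    by (simp only: ev_lin_ext[symmetric] lin_ext_words[symmetric])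
  finally show ?thesis by (simp add: mult.commute)
qed

lemma traceless_word_x:
  assumes "set l \<subseteq> {..<e}" "length l = n"
  shows "word (map x l) \<in> traceless n"
proof -
  have "contr [(i, j)] (word (map x l)) = 0" if "i < j" "j < n" for i j
  proof -
    have "l ! i \<in> set l" "l ! j \<in> set l" using assms(2) that by auto
    then have "l ! i < e" "l ! j < e" using assms(1) by auto
    then have "\<Omega> (map x l ! i) (map x l ! j) = 0" using assms that by (simp add: xx)
    then show ?thesis by (simp add: contract_def contract_word_def)
  qed
  then show ?thesis
    using assms by (auto simp: traceless_def word_in_words free.subspace_0[OF subspace_null])
qed

text \<open>The \<open>y i\<close> separate the permuted words in the \<open>x i\<close>, so the
  coefficients of a combination of such words can be recovered.\<close>

lemma ev_y_word_x:
  assumes "l \<in> perm_lists e" "m \<in> perm_lists e"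
  shows "ev (map y m) (word (map x l)) = (if l = m then 1 else 0)"
proof -
  have "ev (map y m) (word (map x l)) = (\<Prod>i<e. if l ! i = m ! i then 1 else 0)"
    using perm_listsD[OF assms(1)] perm_listsD[OF assms(2)]
    by (auto simp: ev_word xy intro!: prod.cong)
  also have "\<dots> = (if l = m then 1 else 0)"
    using perm_listsD(1)[OF assms(1)] perm_listsD(1)[OF assms(2)] by (auto simp: list_eq_iff_nth_eq)
  finally show ?thesis .
qed

end


section \<open>Values after replacing one or two letters, and the vanishing of traces\<close>

context inf_symplectic
begin

lemma ev_word_update_scale:
  assumes "length u = length z" "n < length z"
  shows "ev z (word (u[n := scale c v])) = c * ev z (word (u[n := v]))"
  using ev_word_update[OF assms] by simp

lemma ev_word_update_sum:
  assumes "length u = length z" "n < length z"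
  shows "ev z (word (u[n := sum f A])) = (\<Sum>a\<in>A. ev z (word (u[n := f a])))"
  using ev_word_update[OF assms] by (simp add: omega_sum sum_distrib_right)

lemma ev_word_update_scale2:
  assumes "length u = length z" "n < length z" "m < length z" "m \<noteq> n"
  shows "ev z (word (u[m := scale c v, n := scale c' w])) = c * c' * ev z (word (u[m := v, n := w]))"
proof -
  have "ev z (word (u[m := scale c v, n := scale c' w])) = c' * ev z (word (u[m := scale c v, n := w]))"
    using assms by (intro ev_word_update_scale) auto
  also have "u[m := scale c v, n := w] = u[n := w, m := scale c v]"
    using assms(4) by (rule list_update_swap)
  also have "ev z (word \<dots>) = c * ev z (word (u[n := w, m := v]))"
    using assms by (intro ev_word_update_scale) auto
  also have "u[n := w, m := v] = u[m := v, n := w]"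
    using assms(4) by (intro list_update_swap) simp
  finally show ?thesis by simp
qed

lemma ev_word_update2:
  assumes "length u = length z" "n < length z" "m < length z" "m \<noteq> n"
  shows "ev z (word (u[m := v, n := w])) =
    \<Omega> v (z ! m) * \<Omega> w (z ! n) * (\<Prod>i\<in>{..<length z} - {m, n}. \<Omega> (u ! i) (z ! i))"
proof -
  have "ev z (word (u[m := v, n := w])) =
      \<Omega> w (z ! n) * (\<Prod>i\<in>{..<length z} - {n}. \<Omega> (u[m := v] ! i) (z ! i))"
    using assms by (intro ev_word_update) auto
  also have "{..<length z} - {n} = insert m ({..<length z} - {m, n})" using assms by auto
  also have "(\<Prod>i\<in>\<dots>. \<Omega> (u[m := v] ! i) (z ! i)) =
      \<Omega> v (z ! m) * (\<Prod>i\<in>{..<length z} - {m, n}. \<Omega> (u[m := v] ! i) (z ! i))"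
    using assms by (subst prod.insert) auto
  also have "(\<Prod>i\<in>{..<length z} - {m, n}. \<Omega> (u[m := v] ! i) (z ! i)) =
      (\<Prod>i\<in>{..<length z} - {m, n}. \<Omega> (u ! i) (z ! i))"
    by (intro prod.cong) auto
  finally show ?thesis by (simp add: mult_ac)
qed

lemma ev_contract_pair:
  assumes "length u = length z" "m < n" "n < length z"
  shows "ev (map ((!) z) (free_positions (length z) [(m, n)])) (contract_word \<Omega> [(m, n)] u) =
    \<Omega> (u ! m) (u ! n) * (\<Prod>i\<in>{..<length z} - {m, n}. \<Omega> (u ! i) (z ! i))"
proof -
  let ?q = "free_positions (length z) [(m, n)]"
  have q: "set ?q = {..<length z} - {m, n}" by (auto simp: set_free_positions inds_def)
  have "(\<Prod>i<length ?q. \<Omega> (u ! (?q ! i)) (z ! (?q ! i))) = (\<Prod>j\<in>set ?q. \<Omega> (u ! j) (z ! j))"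
    by (rule prod.reindex_bij_betw) (rule bij_betw_nth[OF distinct_free_positions refl refl])
  then show ?thesis
    using assms(1) by (simp add: contract_word_eq[of u "length z"] ev_scale ev_word q)
qed

text \<open>Fixing what is inserted at \<open>m\<close> and \<open>n\<close> leaves a constant times
  a value of the contraction of these two positions, which is zero for a traceless tensor. The
  correction terms of the Casimir computation have this form.\<close>

lemma trace_term_less:
  assumes p: "p \<in> traceless e" and z: "length z = e" and mn: "m < n" "n < e"
  shows "lin_fun (\<lambda>u. \<Omega> (u ! m) (u ! n) * ev z (word (u[m := a, n := b]))) p = 0"
proof -
  let ?q = "free_positions e [(m, n)]"
  let ?z = "map ((!) z) ?q"
  have "contr [(m, n)] p \<in> null (e - 2)" using p mn by (simp add: traceless_def)
  moreover have "length ?z = e - 2"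
    using length_free_positions[OF disjoint_index_pairs_single[OF mn]] by simp
  ultimately have 0: "ev ?z (contr [(m, n)] p) = 0"
    using null_subset_words by (metis null_iff subsetD)
  have "lin_fun (\<lambda>u. \<Omega> (u ! m) (u ! n) * ev z (word (u[m := a, n := b]))) p =
      lin_fun (\<lambda>u. (\<Omega> a (z ! m) * \<Omega> b (z ! n)) * ev ?z (contract_word \<Omega> [(m, n)] u)) p"
  proof (rule lin_fun_cong)
    fix u assume "u \<in> Poly_Mapping.keys p"
    then have u: "length u = e" using p by (auto simp: traceless_def words_def)
    show "\<Omega> (u ! m) (u ! n) * ev z (word (u[m := a, n := b])) =
        \<Omega> a (z ! m) * \<Omega> b (z ! n) * ev ?z (contract_word \<Omega> [(m, n)] u)"
      using ev_contract_pair[of u z m n] ev_word_update2[of u z n m a b] u z mn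
      by (simp add: mult_ac)
  qed
  also have "\<dots> = \<Omega> a (z ! m) * \<Omega> b (z ! n) * ev ?z (contr [(m, n)] p)"
    unfolding lin_fun_fun_scale contract_def ev_lin_ext ..
  finally show ?thesis using 0 by simp
qed

lemma trace_term:
  assumes p: "p \<in> traceless e" and z: "length z = e" and mn: "m < e" "n < e" "m \<noteq> n"
  shows "lin_fun (\<lambda>u. \<Omega> (u ! n) (u ! m) * ev z (word (u[m := a, n := b]))) p = 0"
proof (cases "m < n")
  case True
  have "lin_fun (\<lambda>u. \<Omega> (u ! n) (u ! m) * ev z (word (u[m := a, n := b]))) p =
      - lin_fun (\<lambda>u. \<Omega> (u ! m) (u ! n) * ev z (word (u[m := a, n := b]))) p"
    unfolding lin_fun_fun_neg[symmetric] by (subst antisymmetric) simp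
  then show ?thesis using trace_term_less[OF p z True mn(2)] by simp
next
  case False
  then have "n < m" using mn by simp
  moreover have "u[m := a, n := b] = u[n := b, m := a]" for u using mn(3) by (rule list_update_swap)
  ultimately show ?thesis using trace_term_less[OF p z _ mn(1), of n b a] by simp
qed

end

section \<open>The partial Casimir operator that undoes one raising step\<close>

context frame
begin

context
  fixes B :: "'v set" and wd :: "'v \<Rightarrow> 'v"
  assumes fin: "finite B" and BF: "B \<subseteq> F" and wdW: "wd ` B \<subseteq> W"
    and dual: "\<And>v. v \<in> F \<Longrightarrow> (\<Sum>b\<in>B. scale (\<Omega> v (wd b)) b) = v"
begin

text \<open>A partial Casimir operator: replacing a letter by \<open>x k\<close> and then restoring it counts the
  letters from \<open>F\<close>, up to terms that insert \<open>x k\<close> and \<open>y k\<close> into a contraction.\<close>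

lemma casimir_word:
  assumes u: "length u = e" and z: "length z = e" and k: "k < e"
    and A: "A \<subseteq> {..<e}" "\<And>m. m \<in> A \<Longrightarrow> u ! m \<in> F"
      "\<And>m. m < e \<Longrightarrow> m \<notin> A \<Longrightarrow> \<exists>c i. i < k \<and> u ! m = scale c (x i)"
  shows "(\<Sum>b\<in>B. ev z (word_act (transvection (y k) b) (word_act (transvection (x k) (wd b)) (word u)))) =
    of_nat (card A) * ev z (word u) +
    (\<Sum>m<e. \<Sum>n\<in>{..<e} - {m}. \<Omega> (u ! n) (u ! m) * ev z (word (u[m := x k, n := y k])))"
proof -
  define P Q where "P b = transvection (x k) (wd b)" and "Q b = transvection (y k) b" for b
  \<comment> \<open>In \<open>T b m n\<close> the first operator acts at position \<open>m\<close>
    and the second at \<open>n\<close>; off the diagonal the sum over \<open>b\<close> will be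
    \<open>R m n\<close>.\<close>
  define T where "T b m n = ev z (word (u[m := P b (u ! m), n := Q b (u[m := P b (u ! m)] ! n)]))" for b m n
  define R where "R m n = \<Omega> (u ! n) (u ! m) * ev z (word (u[m := x k, n := y k]))" for m n
  have PA: "P b (u ! m) = scale (\<Omega> (u ! m) (wd b)) (x k)" if "m \<in> A" for b m
    using A(2)[OF that] k by (simp add: P_def transvection_x_F)
  have PnA: "P b (u ! m) = 0" if "m < e" "m \<notin> A" "b \<in> B" for b m
    using A(3)[OF that(1,2)] k that(3) wdW by (auto simp: P_def transvection_x_x)
  have Qu: "Q b (u ! n) = scale (\<Omega> (u ! n) b) (y k)" if "n < e" "b \<in> B" for b n
  proof (cases "n \<in> A")
    case True
    then show ?thesis using A(2) k by (simp add: Q_def transvection_y_F)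
  next
    case False
    then obtain c i where ci: "i < k" "u ! n = scale c (x i)" using A(3)[OF \<open>n < e\<close>] by blast
    have "b \<in> F" using that BF by blast
    moreover have "\<Omega> (x i) b = 0" using orth_x[of i b] \<open>b \<in> F\<close> ci k omega_swap_zero[of "x i" b] by auto
    ultimately show ?thesis using ci k by (simp add: Q_def transvection_y_x)
  qed
  have Qx: "Q b (scale c (x k)) = scale c b" if "b \<in> B" for b c
    using that BF k by (auto simp: Q_def transvection_y_x)
  have Q0: "Q b 0 = 0" for b by (simp add: Q_def transvection_def)
  \<comment> \<open>On the diagonal the letter becomes a multiple of \<open>x k\<close> and then of
    \<open>b\<close>; the dual expansion restores it in the sum over \<open>b\<close>. Positions
    outside \<open>A\<close> are killed by the first operator.\<close>
  have diag: "(\<Sum>b\<in>B. T b m m) = (if m \<in> A then ev z (word u) else 0)" if m: "m < e" for m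
  proof (cases "m \<in> A")
    case True
    have "(\<Sum>b\<in>B. T b m m) = (\<Sum>b\<in>B. ev z (word (u[m := scale (\<Omega> (u ! m) (wd b)) b])))"
      using m u True by (intro sum.cong) (auto simp: T_def PA Qx)
    also have "\<dots> = ev z (word (u[m := \<Sum>b\<in>B. scale (\<Omega> (u ! m) (wd b)) b]))"
      using m u z by (simp add: ev_word_update_sum)
    finally show ?thesis using dual[OF A(2)[OF True]] True by simp
  next
    case False
    have "T b m m = 0" if "b \<in> B" for b
      using m u z False that by (simp add: T_def PnA Q0 ev_word_zero_entry[of _ z m])
    then show ?thesis using False by simp
  qed
  \<comment> \<open>Off the diagonal the dual expansion pairs the two letters with each other. If
    position \<open>m\<close> already carries a multiple of some \<open>x i\<close>, both sides
    vanish.\<close>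
  have off: "(\<Sum>b\<in>B. T b m n) = R m n" if mn: "m < e" "n < e" "n \<noteq> m" for m n
  proof (cases "m \<in> A")
    case True
    have "T b m n = \<Omega> (u ! m) (wd b) * \<Omega> (u ! n) b * ev z (word (u[m := x k, n := y k]))" if "b \<in> B" for b
      using mn u z that True by (simp add: T_def PA Qu ev_word_update_scale2)
    then have "(\<Sum>b\<in>B. T b m n) =
        (\<Sum>b\<in>B. \<Omega> (u ! m) (wd b) * \<Omega> (u ! n) b) * ev z (word (u[m := x k, n := y k]))"
      by (simp add: sum_distrib_right)
    also have "(\<Sum>b\<in>B. \<Omega> (u ! m) (wd b) * \<Omega> (u ! n) b) = \<Omega> (u ! n) (\<Sum>b\<in>B. scale (\<Omega> (u ! m) (wd b)) b)"
      by (simp add: omega_sum)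
    finally show ?thesis using dual[OF A(2)[OF True]] by (simp add: R_def)
  next
    case False
    have "T b m n = 0" if "b \<in> B" for b
      using mn u z False that by (simp add: T_def PnA ev_word_zero_entry[of _ z m])
    moreover have "\<Omega> (u ! n) (u ! m) = 0"
    proof -
      obtain c i where ci: "i < k" "u ! m = scale c (x i)" using A(3)[OF mn(1) False] by blast
      have "\<Omega> (u ! n) (x i) = 0"
      proof (cases "n \<in> A")
        case True
        then show ?thesis using orth_x A(2) ci k by auto
      next
        case False
        then obtain c' j where "j < k" "u ! n = scale c' (x j)" using A(3)[OF mn(2)] by blast
        then show ?thesis using ci k by (simp add: xx)
      qed
      then show ?thesis using ci by simp
    qed
    ultimately show ?thesis by (simp add: R_def)
  qed
  have "(\<Sum>b\<in>B. ev z (word_act (Q b) (word_act (P b) (word u)))) = (\<Sum>b\<in>B. \<Sum>m<e. \<Sum>n<e. T b m n)"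
    using u by (simp add: word_act_word word_act_linear(4) ev_sum T_def)
  also have "\<dots> = (\<Sum>m<e. \<Sum>n<e. \<Sum>b\<in>B. T b m n)"
    by (subst sum.swap) (intro sum.cong refl, rule sum.swap)
  also have "\<dots> = (\<Sum>m<e. (if m \<in> A then ev z (word u) else 0) + (\<Sum>n\<in>{..<e} - {m}. R m n))"
  proof (rule sum.cong[OF refl])
    fix m assume "m \<in> {..<e}"
    then have m: "m < e" by simp
    have "(\<Sum>n<e. \<Sum>b\<in>B. T b m n) = (\<Sum>b\<in>B. T b m m) + (\<Sum>n\<in>{..<e} - {m}. \<Sum>b\<in>B. T b m n)"
      using m by (simp add: sum.remove)
    also have "(\<Sum>n\<in>{..<e} - {m}. \<Sum>b\<in>B. T b m n) = (\<Sum>n\<in>{..<e} - {m}. R m n)"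
      using m off by (intro sum.cong) auto
    finally show "(\<Sum>n<e. \<Sum>b\<in>B. T b m n) =
        (if m \<in> A then ev z (word u) else 0) + (\<Sum>n\<in>{..<e} - {m}. R m n)"
      using diag[OF m] by simp
  qed
  also have "\<dots> = (\<Sum>m<e. if m \<in> A then ev z (word u) else 0) + (\<Sum>m<e. \<Sum>n\<in>{..<e} - {m}. R m n)"
    by (rule sum.distrib)
  also have "(\<Sum>m<e. if m \<in> A then ev z (word u) else 0) = of_nat (card A) * ev z (word u)"
    using A(1) by (simp add: sum.If_cases Int_absorb1)
  finally show ?thesis by (simp add: P_def Q_def R_def)
qed

text \<open>After k raising steps e - k letters still come from \<open>F\<close>, which explains the
  eigenvalue; the correction terms are traces and vanish by \<open>tr\<close>. For k < e the
  eigenvalue is nonzero, so the step can be undone.\<close>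

lemma casimir_raise:
  assumes p: "p \<in> words e" "\<And>vs. vs \<in> Poly_Mapping.keys p \<Longrightarrow> set vs \<subseteq> F"
    and \<omega>: "\<And>i. i < k \<Longrightarrow> \<omega> i \<in> W" and k: "k < e" and z: "length z = e"
    and tr: "raise \<omega> k p \<in> traceless e"
  shows "(\<Sum>b\<in>B. ev z (word_act (transvection (y k) b) (word_act (transvection (x k) (wd b)) (raise \<omega> k p)))) =
    of_nat (e - k) * ev z (raise \<omega> k p)"
proof -
  define s where "s = raise \<omega> k p"
  \<comment> \<open>The words of \<open>s\<close> need not have the shape required by
    \<open>casimir_word\<close>. Those of \<open>s'\<close> do, and by \<open>raise_word\<close> it
    represents (e - k)! times the same tensor.\<close>
  define s' where "s' = lin_ext (\<lambda>vs. \<Sum>l\<in>perm_lists e. word (partial_subst \<omega> k l vs)) p"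
  define C where "C b q = ev z (word_act (transvection (y k) b) (word_act (transvection (x k) (wd b)) q))" for b q
  define f :: 'k where "f = fact (e - k)"
  define R where "R m n u = \<Omega> (u ! n) (u ! m) * ev z (word (u[m := x k, n := y k]))" for m n u
  define good where "good u \<longleftrightarrow> length u = e \<and> (\<exists>A\<subseteq>{..<e}. card A = e - k \<and> (\<forall>m\<in>A. u ! m \<in> F) \<and>
      (\<forall>m<e. m \<notin> A \<longrightarrow> (\<exists>c i. i < k \<and> u ! m = scale c (x i))))" for u
  have sw: "s \<in> words e" unfolding s_def by (rule iter_act_in_words[OF p(1)])
  have s'_good: "s' \<in> {q. \<forall>u\<in>Poly_Mapping.keys q. good u}"
    unfolding s'_def
  proof (intro subspace_lin_ext free.subspace_sum subspace_supported)
    fix vs l assume vs: "vs \<in> Poly_Mapping.keys p" and l: "l \<in> perm_lists e"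
    have len: "length vs = e" and sub: "set vs \<subseteq> F" using p vs by (auto simp: words_def)
    \<comment> \<open>\<open>A\<close> collects the positions not yet raised.\<close>
    define A where "A = {m. m < e \<and> k \<le> l ! m}"
    have "card A = (\<Sum>m<e. if k \<le> l ! m then 1 else 0)"
      by (simp add: A_def sum.If_cases Int_def)
    also have "\<dots> = (\<Sum>v<e. if k \<le> v then 1 else 0)" by (rule sum_perm_list[OF l])
    also have "\<dots> = card {k..<e}"
      by (simp add: sum.If_cases) (metis Int_commute card_atLeastLessThan atLeastLessThan_def atLeast_def)
    finally have "card A = e - k" by simp
    moreover have "partial_subst \<omega> k l vs ! m \<in> F" if "m \<in> A" for m
      using that sub len by (auto simp: A_def nth_partial_subst)
    moreover have "\<exists>c i. i < k \<and> partial_subst \<omega> k l vs ! m = scale c (x i)" if "m < e" "m \<notin> A" for m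
      using that by (intro exI[of _ "\<Omega> (vs ! m) (\<omega> (l ! m))"] exI[of _ "l ! m"])
        (simp add: A_def nth_partial_subst)
    ultimately have "good (partial_subst \<omega> k l vs)"
      unfolding good_def by (intro conjI exI[of _ A]) (auto simp: A_def)
    then show "word (partial_subst \<omega> k l vs) \<in> {q. \<forall>u\<in>Poly_Mapping.keys q. good u}" by simp
  qed
  then have s'w: "s' \<in> words e" by (auto simp: words_def good_def)
  have "ev z' s' = ev z' (fscale f s)" if "length z' = e" for z'
  proof -
    have "ev z' s' = lin_fun (\<lambda>vs. f * ev z' (raise \<omega> k (word vs))) p"
      unfolding s'_def ev_lin_ext
    proof (rule lin_fun_cong)
      fix vs assume "vs \<in> Poly_Mapping.keys p"
      then have "length vs = e" "set vs \<subseteq> F" using p by (auto simp: words_def)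
      then show "ev z' (\<Sum>l\<in>perm_lists e. word (partial_subst \<omega> k l vs)) = f * ev z' (raise \<omega> k (word vs))"
        using raise_word[of vs k \<omega> z'] that k \<omega> by (simp add: ev_sum f_def)
    qed
    also have "\<dots> = f * lin_fun (\<lambda>vs. ev z' (raise \<omega> k (word vs))) p" by (rule lin_fun_fun_scale)
    also have "lin_fun (\<lambda>vs. ev z' (raise \<omega> k (word vs))) p = ev z' s"
      unfolding s_def by (subst (2) iter_act_words) (rule ev_lin_ext[symmetric])
    finally show ?thesis by (simp add: ev_scale)
  qed
  then have eq: "eqv e (fscale f s) s'"
    using sw s'w free.subspace_scale[OF subspace_words sw] by (simp add: eqv_def)
  have "fscale f s \<in> traceless e"
    using tr free.subspace_scale[OF subspace_words] free.subspace_scale[OF subspace_null]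
    by (auto simp: s_def traceless_def contr_scale)
  then have s'tr: "s' \<in> traceless e" by (rule eqv_traceless[OF eq])
  have C1: "C b s' = f * C b s" for b
    using eqv_word_act[OF transvection_in_sp eqv_word_act[OF transvection_in_sp eq]] z
    by (auto simp: C_def eqv_def word_act_linear(3) ev_scale)
  have C2: "C b q = lin_fun (\<lambda>u. C b (word u)) q" for b q
    unfolding C_def by (subst lin_ext_words[of q]) (simp only: word_act_linear(5) ev_lin_ext)
  have ev2: "ev z q = lin_fun (\<lambda>u. ev z (word u)) q" for q
    by (subst lin_ext_words[of q]) (rule ev_lin_ext)
  have "(\<Sum>b\<in>B. C b s') = lin_fun (\<lambda>u. \<Sum>b\<in>B. C b (word u)) s'"
    by (subst C2) (simp only: lin_fun_fun_sum)
  also have "\<dots> = lin_fun (\<lambda>u. of_nat (e - k) * ev z (word u) + (\<Sum>m<e. \<Sum>n\<in>{..<e} - {m}. R m n u)) s'"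
  proof (rule lin_fun_cong)
    fix u assume "u \<in> Poly_Mapping.keys s'"
    then have "good u" using s'_good by blast
    then obtain A where A: "length u = e" "A \<subseteq> {..<e}" "card A = e - k" "\<And>m. m \<in> A \<Longrightarrow> u ! m \<in> F"
      "\<And>m. m < e \<Longrightarrow> m \<notin> A \<Longrightarrow> \<exists>c i. i < k \<and> u ! m = scale c (x i)"
      unfolding good_def by blast
    show "(\<Sum>b\<in>B. C b (word u)) = of_nat (e - k) * ev z (word u) + (\<Sum>m<e. \<Sum>n\<in>{..<e} - {m}. R m n u)"
      using casimir_word[OF A(1) z k A(2,4,5)] A(3) by (simp add: C_def R_def)
  qed
  also have "\<dots> = of_nat (e - k) * ev z s' + (\<Sum>m<e. \<Sum>n\<in>{..<e} - {m}. lin_fun (R m n) s')"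
    unfolding lin_fun_fun_add lin_fun_fun_scale lin_fun_fun_sum ev2[of s'] ..
  also have "(\<Sum>m<e. \<Sum>n\<in>{..<e} - {m}. lin_fun (R m n) s') = 0"
    unfolding R_def by (intro sum.neutral ballI trace_term[OF s'tr z]) auto
  finally have "f * (\<Sum>b\<in>B. C b s) = f * (of_nat (e - k) * ev z s)"
    using eq z by (simp add: C1 sum_distrib_left eqv_def ev_scale mult_ac)
  then show ?thesis by (simp add: f_def C_def s_def)
qed

end

end


section \<open>Coefficient functions\<close>

interpretation funs: vector_space "\<lambda>(a :: 'k::field) (f :: 'i \<Rightarrow> 'k) x. a * f x"
  by unfold_locales (auto simp: fun_eq_iff algebra_simps)

text \<open>The index type is infinite, but functions supported on a fixed finite set lie in a
  finite span, as \<open>in_span_irreducibles\<close> requires.\<close>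

lemma funs_in_span_delta:
  assumes "finite D" "\<And>a. a \<notin> D \<Longrightarrow> c a = 0"
  shows "c \<in> funs.span ((\<lambda>a b. if a = b then 1 else 0) ` D)"
proof -
  have "c = (\<Sum>a\<in>D. (\<lambda>b. c a * (if a = b then 1 else 0)))"
  proof
    fix b
    have "(\<Sum>a\<in>D. (\<lambda>b. c a * (if a = b then 1 else 0))) b = (\<Sum>a\<in>D. c a * (if a = b then 1 else 0))"
      by (induction D rule: infinite_finite_induct) simp_all
    also have "\<dots> = (\<Sum>a\<in>D. if a = b then c a else 0)" by (intro sum.cong) auto
    also have "\<dots> = c b" using assms by (simp add: sum.delta)
    finally show "c b = (\<Sum>a\<in>D. (\<lambda>b. c a * (if a = b then 1 else 0))) b" by simp
  qed
  also have "\<dots> \<in> funs.span ((\<lambda>a b. if a = b then 1 else 0) ` D)"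
    by (intro funs.span_sum funs.span_scale funs.span_base) auto
  finally show ?thesis .
qed

lemma sum_fun_apply: "(\<Sum>a\<in>A. f a) x = (\<Sum>a\<in>A. f a x)"
  for f :: "'a \<Rightarrow> 'b \<Rightarrow> 'c::comm_monoid_add"
  by (induction A rule: infinite_finite_induct) simp_all

text \<open>Renames the entries of the list and keeps the first component; on coefficient functions
  this permutes the test vectors (\<open>relabel_coeff\<close>). The order of composition is
  reversed, but the set of all relabelings is still a group.\<close>

definition relabel :: "(nat \<Rightarrow> nat) \<Rightarrow> ('i \<times> nat list \<Rightarrow> 'k) \<Rightarrow> 'i \<times> nat list \<Rightarrow> 'k" where
  "relabel \<pi> c = (\<lambda>a. c (fst a, map \<pi> (snd a)))"

definition relabelings :: "nat \<Rightarrow> (('i \<times> nat list \<Rightarrow> 'k) \<Rightarrow> ('i \<times> nat list \<Rightarrow> 'k)) set" where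
  "relabelings e = relabel ` {\<pi>. \<pi> permutes {..<e}}"

lemma relabel_comp: "relabel \<pi> \<circ> relabel \<tau> = relabel (\<tau> \<circ> \<pi>)"
  by (simp add: relabel_def fun_eq_iff)

lemma relabel_id: "relabel id = id"
  by (simp add: relabel_def fun_eq_iff)

lemma finite_linear_group_relabelings:
  "finite_linear_group (\<lambda>(a :: 'k::field_char_0) f x. a * f x)
     (relabelings e :: (('i \<times> nat list \<Rightarrow> 'k) \<Rightarrow> _) set)"
proof (intro finite_linear_group.intro finite_linear_group_axioms.intro funs.vector_space_axioms)
  let ?G = "relabelings e :: (('i \<times> nat list \<Rightarrow> 'k) \<Rightarrow> _) set"
  show "finite ?G" by (simp add: relabelings_def finite_permutations)
  show "id \<in> ?G" unfolding relabelings_def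
    by (rule image_eqI[where x = id]) (simp_all add: relabel_id permutes_id)
  show "g \<circ> h \<in> ?G" if "g \<in> ?G" "h \<in> ?G" for g h
    using that by (auto simp: relabelings_def relabel_comp permutes_compose)
  have inv: "relabel \<pi> \<circ> relabel (inv_into UNIV \<pi>) = (id :: ('i \<times> nat list \<Rightarrow> 'k) \<Rightarrow> _)"
    "relabel (inv_into UNIV \<pi>) \<circ> relabel \<pi> = (id :: ('i \<times> nat list \<Rightarrow> 'k) \<Rightarrow> _)"
    if "\<pi> permutes {..<e}" for \<pi>
    by (simp_all add: relabel_comp permutes_inv_o[OF that] relabel_id)
  fix g assume "g \<in> ?G"
  then obtain \<pi> where \<pi>: "\<pi> permutes {..<e}" "g = relabel \<pi>" by (auto simp: relabelings_def)
  show "bij g" unfolding \<pi>(2) by (rule o_bij[OF inv(2)[OF \<pi>(1)] inv(1)[OF \<pi>(1)]])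
  have "inv_into UNIV g = relabel (inv_into UNIV \<pi>)"
    unfolding \<pi>(2) by (rule inv_unique_comp[OF inv[OF \<pi>(1)]])
  then show "inv_into UNIV g \<in> ?G" using permutes_inv[OF \<pi>(1)] by (auto simp: relabelings_def)
  show "Vector_Spaces.linear (\<lambda>a f x. a * f x) (\<lambda>a f x. a * f x) g"
    unfolding Vector_Spaces.linear_iff \<pi>(2)
    by (intro conjI funs.vector_space_axioms) (auto simp: relabel_def)
qed

interpretation rel: finite_linear_group "\<lambda>(a :: 'k::field_char_0) f x. a * f x"
    "relabelings e :: (('i \<times> nat list \<Rightarrow> 'k) \<Rightarrow> _) set" for e
  by (rule finite_linear_group_relabelings)

text \<open>The symmetric group acts simply transitively on these lists, so a sum over lists becomes
  a sum over the group once a base point \<open>m\<close> is chosen.\<close>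

lemma bij_perm_lists_permutes:
  assumes "m \<in> perm_lists e"
  shows "bij_betw (\<lambda>\<pi>. map \<pi> m) {\<pi>. \<pi> permutes {..<e}} (perm_lists e)"
proof -
  note m = perm_listsD[OF assms]
  have "inj_on (\<lambda>\<pi>. map \<pi> m) {\<pi>. \<pi> permutes {..<e}}"
  proof (rule inj_onI)
    fix \<pi> \<tau> assume *: "\<pi> \<in> {\<pi>. \<pi> permutes {..<e}}" "\<tau> \<in> {\<pi>. \<pi> permutes {..<e}}" "map \<pi> m = map \<tau> m"
    show "\<pi> = \<tau>"
    proof
      fix i show "\<pi> i = \<tau> i"
        using * m(3) permutes_not_in[of \<pi> "{..<e}" i] permutes_not_in[of \<tau> "{..<e}" i]
        by (cases "i < e") auto
    qed
  qed
  moreover have "(\<lambda>\<pi>. map \<pi> m) ` {\<pi>. \<pi> permutes {..<e}} \<subseteq> perm_lists e"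
    using map_perm_lists assms by blast
  moreover have "card {\<pi>. \<pi> permutes {..<e}} = card (perm_lists e)"
    using card_permutations[of "{..<e}" e] by simp
  ultimately show ?thesis
    by (simp add: bij_betw_def card_image card_subset_eq)
qed

context inf_symplectic
begin

definition admissible :: "nat \<Rightarrow> nat \<Rightarrow> (nat \<times> nat) list set" where
  "admissible d r = {Is. disjoint_index_pairs d Is \<and> length Is = r}"

lemma admissibleD: "Is \<in> admissible d r \<Longrightarrow> disjoint_index_pairs d Is \<and> length Is = r"
  by (simp add: admissible_def)

text \<open>The first index runs over all contractions, since a submodule need not split along them.
  The value 0 off the admissible indices keeps these functions in a finite-dimensional
  space.\<close>

definition coeff :: "nat \<Rightarrow> nat \<Rightarrow> (nat \<Rightarrow> 'v) \<Rightarrow> ('v list \<Rightarrow>\<^sub>0 'k) \<Rightarrow> (nat \<times> nat) list \<times> nat list \<Rightarrow> 'k" where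
  "coeff d r \<omega> t = (\<lambda>a. if fst a \<in> admissible d r \<and> snd a \<in> perm_lists (d - 2 * r)
     then ev (map \<omega> (snd a)) (contr (fst a) t) else 0)"

lemma coeff_add: "coeff d r \<omega> (t + u) = coeff d r \<omega> t + coeff d r \<omega> u"
  and coeff_scale: "coeff d r \<omega> (fscale c t) = (\<lambda>x. c * coeff d r \<omega> t x)"
  and coeff_zero: "coeff d r \<omega> 0 = 0"
  by (auto simp: coeff_def fun_eq_iff contr_add ev_add contr_scale ev_scale contr_zero ev_zero)

lemma relabel_coeff:
  "\<pi> permutes {..<d - 2 * r} \<Longrightarrow> relabel \<pi> (coeff d r \<omega> t) = coeff d r (\<omega> \<circ> \<pi>) t"
  by (simp add: relabel_def coeff_def fun_eq_iff map_perm_lists)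

text \<open>Moving \<open>X\<close> to the test vectors gives a combination of coefficient functions
  of \<open>t\<close> itself for changed \<open>\<omega>\<close>. A linear condition imposed for all
  \<open>\<omega>\<close> is therefore preserved by the action.\<close>

lemma coeff_word_act:
  assumes "X \<in> sp" "t \<in> words d"
  shows "coeff d r \<omega> (word_act X t) = (\<Sum>i<d - 2 * r. (\<lambda>x. - 1 * coeff d r (\<omega>(i := X (\<omega> i))) t x))"
proof
  fix a :: "(nat \<times> nat) list \<times> nat list"
  obtain Is l where a: "a = (Is, l)" by force
  let ?e = "d - 2 * r"
  show "coeff d r \<omega> (word_act X t) a = (\<Sum>i<?e. (\<lambda>x. - 1 * coeff d r (\<omega>(i := X (\<omega> i))) t x)) a"
  proof (cases "Is \<in> admissible d r \<and> l \<in> perm_lists ?e")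
    case True
    then have Is: "disjoint_index_pairs d Is" "length Is = r" and l: "l \<in> perm_lists ?e"
      by (auto simp: admissible_def)
    note L = perm_listsD[OF l]
    have "ev (map \<omega> l) (contr Is (word_act X t)) =
        - (\<Sum>n<?e. ev ((map \<omega> l)[n := X (map \<omega> l ! n)]) (contr Is t))"
      using ev_word_act_contr[OF assms(1) Is(1) assms(2), of "map \<omega> l"] Is(2) L(1) by simp
    \<comment> \<open>The entries of \<open>l\<close> are distinct, so changing the test vector at
      position \<open>n\<close> amounts to changing \<open>\<omega>\<close> at the single argument
      \<open>l ! n\<close>.\<close>
    also have "(\<Sum>n<?e. ev ((map \<omega> l)[n := X (map \<omega> l ! n)]) (contr Is t)) =
        (\<Sum>n<?e. ev (map (\<omega>(l ! n := X (\<omega> (l ! n)))) l) (contr Is t))"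
    proof (intro sum.cong refl arg_cong2[where f = ev])
      fix n assume "n \<in> {..<?e}"
      then have n: "n < length l" using L(1) by simp
      show "(map \<omega> l)[n := X (map \<omega> l ! n)] = map (\<omega>(l ! n := X (\<omega> (l ! n)))) l"
        using n L(2) by (intro nth_equalityI) (auto simp: nth_list_update nth_eq_iff_index_eq)
    qed
    also have "\<dots> = (\<Sum>i<?e. ev (map (\<omega>(i := X (\<omega> i))) l) (contr Is t))"
      by (rule sum_perm_list[OF l])
    finally show ?thesis using True
      by (simp add: sum_fun_apply coeff_def a sum_negf)
  qed (auto simp: sum_fun_apply coeff_def a)
qed

text \<open>Any list z of test vectors arises from the identity list by letting
  \<open>\<omega>\<close> read off z, so coefficient functions see all values of all
  contractions.\<close>

lemma coeff_eq_zero_iff: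
  assumes "t \<in> words d"
  shows "(\<forall>\<omega>. coeff d r \<omega> t = 0) \<longleftrightarrow> t \<in> layer d r"
proof
  assume z: "\<forall>\<omega>. coeff d r \<omega> t = 0"
  show "t \<in> layer d r" unfolding layer_iff
  proof (intro conjI allI impI assms)
    fix Is z assume *: "disjoint_index_pairs d Is \<and> length Is = r \<and> length (z :: 'v list) = d - 2 * r"
    have "coeff d r ((!) z) t (Is, [0..<d - 2 * r]) = 0" using z by simp
    moreover have "map ((!) z) [0..<d - 2 * r] = z" using * map_nth[of z] by simp
    moreover have "[0..<d - 2 * r] \<in> perm_lists (d - 2 * r)" by (auto simp: permutations_of_set_def)
    ultimately show "ev z (contr Is t) = 0" using * by (simp add: coeff_def admissible_def)
  qed
next
  assume "t \<in> layer d r"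
  then show "\<forall>\<omega>. coeff d r \<omega> t = 0"
    using perm_listsD(1) by (auto simp: coeff_def fun_eq_iff layer_iff admissible_def)
qed

lemma coeff_outside: "a \<notin> admissible d r \<times> perm_lists (d - 2 * r) \<Longrightarrow> coeff d r \<omega> t a = 0"
  by (cases a) (auto simp: coeff_def)

lemma finite_coeff_support: "finite (admissible d r \<times> perm_lists (d - 2 * r))"
  using finite_index_pairs by (auto simp: admissible_def)

lemma subspace_traceless: "free.subspace (traceless e)"
proof -
  have "traceless e = words e \<inter> (\<Inter>ij\<in>{ij. fst ij < snd ij \<and> snd ij < e}. {p. contr [ij] p \<in> null (e - 2)})"
    by (auto simp: traceless_def)
  then show ?thesis
    by (auto intro!: free.subspace_inter free.subspace_Int subspace_words
        subspace_contr_preimage subspace_null)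
qed

definition entries :: "('v list \<Rightarrow>\<^sub>0 'k) \<Rightarrow> 'v set" where
  "entries p = (\<Union>vs\<in>Poly_Mapping.keys p. set vs)"

lemma finite_entries: "finite (entries p)"
  by (simp add: entries_def)

lemma entries_contr:
  assumes "t \<in> words d"
  shows "entries (contr Is t) \<subseteq> entries t"
proof -
  have "contr Is t \<in> {p. \<forall>vs\<in>Poly_Mapping.keys p. set vs \<subseteq> entries t}"
    unfolding contract_def
  proof (intro subspace_lin_ext subspace_supported)
    fix vs assume vs: "vs \<in> Poly_Mapping.keys t"
    then have len: "length vs = d" using assms by (auto simp: words_def)
    have "set (map ((!) vs) (free_positions d Is)) \<subseteq> set vs"
      using len by (auto simp: set_free_positions)
    then show "contract_word \<Omega> Is vs \<in> {p. \<forall>vs\<in>Poly_Mapping.keys p. set vs \<subseteq> entries t}"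
      using vs keys_fscale unfolding contract_word_eq[OF len] by (fastforce simp: entries_def)
  qed
  then show ?thesis by (auto simp: entries_def)
qed

text \<open>The dual vectors are chosen before the frame, which has to be orthogonal to them
  too.\<close>

lemma frame_exists:
  assumes "finite F"
  obtains B wd x y where "frame scale \<Omega> F (wd ` B) x y e" "finite B" "B \<subseteq> F" "F \<subseteq> span B"
    "\<And>b b'. b \<in> B \<Longrightarrow> b' \<in> B \<Longrightarrow> \<Omega> b (wd b') = (if b = b' then 1 else 0)"
    "\<And>v. v \<in> F \<Longrightarrow> (\<Sum>b\<in>B. scale (\<Omega> v (wd b)) b) = v"
proof -
  obtain B wd where B: "finite B" "B \<subseteq> F" "F \<subseteq> span B"
    "\<And>b b'. b \<in> B \<Longrightarrow> b' \<in> B \<Longrightarrow> \<Omega> b (wd b') = (if b = b' then 1 else 0)"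
    "\<And>v. v \<in> F \<Longrightarrow> (\<Sum>b\<in>B. scale (\<Omega> v (wd b)) b) = v"
    by (rule finite_dual_basis[OF assms]) blast
  have fin: "finite (F \<union> wd ` B)" using assms B(1) by simp
  obtain x y where "\<And>i j. i < e \<Longrightarrow> j < e \<Longrightarrow> \<Omega> (x i) (y j) = (if i = j then 1 else 0)"
    "\<And>i j. i < e \<Longrightarrow> j < e \<Longrightarrow> \<Omega> (x i) (x j) = 0"
    "\<And>i f. i < e \<Longrightarrow> f \<in> F \<union> wd ` B \<Longrightarrow> \<Omega> f (x i) = 0"
    "\<And>i f. i < e \<Longrightarrow> f \<in> F \<union> wd ` B \<Longrightarrow> \<Omega> f (y i) = 0"
    by (rule symplectic_frame[OF fin]) blast
  then have "frame scale \<Omega> F (wd ` B) x y e"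
    by (intro frame.intro frame_axioms.intro inf_symplectic_axioms)
  then show thesis using that B by blast
qed


section \<open>Submodules of tensor powers\<close>

abbreviation word_mod :: "nat \<Rightarrow> ('k, 'v list \<Rightarrow>\<^sub>0 'k, 'v \<Rightarrow> 'v) lie_module" where
  "word_mod \<equiv> word_module"

abbreviation tensor_mod :: "nat \<Rightarrow> ('k, ('v list \<Rightarrow>\<^sub>0 'k) set, 'v \<Rightarrow> 'v) lie_module" where
  "tensor_mod \<equiv> tensor_power scale"

lemma word_module_simps:
  "carrier (word_module d) = words d" "zero (word_module d) = 0" "add (word_module d) = (+)"
  "smult (word_module d) = fscale" "act (word_module d) = word_act"
  by (simp_all add: word_module_def words_def word_act_def fun_eq_iff)

lemma lie_mod_word_module: "lie_mod sp (word_mod d)"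
proof (intro lie_mod.intro lie_mod_axioms.intro moduleI cring_field_ring abelian_groupI)
  fix p :: "'v list \<Rightarrow>\<^sub>0 'k" assume "p \<in> carrier (word_module d)"
  then show "\<exists>q\<in>carrier (word_module d). q \<oplus>\<^bsub>word_module d\<^esub> p = \<zero>\<^bsub>word_module d\<^esub>"
    by (intro bexI[of _ "- p"])
      (simp_all add: word_module_simps free.subspace_neg[OF subspace_words])
qed (simp_all add: word_module_simps free.subspace_add[OF subspace_words] free.subspace_0[OF subspace_words]
    free.subspace_scale[OF subspace_words] word_act_in_words word_act_linear add_ac
    free.scale_left_distrib free.scale_right_distrib)

lemma lie_submodule_words_iff:
  "lie_submodule sp K (word_mod d) \<longleftrightarrow>
     K \<subseteq> words d \<and> free.subspace K \<and> (\<forall>X\<in>sp. \<forall>p\<in>K. word_act X p \<in> K)"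
proof -
  interpret W: lie_mod sp "word_mod d" by (rule lie_mod_word_module)
  show ?thesis
  proof
    assume K: "lie_submodule sp K (word_mod d)"
    show "K \<subseteq> words d \<and> free.subspace K \<and> (\<forall>X\<in>sp. \<forall>p\<in>K. word_act X p \<in> K)"
      using W.lie_submodule_subset[OF K] W.lie_submodule_zero[OF K] W.lie_submodule_add[OF K]
        W.lie_submodule_smult[OF K] W.lie_submodule_act[OF K]
      by (auto simp: word_module_simps intro!: free.subspaceI)
  next
    assume "K \<subseteq> words d \<and> free.subspace K \<and> (\<forall>X\<in>sp. \<forall>p\<in>K. word_act X p \<in> K)"
    then show "lie_submodule sp K (word_mod d)"
      by (intro W.lie_submoduleI)
        (auto simp: word_module_simps free.subspace_0 free.subspace_add free.subspace_scale)
  qed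
qed

lemma lie_submodule_layer: "lie_submodule sp (layer d r) (word_mod d)"
  unfolding lie_submodule_words_iff using subspace_layer layer_word_act by (auto simp: layer_def)

lemma iter_act_in_submodule:
  assumes "lie_submodule sp K (word_mod d)" "t \<in> K"
    "\<And>i. i < k \<Longrightarrow> X i \<in> sp"
  shows "iter_act X k t \<in> K"
  using assms(3) by (induction k) (use assms(1,2) in \<open>auto simp: lie_submodule_words_iff\<close>)

text \<open>Attaches to a subspace \<open>J\<close> of functions a submodule between
  \<open>layer d r\<close> and \<open>layer d (Suc r)\<close>; the irreducible \<open>J\<close>
  provide the covers.\<close>

definition symmetry_part :: "nat \<Rightarrow> nat \<Rightarrow> ((nat \<times> nat) list \<times> nat list \<Rightarrow> 'k) set \<Rightarrow> ('v list \<Rightarrow>\<^sub>0 'k) set" where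
  "symmetry_part d r J = {t \<in> layer d (Suc r). \<forall>\<omega>. coeff d r \<omega> t \<in> J}"

lemma lie_submodule_symmetry_part:
  assumes J: "funs.subspace J"
  shows "lie_submodule sp (symmetry_part d r J) (word_mod d)"
  unfolding lie_submodule_words_iff
proof (intro conjI ballI)
  show "symmetry_part d r J \<subseteq> words d" by (auto simp: symmetry_part_def layer_def)
  show "free.subspace (symmetry_part d r J)"
  proof (rule free.subspaceI)
    show "0 \<in> symmetry_part d r J"
      using free.subspace_0[OF subspace_layer] funs.subspace_0[OF J]
      by (simp add: symmetry_part_def coeff_zero zero_fun_def)
    show "p + q \<in> symmetry_part d r J" if "p \<in> symmetry_part d r J" "q \<in> symmetry_part d r J" for p q
      using that free.subspace_add[OF subspace_layer] funs.subspace_add[OF J]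
      by (simp add: symmetry_part_def coeff_add)
    show "fscale c p \<in> symmetry_part d r J" if "p \<in> symmetry_part d r J" for c p
      using that free.subspace_scale[OF subspace_layer] funs.subspace_scale[OF J]
      by (simp add: symmetry_part_def coeff_scale)
  qed
  fix X p assume X: "X \<in> sp" and p: "p \<in> symmetry_part d r J"
  then have "p \<in> words d" by (auto simp: symmetry_part_def layer_def)
  then show "word_act X p \<in> symmetry_part d r J"
    using p layer_word_act[OF X] unfolding symmetry_part_def
    by (auto simp only: coeff_word_act[OF X] mem_Collect_eq
        intro!: funs.subspace_sum[OF J] funs.subspace_scale[OF J])
qed

lemma layer_subset_symmetry_part:
  assumes "funs.subspace J" shows "layer d r \<subseteq> symmetry_part d r J"
proof
  fix t assume t: "t \<in> layer d r"
  then have "t \<in> words d" by (simp add: layer_def)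
  then have "coeff d r \<omega> t = 0" for \<omega> using coeff_eq_zero_iff[of t d r] t by blast
  then show "t \<in> symmetry_part d r J"
    using t layer_mono funs.subspace_0[OF assms] by (auto simp: symmetry_part_def)
qed

text \<open>The form a tensor takes after raising. Modulo \<open>layer d r\<close> it is determined
  by \<open>c\<close> (\<open>realizes_unique\<close>), and by linearity and
  \<open>realizes_layer_zero\<close> it determines \<open>c\<close> on the admissible indices. This
  is the bridge between function spaces and submodules.\<close>

definition realizes :: "nat \<Rightarrow> nat \<Rightarrow> (nat \<Rightarrow> 'v) \<Rightarrow> ((nat \<times> nat) list \<times> nat list \<Rightarrow> 'k) \<Rightarrow>
    ('v list \<Rightarrow>\<^sub>0 'k) \<Rightarrow> bool" where
  "realizes d r x c u \<longleftrightarrow> u \<in> words d \<and> (\<forall>Is\<in>admissible d r. \<forall>z. length z = d - 2 * r \<longrightarrow>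
     ev z (contr Is u) = (\<Sum>l\<in>perm_lists (d - 2 * r). c (Is, l) * ev z (word (map x l))))"

lemma realizes_zero: "realizes d r x 0 0"
  by (simp add: realizes_def contr_zero ev_zero free.subspace_0[OF subspace_words])

lemma realizes_add: "realizes d r x c u \<Longrightarrow> realizes d r x c' u' \<Longrightarrow> realizes d r x (c + c') (u + u')"
  by (simp add: realizes_def contr_add ev_add free.subspace_add[OF subspace_words] algebra_simps sum.distrib)

lemma realizes_scale: "realizes d r x c u \<Longrightarrow> realizes d r x (\<lambda>i. a * c i) (fscale a u)"
  by (simp add: realizes_def contr_scale ev_scale free.subspace_scale[OF subspace_words]
      sum_distrib_left mult.assoc)

lemma realizes_unique:
  assumes "realizes d r x c u" "realizes d r x c u'"
  shows "u - u' \<in> layer d r"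
  using assms by (auto simp: realizes_def layer_iff contr_diff ev_diff admissible_def
      free.subspace_diff[OF subspace_words])

lemma realizes_raise:
  assumes fr: "frame scale \<Omega> F W x y (d - 2 * r)" and t: "t \<in> words d" "entries t \<subseteq> F"
    and \<omega>: "\<And>i. i < d - 2 * r \<Longrightarrow> \<omega> i \<in> W"
  shows "realizes d r x (coeff d r \<omega> t) (iter_act (\<lambda>i. transvection (x i) (\<omega> i)) (d - 2 * r) t)"
  unfolding realizes_def
proof (intro conjI ballI allI impI iter_act_in_words t(1))
  fix Is and z :: "'v list" assume Is: "Is \<in> admissible d r" and z: "length z = d - 2 * r"
  interpret frame scale \<Omega> F W x y "d - 2 * r" by (rule fr)
  have I: "disjoint_index_pairs d Is" "length Is = r" using admissibleD[OF Is] by auto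
  have "ev z (contr Is (raise \<omega> (d - 2 * r) t)) = ev z (raise \<omega> (d - 2 * r) (contr Is t))"
    using eqv_contr_iter_act[OF I(1) t(1), of "d - 2 * r" "\<lambda>i. transvection (x i) (\<omega> i)"]
      transvection_in_sp I(2) z by (simp add: eqv_def)
  also have "\<dots> = (\<Sum>l\<in>perm_lists (d - 2 * r). ev (map \<omega> l) (contr Is t) * ev z (word (map x l)))"
  proof (rule raise_full)
    show "contr Is t \<in> words (d - 2 * r)" using contract_in_words[OF I(1) t(1)] I(2) by simp
    show "set vs \<subseteq> F" if "vs \<in> Poly_Mapping.keys (contr Is t)" for vs
      using that entries_contr[OF t(1), of Is] t(2) by (auto simp: entries_def)
  qed (use \<omega> z in auto)
  finally show "ev z (contr Is (raise \<omega> (d - 2 * r) t)) =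
      (\<Sum>l\<in>perm_lists (d - 2 * r). coeff d r \<omega> t (Is, l) * ev z (word (map x l)))"
    using Is by (simp add: coeff_def)
qed

lemma realizes_in_layer:
  assumes fr: "frame scale \<Omega> F W x y (d - 2 * r)" and u: "realizes d r x c u"
  shows "u \<in> layer d (Suc r)"
  unfolding layer_Suc_iff
proof (intro conjI allI impI)
  show uw: "u \<in> words d" using u by (simp add: realizes_def)
  interpret frame scale \<Omega> F W x y "d - 2 * r" by (rule fr)
  fix Is assume I: "disjoint_index_pairs d Is \<and> length Is = r"
  let ?q = "\<Sum>l\<in>perm_lists (d - 2 * r). fscale (c (Is, l)) (word (map x l))"
  have q: "?q \<in> traceless (d - 2 * r)"
    using perm_listsD(1,3)
    by (intro free.subspace_sum free.subspace_scale subspace_traceless traceless_word_x) auto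
  have "eqv (d - 2 * r) ?q (contr Is u)"
    using q u I contract_in_words[OF conjunct1[OF I] uw]
    by (auto simp: eqv_def realizes_def admissible_def ev_sum ev_scale traceless_def)
  then show "contr Is u \<in> traceless (d - 2 * r)" using q by (rule eqv_traceless)
qed

text \<open>At arbitrary vectors \<open>\<zeta>\<close> the coefficient function is a combination of
  relabelings of \<open>c\<close>, weighted by products of \<open>\<Omega>\<close> between the
  \<open>x i\<close> and the \<open>\<zeta> i\<close>. Stability under the symmetric group keeps it
  in \<open>J\<close>.\<close>

lemma realizes_in_symmetry_part:
  assumes fr: "frame scale \<Omega> F W x y (d - 2 * r)" and u: "realizes d r x c u"
    and J: "rel.stable (d - 2 * r) J" and c: "c \<in> J"
    and supp: "\<And>a. a \<notin> admissible d r \<times> perm_lists (d - 2 * r) \<Longrightarrow> c a = 0"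
  shows "u \<in> symmetry_part d r J"
proof -
  interpret frame scale \<Omega> F W x y "d - 2 * r" by (rule fr)
  let ?e = "d - 2 * r"
  have sub: "funs.subspace J" and st: "\<And>\<pi> c. \<pi> permutes {..<?e} \<Longrightarrow> c \<in> J \<Longrightarrow> relabel \<pi> c \<in> J"
    using J[unfolded rel.stable_def] by (auto simp: relabelings_def)
  have "coeff d r \<zeta> u \<in> J" for \<zeta>
  proof -
    let ?w = "\<lambda>\<pi>. \<Prod>i<?e. \<Omega> (x (\<pi> i)) (\<zeta> i)"
    have "coeff d r \<zeta> u = (\<Sum>\<pi> | \<pi> permutes {..<?e}. (\<lambda>a. ?w \<pi> * relabel \<pi> c a))"
    proof
      fix a :: "(nat \<times> nat) list \<times> nat list"
      obtain Is m where a: "a = (Is, m)" by force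
      show "coeff d r \<zeta> u a = (\<Sum>\<pi> | \<pi> permutes {..<?e}. (\<lambda>a. ?w \<pi> * relabel \<pi> c a)) a"
      proof (cases "Is \<in> admissible d r \<and> m \<in> perm_lists ?e")
        case True
        then have m: "m \<in> perm_lists ?e" by blast
        have "coeff d r \<zeta> u a = (\<Sum>l\<in>perm_lists ?e. c (Is, l) * ev (map \<zeta> m) (word (map x l)))"
          using True u perm_listsD(1)[OF m] by (simp add: coeff_def a realizes_def)
        also have "\<dots> = (\<Sum>\<pi> | \<pi> permutes {..<?e}. c (Is, map \<pi> m) * ev (map \<zeta> m) (word (map x (map \<pi> m))))"
          by (rule sum.reindex_bij_betw[OF bij_perm_lists_permutes[OF m], symmetric])
        also have "\<dots> = (\<Sum>\<pi> | \<pi> permutes {..<?e}. ?w \<pi> * relabel \<pi> c a)"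
        proof (intro sum.cong refl)
          fix \<pi>
          have "ev (map \<zeta> m) (word (map x (map \<pi> m))) = (\<Prod>j<?e. \<Omega> (x (\<pi> (m ! j))) (\<zeta> (m ! j)))"
            using perm_listsD(1)[OF m] by (simp add: ev_word)
          also have "\<dots> = ?w \<pi>" by (rule prod_perm_list[OF m])
          finally show "c (Is, map \<pi> m) * ev (map \<zeta> m) (word (map x (map \<pi> m))) = ?w \<pi> * relabel \<pi> c a"
            by (simp add: relabel_def a)
        qed
        finally show ?thesis by (simp add: sum_fun_apply)
      next
        case False
        then have "relabel \<pi> c a = 0" if "\<pi> permutes {..<?e}" for \<pi>
          using supp[of "(Is, map \<pi> m)"] map_perm_lists[OF that] by (auto simp: relabel_def a)
        then show ?thesis using False by (auto simp: sum_fun_apply coeff_def a)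
      qed
    qed
    then show ?thesis
      using st c by (auto intro!: funs.subspace_sum[OF sub] funs.subspace_scale[OF sub])
  qed
  then show ?thesis using realizes_in_layer[OF fr u] by (simp add: symmetry_part_def)
qed

text \<open>Downward induction from the fully raised tensors: the Casimir operator recovers stage k
  from stage k + 1 up to the nonzero factor e - k and an element of \<open>layer d r\<close>. Stage
  0 is \<open>t\<close> itself.\<close>

lemma regenerate:
  assumes K: "lie_submodule sp K (word_mod d)" "layer d r \<subseteq> K"
    and t: "t \<in> layer d (Suc r)" "entries t \<subseteq> F"
    and fr: "frame scale \<Omega> F (wd ` B) x y (d - 2 * r)" and B: "finite B" "B \<subseteq> F"
    "\<And>v. v \<in> F \<Longrightarrow> (\<Sum>b\<in>B. scale (\<Omega> v (wd b)) b) = v"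
    and raised: "\<And>\<omega>. (\<And>i. i < d - 2 * r \<Longrightarrow> \<omega> i \<in> wd ` B) \<Longrightarrow>
      iter_act (\<lambda>i. transvection (x i) (\<omega> i)) (d - 2 * r) t \<in> K"
  shows "t \<in> K"
proof -
  interpret frame scale \<Omega> F "wd ` B" x y "d - 2 * r" by (rule fr)
  let ?e = "d - 2 * r"
  note K' = K(1)[unfolded lie_submodule_words_iff]
  have subK: "free.subspace K" using K' by blast
  have tw: "t \<in> words d" using t by (simp add: layer_def)
  have "\<forall>\<omega>. (\<forall>i<k. \<omega> i \<in> wd ` B) \<longrightarrow> raise \<omega> k t \<in> K" if "k \<le> ?e" for k
    using that
  proof (induction rule: inc_induct)
    case base
    show ?case using raised by blast
  next
    case (step k)
    have k: "k < ?e" using step by simp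
    show ?case
    proof (intro allI impI)
      fix \<omega> assume \<omega>: "\<forall>i<k. \<omega> i \<in> wd ` B"
      define s where "s = raise \<omega> k t"
      define v where "v = (\<Sum>b\<in>B. word_act (transvection (y k) b) (word_act (transvection (x k) (wd b)) s))"
      have s: "s \<in> layer d (Suc r)" unfolding s_def
        by (rule iter_act_in_submodule[OF lie_submodule_layer t(1) transvection_in_sp])
      then have sw: "s \<in> words d" by (simp add: layer_def)
      have "word_act (transvection (x k) (wd b)) s \<in> K" if "b \<in> B" for b
      proof -
        \<comment> \<open>The induction runs over all \<open>\<omega>\<close> at once because the
          vector at place \<open>k\<close> must range over the whole dual basis.\<close>
        have "\<forall>i<Suc k. (\<omega>(k := wd b)) i \<in> wd ` B" using \<omega> that by (auto simp: less_Suc_eq)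
        then have "raise (\<omega>(k := wd b)) (Suc k) t \<in> K" using step.IH by blast
        moreover have "raise (\<omega>(k := wd b)) k t = s"
          unfolding s_def by (rule iter_act_cong) auto
        ultimately show ?thesis by (simp del: fun_upd_apply) (simp only: fun_upd_same)
      qed
      then have vK: "v \<in> K"
        unfolding v_def using K' transvection_in_sp by (auto intro!: free.subspace_sum)
      \<comment> \<open>As tensors, the contractions of \<open>s\<close> are the raised contractions
        of \<open>t\<close>. They are traceless since \<open>s\<close> lies in
        \<open>layer d (Suc r)\<close>, so the Casimir computation applies to each.\<close>
      have "v - fscale (of_nat (?e - k)) s \<in> layer d r"
        unfolding layer_iff
      proof (intro conjI allI impI)
        show "v - fscale (of_nat (?e - k)) s \<in> words d"
          using vK sw K' by (intro free.subspace_diff[OF subspace_words] free.subspace_scale[OF subspace_words]) auto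
        fix Is and z :: "'v list"
        assume *: "disjoint_index_pairs d Is \<and> length Is = r \<and> length z = ?e"
        then have I: "disjoint_index_pairs d Is" "length Is = r" and z: "length z = ?e" by auto
        let ?p = "contr Is t"
        have pw: "?p \<in> words ?e" using contract_in_words[OF I(1) tw] I(2) by simp
        have eq: "eqv ?e (contr Is s) (raise \<omega> k ?p)"
          using eqv_contr_iter_act[OF I(1) tw, of k "\<lambda>i. transvection (x i) (\<omega> i)"] transvection_in_sp I(2)
          by (simp add: s_def)
        have "contr Is s \<in> traceless ?e" using s I by (simp add: layer_Suc_iff)
        then have tr: "raise \<omega> k ?p \<in> traceless ?e" by (rule eqv_traceless[OF eq])
        have step2: "eqv ?e (contr Is (word_act X q)) (word_act X q')"
          if "X \<in> sp" "q \<in> words d" "eqv ?e (contr Is q) q'" for X q q'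
        proof -
          have "ev w (contr Is (word_act X q)) = ev w (word_act X (contr Is q))" if "length w = ?e" for w
            using ev_contr_word_act[OF \<open>X \<in> sp\<close> I(1) \<open>q \<in> words d\<close>] that I(2) by simp
          moreover have "contr Is (word_act X q) \<in> words ?e"
            using contract_in_words[OF I(1) word_act_in_words[OF that(2)]] I(2) by simp
          ultimately show ?thesis using eqv_word_act[OF that(1,3)] by (simp add: eqv_def)
        qed
        have "ev z (contr Is v) = (\<Sum>b\<in>B. ev z (word_act (transvection (y k) b)
            (word_act (transvection (x k) (wd b)) (raise \<omega> k ?p))))"
          unfolding v_def contr_sum ev_sum
        proof (rule sum.cong[OF refl])
          fix b
          show "ev z (contr Is (word_act (transvection (y k) b) (word_act (transvection (x k) (wd b)) s))) =
            ev z (word_act (transvection (y k) b) (word_act (transvection (x k) (wd b)) (raise \<omega> k ?p)))"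
            using step2[OF transvection_in_sp word_act_in_words[OF sw] step2[OF transvection_in_sp sw eq]] z
            by (simp add: eqv_def)
        qed
        also have "\<dots> = of_nat (?e - k) * ev z (raise \<omega> k ?p)"
        proof (rule casimir_raise[OF B(1,2) order_refl B(3) pw _ _ k z tr])
          show "set vs \<subseteq> F" if "vs \<in> Poly_Mapping.keys ?p" for vs
            using that entries_contr[OF tw, of Is] t(2) by (auto simp: entries_def)
        qed (use \<omega> in auto)
        also have "ev z (raise \<omega> k ?p) = ev z (contr Is s)" using eq z by (simp add: eqv_def)
        finally show "ev z (contr Is (v - fscale (of_nat (?e - k)) s)) = 0"
          by (simp add: contr_diff contr_scale ev_diff ev_scale)
      qed
      then have "v - fscale (of_nat (?e - k)) s \<in> K" using K(2) by blast
      then have "v - (v - fscale (of_nat (?e - k)) s) \<in> K" by (rule free.subspace_diff[OF subK vK])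
      then have "fscale (of_nat (?e - k)) s \<in> K" by simp
      then have "fscale (inverse (of_nat (?e - k))) (fscale (of_nat (?e - k)) s) \<in> K"
        by (rule free.subspace_scale[OF subK])
      moreover have "(of_nat (?e - k) :: 'k) \<noteq> 0" using k unfolding of_nat_eq_0_iff by simp
      ultimately show "raise \<omega> k t \<in> K"
        by (simp only: free.scale_scale left_inverse not_False_eq_True free.scale_one s_def)
    qed
  qed
  from this[of 0] show ?thesis by simp
qed

text \<open>Some contraction of \<open>t\<close> is a nonzero tensor with letters in the span of
  \<open>B\<close>, and \<open>null_dualI\<close> detects it by dual vectors alone.\<close>

lemma nonzero_coeff:
  assumes t: "t \<in> words d" "t \<notin> layer d r" "entries t \<subseteq> span B"
    and dual: "\<And>b b'. b \<in> B \<Longrightarrow> b' \<in> B \<Longrightarrow> \<Omega> b (wd b') = (if b = b' then 1 else 0)"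
  obtains Is \<omega> where "Is \<in> admissible d r" "\<forall>i<d - 2 * r. \<omega> i \<in> wd ` B"
    "coeff d r \<omega> t (Is, [0..<d - 2 * r]) \<noteq> 0"
proof -
  let ?e = "d - 2 * r"
  obtain Is where Is: "disjoint_index_pairs d Is" "length Is = r" "contr Is t \<notin> null ?e"
    using t(1,2) by (auto simp: layer_def)
  have w: "contr Is t \<in> words ?e" using contract_in_words[OF Is(1) t(1)] Is(2) by simp
  have en: "set vs \<subseteq> span B" if "vs \<in> Poly_Mapping.keys (contr Is t)" for vs
    using that entries_contr[OF t(1), of Is] t(3) by (auto simp: entries_def)
  obtain bs where bs: "set bs \<subseteq> B" "length bs = ?e" "ev (map wd bs) (contr Is t) \<noteq> 0"
    using null_dualI[OF w en dual] Is(3) by blast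
  have "map (\<lambda>i. wd (bs ! i)) [0..<?e] = map wd bs"
    using bs(2) by (intro nth_equalityI) auto
  then have "coeff d r (\<lambda>i. wd (bs ! i)) t (Is, [0..<?e]) \<noteq> 0"
    using bs(3) Is(1,2) by (auto simp: coeff_def admissible_def permutations_of_set_def)
  moreover have "\<forall>i<?e. wd (bs ! i) \<in> wd ` B"
  proof (intro allI impI imageI)
    show "bs ! i \<in> B" if "i < ?e" for i using bs(1,2) nth_mem[of i bs] that by auto
  qed
  ultimately show thesis using that Is(1,2) by (auto simp: admissible_def)
qed

lemma realizes_layer_zero:
  assumes fr: "frame scale \<Omega> F W x y (d - 2 * r)" and u: "realizes d r x c u" "u \<in> layer d r"
    and a: "Is \<in> admissible d r" "m \<in> perm_lists (d - 2 * r)"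
  shows "c (Is, m) = 0"
proof -
  interpret frame scale \<Omega> F W x y "d - 2 * r" by (rule fr)
  have len: "length (map y m) = d - 2 * r" using perm_listsD(1)[OF a(2)] by simp
  have "0 = ev (map y m) (contr Is u)" using u(2) a(1) len by (simp add: layer_iff admissible_def)
  also have "\<dots> = (\<Sum>l\<in>perm_lists (d - 2 * r). c (Is, l) * ev (map y m) (word (map x l)))"
    using u(1) a(1) len by (simp add: realizes_def)
  also have "\<dots> = (\<Sum>l\<in>perm_lists (d - 2 * r). if l = m then c (Is, l) else 0)"
    using a(2) by (intro sum.cong) (auto simp: ev_y_word_x)
  also have "\<dots> = c (Is, m)" using a(2) by (simp add: sum.delta)
  finally show ?thesis by simp
qed

text \<open>A raised tensor shows that the intersection of \<open>S\<close> with
  \<open>layer d (Suc r)\<close> is strictly larger than \<open>layer d r\<close>; as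
  \<open>S\<close> is a cover, the intersection is all of \<open>S\<close>.\<close>

lemma cover_subset_layer_Suc:
  assumes "covers sp (word_mod d) (layer d r) S"
  shows "S \<subseteq> layer d (Suc r)"
proof -
  let ?W = "word_mod d" and ?e = "d - 2 * r"
  have S: "lie_submodule sp S ?W" "layer d r \<subset> S"
    "\<And>K. lie_submodule sp K ?W \<Longrightarrow> layer d r \<subseteq> K \<Longrightarrow> K \<subseteq> S \<Longrightarrow> K = layer d r \<or> K = S"
    using assms by (auto simp: covers_def)
  note S' = S(1)[unfolded lie_submodule_words_iff]
  obtain t where t: "t \<in> S" "t \<notin> layer d r" using S(2) by blast
  have tw: "t \<in> words d" using t S' by blast
  obtain B wd x y where fr: "frame scale \<Omega> (entries t) (wd ` B) x y ?e" and B: "finite B"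
    "B \<subseteq> entries t" "entries t \<subseteq> span B"
    "\<And>b b'. b \<in> B \<Longrightarrow> b' \<in> B \<Longrightarrow> \<Omega> b (wd b') = (if b = b' then 1 else 0)"
    "\<And>v. v \<in> entries t \<Longrightarrow> (\<Sum>b\<in>B. scale (\<Omega> v (wd b)) b) = v"
    by (rule frame_exists[OF finite_entries[of t], of ?e]) blast
  obtain Is \<omega> where \<omega>: "Is \<in> admissible d r" "\<forall>i<?e. \<omega> i \<in> wd ` B"
    "coeff d r \<omega> t (Is, [0..<?e]) \<noteq> 0"
    by (rule nonzero_coeff[OF tw t(2) B(3,4)]) blast
  define u where "u = iter_act (\<lambda>i. transvection (x i) (\<omega> i)) ?e t"
  have u: "realizes d r x (coeff d r \<omega> t) u"
    unfolding u_def by (rule realizes_raise[OF fr tw order_refl]) (use \<omega>(2) in blast)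
  have "[0..<?e] \<in> perm_lists ?e" by (auto simp: permutations_of_set_def)
  then have "u \<notin> layer d r" using realizes_layer_zero[OF fr u _ \<omega>(1)] \<omega>(3) by blast
  moreover have "u \<in> S" unfolding u_def
    by (rule iter_act_in_submodule[OF S(1) t(1) transvection_in_sp])
  moreover have "u \<in> layer d (Suc r)" by (rule realizes_in_layer[OF fr u])
  moreover have "lie_submodule sp (S \<inter> layer d (Suc r)) ?W"
    using S' lie_submodule_layer[of d "Suc r", unfolded lie_submodule_words_iff]
    unfolding lie_submodule_words_iff by (auto intro: free.subspace_inter)
  moreover have "layer d r \<subseteq> S \<inter> layer d (Suc r)" using S(2) layer_mono by blast
  ultimately have "S \<inter> layer d (Suc r) = S" using S(3)[of "S \<inter> layer d (Suc r)"] by blast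
  then show ?thesis by blast
qed

text \<open>The \<open>\<omega> i\<close> are restricted to \<open>W\<close> because the frame is
  orthogonal to \<open>W\<close>. This makes every function of the span realizable in any submodule
  containing \<open>t\<close> (\<open>coeff_span_realized\<close>).\<close>

definition coeff_span :: "nat \<Rightarrow> nat \<Rightarrow> 'v set \<Rightarrow> ('v list \<Rightarrow>\<^sub>0 'k) \<Rightarrow> ((nat \<times> nat) list \<times> nat list \<Rightarrow> 'k) set" where
  "coeff_span d r W t = funs.span {coeff d r \<omega> t | \<omega>. \<forall>i<d - 2 * r. \<omega> i \<in> W}"

lemma stable_coeff_span: "rel.stable (d - 2 * r) (coeff_span d r W t)"
  unfolding rel.stable_def
proof (intro conjI ballI)
  show "funs.subspace (coeff_span d r W t)" by (simp add: coeff_span_def)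
  fix g :: "((nat \<times> nat) list \<times> nat list \<Rightarrow> 'k) \<Rightarrow> _" and c
  assume g: "g \<in> relabelings (d - 2 * r)" and c: "c \<in> coeff_span d r W t"
  obtain \<pi> where \<pi>: "\<pi> permutes {..<d - 2 * r}" "g = relabel \<pi>" using g by (auto simp: relabelings_def)
  show "g c \<in> coeff_span d r W t"
    using c unfolding coeff_span_def
  proof (induction rule: funs.span_induct_alt)
    case base
    have "g 0 = 0" by (simp add: \<pi>(2) relabel_def fun_eq_iff)
    then show ?case by (simp only: funs.span_zero)
  next
    case (step a c c')
    then obtain \<omega> where \<omega>: "c = coeff d r \<omega> t" "\<forall>i<d - 2 * r. \<omega> i \<in> W" by blast
    have "\<pi> i < d - 2 * r" if "i < d - 2 * r" for i using permutes_in_image[OF \<pi>(1), of i] that by simp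
    then have "g c \<in> {coeff d r \<omega> t | \<omega>. \<forall>i<d - 2 * r. \<omega> i \<in> W}"
      using \<omega> relabel_coeff[OF \<pi>(1), of \<omega> t] by (auto simp: \<pi>(2) intro!: exI[of _ "\<omega> \<circ> \<pi>"])
    then have "(\<lambda>x. a * g c x) + g c' \<in> funs.span {coeff d r \<omega> t | \<omega>. \<forall>i<d - 2 * r. \<omega> i \<in> W}"
      using step(2) by (intro funs.span_add[OF funs.span_scale[OF funs.span_base]])
    moreover have "g ((\<lambda>x. a * c x) + c') = (\<lambda>x. a * g c x) + g c'"
      by (simp add: \<pi>(2) relabel_def fun_eq_iff)
    ultimately show ?case by (simp only:)
  qed
qed

lemma coeff_span_realized:
  assumes fr: "frame scale \<Omega> F W x y (d - 2 * r)"
    and K: "lie_submodule sp K (word_mod d)"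
    and t: "t \<in> K" "entries t \<subseteq> F" and c: "c \<in> coeff_span d r W t"
  shows "\<exists>u\<in>K. realizes d r x c u"
  using c unfolding coeff_span_def
proof (induction rule: funs.span_induct_alt)
  case base
  show ?case
    by (rule bexI[of _ 0], rule realizes_zero) (use K in \<open>simp add: lie_submodule_words_iff free.subspace_0\<close>)
next
  case (step a c c')
  note K' = K[unfolded lie_submodule_words_iff]
  obtain \<omega> where \<omega>: "c = coeff d r \<omega> t" "\<forall>i<d - 2 * r. \<omega> i \<in> W" using step by blast
  define u where "u = iter_act (\<lambda>i. transvection (x i) (\<omega> i)) (d - 2 * r) t"
  have "u \<in> K" unfolding u_def by (rule iter_act_in_submodule[OF K t(1) transvection_in_sp])
  moreover have "realizes d r x c u"
    unfolding u_def \<omega>(1) by (rule realizes_raise[OF fr _ t(2)]) (use \<omega>(2) t(1) K' in auto)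
  moreover obtain u' where "u' \<in> K" "realizes d r x c' u'" using step by blast
  ultimately show ?case
    using realizes_add[OF realizes_scale] K' by (meson free.subspace_add free.subspace_scale)
qed

lemma raise_in_submodule:
  assumes fr: "frame scale \<Omega> F W x y (d - 2 * r)"
    and K: "lie_submodule sp K (word_mod d)" "layer d r \<subseteq> K"
    and t: "t \<in> words d" "entries t \<subseteq> F" and \<omega>: "\<And>i. i < d - 2 * r \<Longrightarrow> \<omega> i \<in> W"
    and u: "u \<in> K" "realizes d r x (coeff d r \<omega> t) u"
  shows "iter_act (\<lambda>i. transvection (x i) (\<omega> i)) (d - 2 * r) t \<in> K" (is "?v \<in> K")
proof -
  have "?v - u \<in> layer d r" by (rule realizes_unique[OF realizes_raise[OF fr t \<omega>] u(2)])
  then have "?v - u + u \<in> K"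
    using u(1) K by (intro free.subspace_add) (auto simp: lie_submodule_words_iff)
  then show ?thesis by simp
qed

text \<open>One frame serves both a tensor \<open>t\<close> of \<open>K\<close> outside
  \<open>layer d r\<close> and a tensor \<open>t'\<close> of the symmetry part. The span of the
  coefficient functions of \<open>t\<close> is stable and nonzero in \<open>J\<close>, hence equal
  to \<open>J\<close>; so \<open>K\<close> realizes those of \<open>t'\<close>, and
  \<open>regenerate\<close> gives \<open>t'\<close>. The assumption \<open>ne\<close> excludes a
  \<open>J\<close> that captures no tensor outside \<open>layer d r\<close>.\<close>

lemma symmetry_part_cover:
  assumes J: "rel.irreducible (d - 2 * r) J" and ne: "symmetry_part d r J \<noteq> layer d r"
  shows "covers sp (word_mod d) (layer d r) (symmetry_part d r J)"
  unfolding covers_def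
proof (intro conjI allI impI)
  let ?W = "word_mod d" and ?e = "d - 2 * r"
  let ?S = "symmetry_part d r J"
  have st: "rel.stable ?e J" and min: "\<And>L. rel.stable ?e L \<Longrightarrow> L \<subseteq> J \<Longrightarrow> L = {0} \<or> L = J"
    using J unfolding rel.irreducible_def by blast+
  have sub: "funs.subspace J" using st unfolding rel.stable_def by blast
  show "lie_submodule sp ?S ?W" by (rule lie_submodule_symmetry_part[OF sub])
  show "layer d r \<subset> ?S" using layer_subset_symmetry_part[OF sub] ne by blast
  fix K assume asm: "lie_submodule sp K ?W \<and> layer d r \<subseteq> K \<and> K \<subseteq> ?S"
  then have K: "lie_submodule sp K ?W" "layer d r \<subseteq> K" "K \<subseteq> ?S" by auto
  note K' = K(1)[unfolded lie_submodule_words_iff]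
  have "?S \<subseteq> K" if neK: "K \<noteq> layer d r"
  proof
    obtain t where t: "t \<in> K" "t \<notin> layer d r" using neK K(2) by blast
    have tw: "t \<in> words d" using t K' by blast
    fix t' assume t': "t' \<in> ?S"
    then have t'l: "t' \<in> layer d (Suc r)" by (simp add: symmetry_part_def)
    then have t'w: "t' \<in> words d" by (simp add: layer_def)
    let ?F = "entries t \<union> entries t'"
    have "finite ?F" by (simp add: finite_entries)
    then obtain B wd x y where fr: "frame scale \<Omega> ?F (wd ` B) x y ?e" and B: "finite B"
      "B \<subseteq> ?F" "?F \<subseteq> span B"
      "\<And>b b'. b \<in> B \<Longrightarrow> b' \<in> B \<Longrightarrow> \<Omega> b (wd b') = (if b = b' then 1 else 0)"
      "\<And>v. v \<in> ?F \<Longrightarrow> (\<Sum>b\<in>B. scale (\<Omega> v (wd b)) b) = v"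
      by (rule frame_exists[of _ ?e]) blast
    have ent: "entries t \<subseteq> span B" using B(3) by blast
    obtain Is \<omega> where \<omega>: "\<forall>i<?e. \<omega> i \<in> wd ` B" "coeff d r \<omega> t (Is, [0..<?e]) \<noteq> 0"
      by (rule nonzero_coeff[OF tw t(2) ent B(4)]) blast
    let ?L = "coeff_span d r (wd ` B) t"
    have "?L \<subseteq> J" unfolding coeff_span_def
    proof (rule funs.span_minimal[OF _ sub])
      show "{coeff d r \<omega> t |\<omega>. \<forall>i<?e. \<omega> i \<in> wd ` B} \<subseteq> J"
        using t(1) K(3) by (auto simp: symmetry_part_def)
    qed
    moreover have "coeff d r \<omega> t \<in> ?L"
      unfolding coeff_span_def using \<omega>(1) by (intro funs.span_base) blast
    moreover have "coeff d r \<omega> t \<noteq> 0" using \<omega>(2) by (metis zero_fun_apply)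
    ultimately have LJ: "?L = J" using min[OF stable_coeff_span] by blast
    show "t' \<in> K"
    proof (rule regenerate[OF K(1,2) t'l _ fr B(1,2,5)])
      fix \<zeta> assume \<zeta>: "\<And>i. i < ?e \<Longrightarrow> \<zeta> i \<in> wd ` B"
      have "coeff d r \<zeta> t' \<in> ?L" using t' LJ by (simp add: symmetry_part_def)
      then obtain u where "u \<in> K" "realizes d r x (coeff d r \<zeta> t') u"
        using coeff_span_realized[OF fr K(1) t(1)] by blast
      then show "iter_act (\<lambda>i. transvection (x i) (\<zeta> i)) ?e t' \<in> K"
        using \<zeta> by (intro raise_in_submodule[OF fr K(1,2) t'w]) auto
    qed auto
  qed
  then show "K = layer d r \<or> K = ?S" using K(3) by blast
qed

text \<open>Maschke's theorem splits the coefficient functions of \<open>t\<close> into irreducible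
  pieces, each realized in a symmetry part and so in \<open>K\<close>. By linearity \<open>K\<close>
  realizes them all and contains \<open>t\<close> by \<open>regenerate\<close>.\<close>

lemma layer_Suc_subset:
  assumes K: "lie_submodule sp K (word_mod d)" "layer d r \<subseteq> K"
    and cov: "\<And>S. covers sp (word_mod d) (layer d r) S \<Longrightarrow> S \<subseteq> K"
  shows "layer d (Suc r) \<subseteq> K"
proof
  let ?W = "word_mod d" and ?e = "d - 2 * r"
  let ?D = "admissible d r \<times> perm_lists ?e"
  note K' = K(1)[unfolded lie_submodule_words_iff]
  fix t assume t: "t \<in> layer d (Suc r)"
  then have tw: "t \<in> words d" by (simp add: layer_def)
  obtain B wd x y where fr: "frame scale \<Omega> (entries t) (wd ` B) x y ?e" and B: "finite B"
    "B \<subseteq> entries t" "entries t \<subseteq> span B"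
    "\<And>b b'. b \<in> B \<Longrightarrow> b' \<in> B \<Longrightarrow> \<Omega> b (wd b') = (if b = b' then 1 else 0)"
    "\<And>v. v \<in> entries t \<Longrightarrow> (\<Sum>b\<in>B. scale (\<Omega> v (wd b)) b) = v"
    by (rule frame_exists[OF finite_entries[of t], of ?e]) blast
  let ?L = "coeff_span d r (wd ` B) t"
  have supp: "c a = 0" if "c \<in> ?L" "a \<notin> ?D" for c a
    using that(1) unfolding coeff_span_def
  proof (induction rule: funs.span_induct_alt)
    case (step b c c')
    then have "c a = 0" using coeff_outside[OF that(2)] by blast
    then show ?case using step by simp
  qed simp
  have "?L \<subseteq> funs.span ((\<lambda>a b. if a = b then 1 else 0) ` ?D)"
    using funs_in_span_delta[OF finite_coeff_support] supp by blast
  then have L: "?L \<subseteq> funs.span (\<Union>{J. rel.irreducible ?e J \<and> J \<subseteq> ?L})"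
    by (intro rel.in_span_irreducibles[OF _ stable_coeff_span]) (simp_all add: finite_coeff_support)
  have real: "\<exists>u\<in>K. realizes d r x c u" if "c \<in> ?L" for c
    using subsetD[OF L that]
  proof (induction rule: funs.span_induct_alt)
    case base
    show ?case by (rule bexI[of _ 0], rule realizes_zero) (use K' in \<open>simp add: free.subspace_0\<close>)
  next
    case (step a c c')
    then obtain J where J: "rel.irreducible ?e J" "J \<subseteq> ?L" "c \<in> J" by blast
    then have st: "rel.stable ?e J" unfolding rel.irreducible_def by blast
    obtain u where u: "realizes d r x c u"
      using coeff_span_realized[OF fr lie_submodule_layer t order_refl subsetD[OF J(2,3)]] by blast
    have "u \<in> symmetry_part d r J"
      using supp J(2,3) by (intro realizes_in_symmetry_part[OF fr u st J(3)]) blast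
    \<comment> \<open>The symmetry part is a cover unless it equals \<open>layer d r\<close>; in
      both cases it lies in \<open>K\<close>.\<close>
    then have "u \<in> K" using symmetry_part_cover[OF J(1)] cov K(2) by blast
    moreover obtain u' where "u' \<in> K" "realizes d r x c' u'" using step by blast
    ultimately show ?case
      using realizes_add[OF realizes_scale[OF u]] K' by (meson free.subspace_add free.subspace_scale)
  qed
  show "t \<in> K"
  proof (rule regenerate[OF K t order_refl fr B(1,2,5)])
    fix \<zeta> assume \<zeta>: "\<And>i. i < ?e \<Longrightarrow> \<zeta> i \<in> wd ` B"
    have "coeff d r \<zeta> t \<in> ?L" unfolding coeff_span_def using \<zeta> by (intro funs.span_base) blast
    then obtain u where "u \<in> K" "realizes d r x (coeff d r \<zeta> t) u" using real by blast
    then show "iter_act (\<lambda>i. transvection (x i) (\<zeta> i)) ?e t \<in> K"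
      using \<zeta> by (intro raise_in_submodule[OF fr K tw]) auto
  qed
qed

section \<open>From formal sums to tensors\<close>

abbreviation tensor_coset :: "nat \<Rightarrow> ('v list \<Rightarrow>\<^sub>0 'k) \<Rightarrow> ('v list \<Rightarrow>\<^sub>0 'k) set" where
  "tensor_coset d p \<equiv> null d +>\<^bsub>word_mod d\<^esub> p"

lemma tensor_coset_eq: "tensor_coset d p = (\<lambda>n. n + p) ` null d"
  by (auto simp: a_r_coset_def' word_module_simps)

lemma tensor_coset_eq_iff: "tensor_coset d p = tensor_coset d q \<longleftrightarrow> p - q \<in> null d"
proof
  assume "tensor_coset d p = tensor_coset d q"
  moreover have "p \<in> tensor_coset d p"
    unfolding tensor_coset_eq using free.subspace_0[OF subspace_null] by (auto intro: image_eqI[of _ _ 0])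
  ultimately show "p - q \<in> null d" unfolding tensor_coset_eq by auto
next
  assume pq: "p - q \<in> null d"
  show "tensor_coset d p = tensor_coset d q" unfolding tensor_coset_eq
  proof (intro equalityI image_subsetI)
    fix n assume n: "n \<in> null d"
    show "n + p \<in> (\<lambda>n. n + q) ` null d"
      using free.subspace_add[OF subspace_null n pq] by (intro image_eqI[of _ _ "n + (p - q)"]) auto
    show "n + q \<in> (\<lambda>n. n + p) ` null d"
      using free.subspace_diff[OF subspace_null n pq] by (intro image_eqI[of _ _ "n - (p - q)"]) auto
  qed
qed

text \<open>Contractions map relations to relations, so all representatives contribute the same
  coset to the union.\<close>

lemma contraction_tensor_coset:
  assumes "disjoint_index_pairs d Is"
  shows "contraction scale \<Omega> d Is (tensor_coset d p) = tensor_coset (d - 2 * length Is) (contr Is p)"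
proof -
  have "tensor_coset (d - 2 * length Is) (contr Is q) = tensor_coset (d - 2 * length Is) (contr Is p)"
    if q: "q \<in> tensor_coset d p" for q
  proof -
    obtain n where "n \<in> null d" "q = n + p" using q unfolding tensor_coset_eq by blast
    then show ?thesis using contr_null[OF assms] by (simp add: tensor_coset_eq_iff contr_add)
  qed
  moreover have "p \<in> tensor_coset d p"
    unfolding tensor_coset_eq using free.subspace_0[OF subspace_null] by (auto intro: image_eqI[of _ _ 0])
  ultimately show ?thesis unfolding contraction_def Let_def contract_def[symmetric] by blast
qed

sublocale W: lie_mod_sub sp "word_mod d" "null d" for d
  using lie_mod_word_module lie_submodule_layer[of d 0]
  by (simp add: lie_mod_sub_def lie_mod_sub_axioms_def layer_0)

lemma socle_filtration_tensor_power:
  "socle_filtration sp (tensor_mod d) r = tensor_coset d ` layer d r"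
  unfolding tensor_power_def
  by (rule W.socle_filtration_eqI[OF layer_0 lie_submodule_layer layer_mono cover_subset_layer_Suc
        layer_Suc_subset]) blast+

lemma carrier_tensor_power:
  "carrier (tensor_mod d) = tensor_coset d ` words d"
  unfolding tensor_power_def W.quot_carrier by (simp add: word_module_simps)

lemma null_subset_layer: "null d \<subseteq> layer d r"
  by (induction r) (use layer_0 layer_mono in blast)+

text \<open>Supplies the lower bound for the Loewy length: some word has an r-fold contraction equal
  to a tensor power of one vector \<open>x\<close>, and its value at a partner \<open>y\<close> of
  \<open>x\<close> is 1.\<close>

lemma layer_neq_words:
  assumes "2 * r \<le> d" shows "layer d r \<noteq> words d"
proof -
  \<comment> \<open>The pairs (0, 1), (2, 3), ... fit because 2r is at most d.\<close>
  define Is where "Is = map (\<lambda>i. (2 * i, 2 * i + 1)) [0..<r]"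
  have Is: "disjoint_index_pairs d Is" "length Is = r"
    using assms unfolding Is_def disjoint_index_pairs_def
    by (auto simp: distinct_map inj_on_def) presburger
  obtain x y where xy: "\<Omega> x y = 1" using hyperbolic_pair[of "{}"] by auto
  \<comment> \<open>With \<open>y\<close> at the second member of each pair and \<open>x\<close>
    elsewhere, every pair contributes the factor 1 and all free positions carry
    \<open>x\<close>.\<close>
  define vs where "vs = map (\<lambda>i. if i \<in> set (map snd Is) then y else x) [0..<d]"
  have vs: "length vs = d" by (simp add: vs_def)
  have "(\<Prod>(i, j)\<leftarrow>Is. \<Omega> (vs ! i) (vs ! j)) = (\<Prod>(i, j)\<leftarrow>Is. 1)"
  proof (intro arg_cong[of _ _ prod_list] map_cong refl)
    fix ij assume "ij \<in> set Is"
    then obtain i j where ij: "ij = (i, j)" "(i, j) \<in> set Is" by (metis surj_pair)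
    then have "i < d" "j < d" using disjoint_index_pairsD(3)[OF Is(1)] by force+
    moreover have "j \<in> set (map snd Is)" using ij(2) by force
    moreover have "i \<notin> set (map snd Is)"
    proof -
      have "i \<in> set (map fst Is)" using ij(2) by force
      then show ?thesis using disjoint_index_pairsD(1)[OF Is(1)] unfolding inds_def distinct_append by blast
    qed
    ultimately show "(case ij of (i, j) \<Rightarrow> \<Omega> (vs ! i) (vs ! j)) = (case ij of (i, j) \<Rightarrow> 1)"
      unfolding ij(1) vs_def using xy by simp
  qed
  also have "\<dots> = 1" by (induction Is) auto
  finally have one: "(\<Prod>(i, j)\<leftarrow>Is. \<Omega> (vs ! i) (vs ! j)) = 1" .
  have "map ((!) vs) (free_positions d Is) = replicate (d - 2 * r) x"
  proof (rule replicate_eqI)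
    show "length (map ((!) vs) (free_positions d Is)) = d - 2 * r"
      using length_free_positions[OF Is(1)] Is(2) by simp
    fix v assume "v \<in> set (map ((!) vs) (free_positions d Is))"
    then obtain i where "i \<in> set (free_positions d Is)" "v = vs ! i" by auto
    then show "v = x" unfolding set_free_positions vs_def inds_def by simp
  qed
  then have "contr Is (word vs) = word (replicate (d - 2 * r) x)"
    by (simp add: contract_def contract_word_eq[OF vs] one)
  then have "ev (replicate (d - 2 * r) y) (contr Is (word vs)) = 1" by (simp add: ev_word xy)
  moreover have "ev (replicate (d - 2 * r) y) (contr Is (word vs)) = 0" if "word vs \<in> layer d r"
    using that[unfolded layer_iff, THEN conjunct2, rule_format, of Is "replicate (d - 2 * r) y"] Is by simp
  ultimately have "word vs \<notin> layer d r" by auto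
  then show ?thesis using word_in_words[OF vs] by blast
qed

text \<open>Both sets of formal sums contain the relations, so taking preimages turns an equality of
  sets of cosets into one of sets of formal sums.\<close>

lemma tensor_coset_layer_neq:
  assumes "2 * r \<le> d"
  shows "tensor_coset d ` layer d r \<noteq> carrier (tensor_mod d)"
proof
  assume "tensor_coset d ` layer d r = carrier (tensor_mod d)"
  then have "W.preim d (tensor_coset d ` layer d r) = W.preim d (tensor_coset d ` words d)"
    by (simp add: carrier_tensor_power)
  moreover have "lie_submodule sp (words d) (word_mod d)"
    by (simp add: lie_submodule_words_iff subspace_words word_act_in_words)
  ultimately have "layer d r = words d"
    using W.preim_image[OF lie_submodule_layer null_subset_layer] W.preim_image[OF _ null_subset_words] by metis
  then show False using layer_neq_words[OF assms] by blast
qed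

lemma tensor_coset_layer_kernels:
  assumes "2 * r \<le> d"
  shows "tensor_coset d ` layer d r = (\<Inter>Is\<in>{Is. disjoint_index_pairs d Is \<and> length Is = r}.
    a_kernel (tensor_mod d) (tensor_mod (d - 2 * r))
      (contraction scale \<Omega> d Is))"
proof -
  have ker: "tensor_coset d p \<in> a_kernel (tensor_mod d)
      (tensor_mod (d - 2 * r)) (contraction scale \<Omega> d Is) \<longleftrightarrow>
      contr Is p \<in> null (d - 2 * r)"
    if "p \<in> words d" "disjoint_index_pairs d Is" "length Is = r" for p Is
  proof -
    have "tensor_coset (d - 2 * r) (contr Is p) = null (d - 2 * r) \<longleftrightarrow>
        tensor_coset (d - 2 * r) (contr Is p) = tensor_coset (d - 2 * r) 0"
      unfolding tensor_coset_eq[of _ 0] by simp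
    then show ?thesis
      using that tensor_coset_eq_iff[of "d - 2 * r" "contr Is p" 0]
      by (simp add: a_kernel_def' carrier_tensor_power contraction_tensor_coset)
        (simp add: tensor_power_def quot_module_simps)
  qed
  \<comment> \<open>At least one collection exists, since otherwise the layer would be everything.
    Over no collections the intersection would be the universal set instead of the carrier.\<close>
  obtain Is0 where Is0: "disjoint_index_pairs d Is0" "length Is0 = r"
    using layer_neq_words[OF assms] by (auto simp: layer_def)
  show ?thesis
  proof (intro equalityI subsetI)
    fix A assume "A \<in> tensor_coset d ` layer d r"
    then obtain p where "A = tensor_coset d p" "p \<in> layer d r" by blast
    then show "A \<in> (\<Inter>Is\<in>{Is. disjoint_index_pairs d Is \<and> length Is = r}.
        a_kernel (tensor_mod d) (tensor_mod (d - 2 * r))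
          (contraction scale \<Omega> d Is))"
      using ker by (auto simp: layer_def)
  next
    fix A assume A: "A \<in> (\<Inter>Is\<in>{Is. disjoint_index_pairs d Is \<and> length Is = r}.
        a_kernel (tensor_mod d) (tensor_mod (d - 2 * r))
          (contraction scale \<Omega> d Is))"
    then have "A \<in> carrier (tensor_mod d)"
      using Is0 by (auto simp: a_kernel_def')
    then obtain p where p: "p \<in> words d" "A = tensor_coset d p" unfolding carrier_tensor_power by blast
    then have "p \<in> layer d r" using A ker by (auto simp: layer_def)
    then show "A \<in> tensor_coset d ` layer d r" using p(2) by blast
  qed
qed

end

lemma (in symplectic_space) countably_infinite_dim_span_neq_UNIV:
  assumes "countably_infinite_dim scale" "finite F" shows "span F \<noteq> UNIV"
proof
  assume "span F = UNIV"
  obtain B where B: "infinite B" "independent B"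
    using assms(1) by (auto simp: countably_infinite_dim_def)
  then show False using independent_span_bound[OF assms(2) B(2)] \<open>span F = UNIV\<close> by simp
qed

theorem theorem3p2:
  fixes scale :: "'k::field_char_0 \<Rightarrow> 'v::ab_group_add \<Rightarrow> 'v"
    and \<Omega> :: "'v \<Rightarrow> 'v \<Rightarrow> 'k"
    and d :: nat
  assumes "symplectic_space scale \<Omega>"
    and "countably_infinite_dim scale"
  shows "has_Loewy_length (sp_inf scale \<Omega>) (tensor_power scale d) (d div 2 + 1) \<and>
    (\<forall>r\<in>{1..d div 2}.
       socle_filtration (sp_inf scale \<Omega>) (tensor_power scale d) r =
         (\<Inter>Is\<in>{Is. disjoint_index_pairs d Is \<and> length Is = r}.
            a_kernel (tensor_power scale d) (tensor_power scale (d - 2 * r))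
              (contraction scale \<Omega> d Is)))"
proof -
  interpret inf_symplectic scale \<Omega>
    using assms symplectic_space.countably_infinite_dim_span_neq_UNIV
    by (intro inf_symplectic.intro inf_symplectic_axioms.intro) blast+
  \<comment> \<open>No d div 2 + 1 disjoint pairs fit into d positions, so the condition defining
    the layer is vacuous.\<close>
  have "layer d (d div 2 + 1) = words d"
    using disjoint_index_pairs_length by (fastforce simp: layer_def)
  then have "socle_filtration sp (tensor_power scale d) (d div 2 + 1) = carrier (tensor_power scale d)"
    by (simp only: socle_filtration_tensor_power carrier_tensor_power)
  moreover have "socle_filtration sp (tensor_power scale d) l \<noteq> carrier (tensor_power scale d)"
    if "l < d div 2 + 1" for l
    using tensor_coset_layer_neq[of l d] that by (simp add: socle_filtration_tensor_power)
  ultimately have "has_Loewy_length sp (tensor_power scale d) (d div 2 + 1)"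
    by (simp add: has_Loewy_length_def)
  moreover have "socle_filtration sp (tensor_power scale d) r =
      (\<Inter>Is\<in>{Is. disjoint_index_pairs d Is \<and> length Is = r}.
        a_kernel (tensor_power scale d) (tensor_power scale (d - 2 * r)) (contraction scale \<Omega> d Is))"
    if "r \<in> {1..d div 2}" for r
  proof -
    have "r \<le> d div 2" using that by simp
    then have "2 * r \<le> d" by linarith
    then show ?thesis by (simp only: socle_filtration_tensor_power tensor_coset_layer_kernels)
  qed
  ultimately show ?thesis by blast
qed

end
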